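(* Let $a>0$ and for $\Re s>1$ define \[ A(s)=\frac{1}{\Gamma(\frac{s}{2})}\int_a^{+\infty}f(x)\,x^{\frac{s}{2}}\frac{dx}{x}. \] Then $A(s)$ extends to an entire function of $s$, given for all $s\in\mathbf{C}$ by the series \[ A(s)=\sum_{n=1}^\infty \frac{\Gamma(\frac{s}{2},a\alpha_n^2)}{\Gamma(\frac{s}{2})}\frac{1}{\alpha_n^s}. \]
   Context: Let the zeros $\rho$ of the Riemann zeta function with $\Im\rho>0$ be arranged in a sequence $(\rho_n)_{n\ge1}$ with $\Im\rho_{n+1}\ge\Im\rho_n$, each zero repeated according to its multiplicity, and write $\rho_n=\frac12+i\alpha_n$ (so $\Re\alpha_n>0$; the Riemann Hypothesis is not assumed). Powers use the principal branch. For $\Re z>0$, $f(z)=\sum_{n=1}^\infty e^{-\alpha_n^2 z}$. $\Gamma(w,z)=\int_z^\infty t^{w-1}e^{-t}\,dt$ is the upper incomplete gamma function, and $1/\Gamma$ is understood as an entire function. *)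

theory Defs
  imports "HOL-Complex_Analysis.Complex_Analysis"
begin

text \<open>The value at the pole 1 is normalised to 0, so that the analytic continuation is a unique
  total function.\<close>

definition zeta :: "complex \<Rightarrow> complex" where
  "zeta = (THE g. g holomorphic_on - {1} \<and> g 1 = 0 \<and>
      (\<forall>s. Re s > 1 \<longrightarrow> g s = (\<Sum>n. 1 / of_nat (Suc n) powr s)))"

text \<open>Sequences are indexed from 1; the value at index 0 is irrelevant.\<close>

definition upper_zeta_zeros :: "(nat \<Rightarrow> complex) \<Rightarrow> bool" where
  "upper_zeta_zeros \<rho> \<longleftrightarrow>
     (\<forall>n\<ge>1. zeta (\<rho> n) = 0 \<and> Im (\<rho> n) > 0 \<and> Im (\<rho> n) \<le> Im (\<rho> (Suc n))) \<and>
     (\<forall>z. zeta z = 0 \<and> Im z > 0 \<longrightarrow>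
        finite {n. n \<ge> 1 \<and> \<rho> n = z} \<and> int (card {n. n \<ge> 1 \<and> \<rho> n = z}) = zorder zeta z)"

definition theta_series :: "(nat \<Rightarrow> complex) \<Rightarrow> complex \<Rightarrow> complex" where
  "theta_series \<alpha> z = (\<Sum>n. exp (- ((\<alpha> (Suc n))\<^sup>2 * z)))"

text \<open>The path from \<open>z\<close> to infinity is the horizontal ray \<open>t = z + u\<close> with \<open>u \<ge> 0\<close>. It avoids the
  branch cut whenever \<open>z\<close> is not a nonpositive real number.\<close>

definition upper_Gamma :: "complex \<Rightarrow> complex \<Rightarrow> complex" where
  "upper_Gamma w z =
     (LBINT u:{0..}. (z + complex_of_real u) powr (w - 1) * exp (- (z + complex_of_real u)))"

definition A_integrand :: "(nat \<Rightarrow> complex) \<Rightarrow> complex \<Rightarrow> real \<Rightarrow> complex" where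
  "A_integrand \<alpha> s x =
     theta_series \<alpha> (complex_of_real x) * complex_of_real x powr (s / 2) / complex_of_real x"

definition A_fun :: "(nat \<Rightarrow> complex) \<Rightarrow> real \<Rightarrow> complex \<Rightarrow> complex" where
  "A_fun \<alpha> a s = rGamma (s / 2) * (LBINT x:{a..}. A_integrand \<alpha> s x)"

end

theory Submission
  imports Defs
begin

text \<open>
  Once the numbers \<open>\<alpha>\<^sub>n\<^sup>2\<close> are known to have positive real part and to grow at least linearly,
  the theta series is \<open>O(exp (- \<kappa> x))\<close> on \<open>[a, \<infinity>)\<close>, so the integral converges for every \<open>s\<close>, is
  entire, and may be computed term by term; each term is an incomplete gamma function by rotating
  the ray of integration, that is, by the identity theorem in \<open>\<alpha>\<^sub>n\<^sup>2\<close>.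

  The facts about zeta come from the Abel--Plana representation
  \<open>\<zeta>(s, c) = c\<^bsup>1-s\<^esup>/(s - 1) + c\<^bsup>-s\<^esup>/2 + \<integral>\<^sub>0\<^sup>\<infinity> \<i> ((c + \<i>t)\<^bsup>-s\<^esup> - (c - \<i>t)\<^bsup>-s\<^esup>)/(exp (2\<pi>t) - 1) dt\<close>
  of the Hurwitz zeta function. It gives the analytic continuation, the growth bound
  \<open>exp (O(|s|\<^sup>2))\<close> and hence, by a Jensen type inequality, \<open>n = O((1 + Im \<rho>\<^sub>n)\<^sup>2)\<close>. Letting \<open>c \<rightarrow> 0\<close>
  in \<open>\<zeta>(s, c) = c\<^bsup>-s\<^esup> + \<zeta>(s, c + 1)\<close> for \<open>Re s < -1\<close> gives the functional equation. A direct
  estimate of the integral for \<open>c = 1\<close> excludes zeros with \<open>0 < Im \<rho> \<le> |Re \<rho> - 1/2|\<close>, that is,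
  with \<open>Re (\<alpha>\<^sup>2) \<le> 0\<close>.
\<close>

section \<open>Holomorphic parameter integrals\<close>

text \<open>Since Re(\<alpha>^2) = (Im \<rho>)^2 - (Re \<rho> - 1/2)^2, a single low zero far off
  the critical line would keep its term exp(-\<alpha>^2 x) from decaying. Without the Riemann
  Hypothesis such zeros must be excluded numerically, and this favours the Abel--Plana form: the
  integral of 2t/(exp(2 pi t) - 1) is 1/12, so in the wedge in question the integral term is at most
  |s| e/12, while a zero would force it to equal -(s+1)/(2(s-1)). The estimate is made for Re s >=
  1/2; the functional equation serves to reflect the other zeros to that side. The shift c also acts
  at infinity: c -> infinity along the integers identifies the representation with the Dirichlet
  series. The growth bound is crude but sufficient. As |Re \<rho> - 1/2| is bounded, a quadratic
  bound for n in Im \<rho>_n already yields a linear lower bound for Re(\<alpha>_n^2) in n, which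
  makes the exponential series converge geometrically.\<close>

lemma holomorphic_on_integral:
  fixes f :: "complex \<Rightarrow> 'a \<Rightarrow> complex"
  assumes S: "open S"
    and meas: "\<And>s. s \<in> S \<Longrightarrow> f s \<in> borel_measurable M"
    and hol: "\<And>x. x \<in> space M \<Longrightarrow> (\<lambda>s. f s x) holomorphic_on S"
    and dom: "\<And>s0. s0 \<in> S \<Longrightarrow> \<exists>r>0. \<exists>g. integrable M g \<and>
      (\<forall>s\<in>S. dist s0 s \<le> r \<longrightarrow> (\<forall>x\<in>space M. norm (f s x) \<le> g x))"
  shows "(\<lambda>s. \<integral>x. f s x \<partial>M) holomorphic_on S"
  unfolding holomorphic_on_open[OF S]
proof (intro ballI)
  fix s0 assume s0: "s0 \<in> S"
  obtain r0 g where r0: "r0 > 0" and g: "integrable M g" and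
    bd0: "\<And>s x. s \<in> S \<Longrightarrow> dist s0 s \<le> r0 \<Longrightarrow> x \<in> space M \<Longrightarrow> norm (f s x) \<le> g x"
    using dom[OF s0] by metis
  obtain r1 where r1: "r1 > 0" "cball s0 r1 \<subseteq> S"
    using S s0 open_contains_cball by blast
  define r where "r = min r0 r1"
  have r: "r > 0" "cball s0 r \<subseteq> S" using r0 r1 by (auto simp: r_def)
  have bd: "norm (f s x) \<le> g x" if "s \<in> cball s0 r" "x \<in> space M" for s x
    using bd0[of s x] that r by (auto simp: r_def)
  have int: "integrable M (f s)" if "s \<in> cball s0 r" for s
    by (rule Bochner_Integration.integrable_bound[OF g])
       (use meas[of s] that r bd[OF that] in \<open>auto intro!: AE_I2 intro: order_trans[OF _ abs_ge_self]\<close>)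
  \<comment> \<open>Cauchy's inequality on discs of radius \<open>r/2\<close> turns the domination
    of \<open>f\<close> by \<open>g\<close> into the bound \<open>g x / (r/2)\<close> for the
    derivative in \<open>s\<close>. The resulting Lipschitz constant is integrable in
    \<open>x\<close> and dominates the difference quotients.\<close>
  have lip: "norm (f (s0 + h) x - f s0 x) \<le> (g x / (r/2)) * norm h"
    if h: "norm h \<le> r/2" and x: "x \<in> space M" for h x
  proof -
    have holx: "(\<lambda>s. f s x) holomorphic_on cball s0 r"
      using hol[OF x] r holomorphic_on_subset by blast
    have der: "((\<lambda>s. f s x) has_field_derivative deriv (\<lambda>s. f s x) w) (at w within cball s0 (r/2))"
      and bnd: "norm (deriv (\<lambda>s. f s x) w) \<le> g x / (r/2)" if w: "w \<in> cball s0 (r/2)" for w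
    proof -
      have wS: "w \<in> S" using w r by (auto simp: subset_iff)
      show "((\<lambda>s. f s x) has_field_derivative deriv (\<lambda>s. f s x) w) (at w within cball s0 (r/2))"
        using holomorphic_derivI[OF hol[OF x] S wS] by blast
      have sub: "cball w (r/2) \<subseteq> cball s0 r"
        using w by (auto simp: dist_norm) (smt (verit) dist_norm dist_triangle field_sum_of_halves)
      have "norm ((deriv ^^ 1) (\<lambda>s. f s x) w) \<le> fact 1 * g x / (r/2)^1"
      proof (rule Cauchy_inequality)
        show "(\<lambda>s. f s x) holomorphic_on ball w (r/2)"
          using holx sub by (meson ball_subset_cball holomorphic_on_subset order_trans)
        show "continuous_on (cball w (r/2)) (\<lambda>s. f s x)"
          using holx sub by (meson continuous_on_subset holomorphic_on_imp_continuous_on)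
        fix y assume "norm (w - y) = r/2"
        then have "y \<in> cball s0 r" using sub by (auto simp: dist_norm)
        then show "norm (f y x) \<le> g x" using bd x by auto
      qed (use r in auto)
      then show "norm (deriv (\<lambda>s. f s x) w) \<le> g x / (r/2)" by simp
    qed
    have "norm (f (s0 + h) x - f s0 x) \<le> (g x / (r/2)) * norm (s0 + h - s0)"
      by (rule field_differentiable_bound[where S="cball s0 (r/2)" and f="\<lambda>s. f s x", OF _ der bnd])
         (use h r in \<open>auto simp: dist_norm\<close>)
    then show ?thesis by simp
  qed
  define D where "D = (\<integral>x. deriv (\<lambda>s. f s x) s0 \<partial>M)"
  have "((\<lambda>h. ((\<integral>x. f (s0 + h) x \<partial>M) - (\<integral>x. f s0 x \<partial>M)) / h) \<longlongrightarrow> D) (at 0)"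
    unfolding tendsto_at_iff_sequentially
  proof (intro allI impI)
    \<comment> \<open>Dominated convergence speaks of sequences, so an arbitrary sequence of
      increments is tested. Dropping its first \<open>N\<close> terms keeps the others within
      \<open>r/2\<close>, where the Lipschitz bound holds.\<close>
    fix X :: "nat \<Rightarrow> complex" assume X: "\<forall>i. X i \<in> UNIV - {0}" "X \<longlonglongrightarrow> 0"
    obtain N where N: "\<And>i. i \<ge> N \<Longrightarrow> norm (X i) < r/2"
      using X(2) r(1) by (metis LIMSEQ_iff diff_zero half_gt_zero)
    define Y where "Y i = X (i + N)" for i
    have Y0: "Y i \<noteq> 0" "norm (Y i) \<le> r/2" for i
      using X N[of "i+N"] by (auto simp: Y_def)
    have Ylim: "Y \<longlonglongrightarrow> 0" using X(2) unfolding Y_def by (rule LIMSEQ_ignore_initial_segment)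
    have ins: "s0 + Y i \<in> cball s0 r" for i using Y0[of i] r by (auto simp: dist_norm)
    have conv: "(\<lambda>i. (f (s0 + Y i) x - f s0 x) / Y i) \<longlonglongrightarrow> deriv (\<lambda>s. f s x) s0" if x: "x \<in> space M" for x
    proof -
      have "((\<lambda>s. f s x) has_field_derivative deriv (\<lambda>s. f s x) s0) (at s0)"
        using holomorphic_derivI[OF hol[OF x] S s0] by simp
      then have "((\<lambda>h. (f (s0 + h) x - f s0 x) / h) \<longlongrightarrow> deriv (\<lambda>s. f s x) s0) (at 0)"
        by (simp add: DERIV_def)
      then show ?thesis using Y0 Ylim unfolding tendsto_at_iff_sequentially o_def by auto
    qed
    have m1: "(\<lambda>x. (f (s0 + Y i) x - f s0 x) / Y i) \<in> borel_measurable M" for i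
      using meas[of "s0 + Y i"] meas[OF s0] ins[of i] r by auto
    have "(\<lambda>i. \<integral>x. (f (s0 + Y i) x - f s0 x) / Y i \<partial>M) \<longlonglongrightarrow> D"
      unfolding D_def
    proof (rule integral_dominated_convergence[where w="\<lambda>x. g x / (r/2)"])
      show "(\<lambda>x. deriv (\<lambda>s. f s x) s0) \<in> borel_measurable M"
        by (rule borel_measurable_LIMSEQ_metric[OF m1 conv])
      show "integrable M (\<lambda>x. g x / (r/2))" using g by simp
      show "AE x in M. norm ((f (s0 + Y i) x - f s0 x) / Y i) \<le> g x / (r/2)" for i
      proof (rule AE_I2)
        fix x assume x: "x \<in> space M"
        show "norm ((f (s0 + Y i) x - f s0 x) / Y i) \<le> g x / (r/2)"
          using lip[OF Y0(2) x, of i] Y0(1)[of i] by (simp add: norm_divide divide_le_eq)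
      qed
    qed (use m1 conv in auto)
    also have "(\<lambda>i. \<integral>x. (f (s0 + Y i) x - f s0 x) / Y i \<partial>M) =
        (\<lambda>i. ((\<integral>x. f (s0 + Y i) x \<partial>M) - (\<integral>x. f s0 x \<partial>M)) / Y i)"
      using int[OF ins] int[of s0] r by (intro ext) (simp add: diff_divide_distrib)
    finally have "(\<lambda>i. ((\<lambda>h. ((\<integral>x. f (s0 + h) x \<partial>M) - (\<integral>x. f s0 x \<partial>M)) / h) \<circ> X) (i + N)) \<longlonglongrightarrow> D"
      by (simp add: Y_def o_def)
    then show "((\<lambda>h. ((\<integral>x. f (s0 + h) x \<partial>M) - (\<integral>x. f s0 x \<partial>M)) / h) \<circ> X) \<longlonglongrightarrow> D"
      by (rule LIMSEQ_offset)
  qed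
  then show "\<exists>f'. ((\<lambda>s. \<integral>x. f s x \<partial>M) has_field_derivative f') (at s0)"
    by (auto simp: DERIV_def)
qed

lemma holomorphic_on_set_integral:
  fixes f :: "complex \<Rightarrow> 'a \<Rightarrow> complex"
  assumes S: "open S"
    and meas: "\<And>s. s \<in> S \<Longrightarrow> set_borel_measurable M A (f s)"
    and hol: "\<And>x. x \<in> A \<Longrightarrow> (\<lambda>s. f s x) holomorphic_on S"
    and dom: "\<And>s0. s0 \<in> S \<Longrightarrow> \<exists>r>0. \<exists>g. set_integrable M A g \<and>
      (\<forall>s\<in>S. dist s0 s \<le> r \<longrightarrow> (\<forall>x\<in>A. norm (f s x) \<le> g x))"
  shows "(\<lambda>s. LINT x:A|M. f s x) holomorphic_on S"
  unfolding set_lebesgue_integral_def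
proof (rule holomorphic_on_integral[OF S])
  show "(\<lambda>x. indicat_real A x *\<^sub>R f s x) \<in> borel_measurable M" if "s \<in> S" for s
    using meas[OF that] by (simp add: set_borel_measurable_def)
  show "(\<lambda>s. indicat_real A x *\<^sub>R f s x) holomorphic_on S" for x
    by (cases "x \<in> A") (use hol in auto)
  fix s0 assume "s0 \<in> S"
  from dom[OF this] obtain r g where rg: "r > 0" "set_integrable M A g"
    "\<And>s x. s \<in> S \<Longrightarrow> dist s0 s \<le> r \<Longrightarrow> x \<in> A \<Longrightarrow> norm (f s x) \<le> g x" by metis
  show "\<exists>r>0. \<exists>g. integrable M g \<and> (\<forall>s\<in>S. dist s0 s \<le> r \<longrightarrow>
      (\<forall>x\<in>space M. norm (indicat_real A x *\<^sub>R f s x) \<le> g x))"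
    using rg by (intro exI[of _ r] conjI exI[of _ "\<lambda>x. indicat_real A x *\<^sub>R g x"])
       (auto simp: set_integrable_def indicator_def)
qed

text \<open>The principal argument lies between -pi and pi, so the imaginary part of the exponent
  costs a factor that does not depend on \<open>z\<close>. At \<open>z = 0\<close> both sides
  vanish.\<close>

lemma norm_powr_complex_le:
  "norm (z powr w) \<le> norm z powr Re w * exp (pi * \<bar>Im w\<bar>)" for z w :: complex
proof (cases "z = 0")
  case False
  have "\<bar>Im (Ln z)\<bar> \<le> pi" using mpi_less_Im_Ln[OF False] Im_Ln_le_pi[OF False] by linarith
  then have "\<bar>Im w * Im (Ln z)\<bar> \<le> \<bar>Im w\<bar> * pi" by (simp add: abs_mult mult_left_mono)
  then have "- (Im w * Im (Ln z)) \<le> pi * \<bar>Im w\<bar>" by (simp add: mult.commute abs_le_iff)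
  then show ?thesis
    using False by (simp add: powr_def exp_add[symmetric] algebra_simps)
qed auto

lemma powr_le_exp:
  fixes \<delta> \<epsilon> p :: real
  assumes "\<delta> > 0" "\<epsilon> > 0"
  obtains C where "C \<ge> 0" "\<And>x. x \<ge> \<delta> \<Longrightarrow> x powr p \<le> C * exp (\<epsilon> * x)"
proof (cases "p \<le> 0")
  case True
  have "x powr p \<le> \<delta> powr p * exp (\<epsilon> * x)" if "x \<ge> \<delta>" for x
  proof -
    have "x powr p \<le> \<delta> powr p" using True that assms by (intro powr_mono2') auto
    also have "\<dots> \<le> \<delta> powr p * exp (\<epsilon> * x)"
      using that assms by (simp add: mult_le_cancel_left1)
    finally show ?thesis .
  qed
  then show ?thesis using that[of "\<delta> powr p"] by auto
next
  case False
  \<comment> \<open>The function x^p exp(-\<epsilon> x) peaks at x = p/\<epsilon>, which explains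
    the constant; the factor exp(-p) of the exact maximum is dropped.\<close>
  have "x powr p \<le> (p/\<epsilon>) powr p * exp (\<epsilon> * x)" if "x \<ge> \<delta>" for x
  proof -
    have x: "x > 0" using that assms by simp
    have "ln (\<epsilon> * x / p) \<le> \<epsilon> * x / p - 1"
      using x assms False by (intro ln_le_minus_one) auto
    then have "p * ln (\<epsilon> * x / p) \<le> p * (\<epsilon> * x / p)" using False by (intro mult_left_mono) auto
    then have "p * (ln x - ln (p/\<epsilon>)) \<le> \<epsilon> * x"
      using x assms False by (simp add: ln_div ln_mult algebra_simps)
    then have "p * ln x \<le> p * ln (p/\<epsilon>) + \<epsilon> * x" by (simp add: algebra_simps)
    then have "exp (p * ln x) \<le> exp (p * ln (p/\<epsilon>) + \<epsilon> * x)" by simp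
    then show ?thesis using x assms False by (simp add: powr_def exp_add)
  qed
  then show ?thesis using that[of "(p/\<epsilon>) powr p"] by auto
qed

lemma set_borel_measurable_continuous_on:
  fixes f :: "'a::euclidean_space \<Rightarrow> 'b::real_normed_vector"
  assumes "continuous_on A f" "A \<in> sets borel"
  shows "set_borel_measurable lborel A f"
  using borel_measurable_continuous_on_indicator[OF assms(2,1)]
  by (simp add: set_borel_measurable_def)

text \<open>\<open>absolutely_integrable_on\<close> refers to the completed measure, whereas Fubini
  and dominated convergence are applied over \<open>lborel\<close>; Borel measurability allows the
  descent.\<close>

lemma absolutely_integrable_imp_set_integrable_lborel:
  fixes f :: "real \<Rightarrow> 'b::euclidean_space"
  assumes "f absolutely_integrable_on A" "set_borel_measurable lborel A f"
  shows "set_integrable lborel A f"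
  using assms unfolding set_integrable_def set_borel_measurable_def
  by (subst (asm) integrable_completion) auto

lemma set_integrable_exp_Ici:
  fixes c \<kappa> :: real
  assumes "\<kappa> > 0"
  shows "set_integrable lborel {c..} (\<lambda>x. exp (- (\<kappa> * x)))"
proof (rule absolutely_integrable_imp_set_integrable_lborel)
  show "(\<lambda>x. exp (- (\<kappa> * x))) absolutely_integrable_on {c..}"
    using integrable_on_exp_minus_to_infinity[OF assms, of c]
    by (intro nonnegative_absolutely_integrable_1) auto
  show "set_borel_measurable lborel {c..} (\<lambda>x. exp (- (\<kappa> * x)))"
    by (intro set_borel_measurable_continuous_on continuous_intros) auto
qed

text \<open>The positive real axis accumulates at 1 inside a connected domain. This takes the place
  of rotating a contour: an identity proved by a real change of variables for positive
  \<open>w\<close> carries over to Re w > 0.\<close>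

lemma eq_on_right_half_plane:
  assumes f: "f holomorphic_on {w. Re w > 0}" and g: "g holomorphic_on {w. Re w > 0}"
    and eq: "\<And>x. x > 0 \<Longrightarrow> f (complex_of_real x) = g (of_real x)" and w: "Re w > 0"
  shows "f w = g w"
proof -
  have "f w - g w = 0"
  proof (rule analytic_continuation[where f="\<lambda>w. f w - g w" and w=w and \<xi>=1])
    show "(\<lambda>w. f w - g w) holomorphic_on {w. Re w > 0}" using f g by (intro holomorphic_intros)
    show "open {w. Re w > 0}" by (rule open_halfspace_Re_gt)
    show "connected {w. Re w > 0}" using convex_halfspace_Re_gt convex_connected by blast
    show "of_real ` {0<..} \<subseteq> {w. Re w > 0}" by auto
    show "(1::complex) islimpt of_real ` {0<..}"
    proof (rule islimptI)
      fix T :: "complex set" assume "1 \<in> T" "open T"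
      then obtain e where e: "e > 0" "ball 1 e \<subseteq> T" using open_contains_ball by blast
      have "dist (1::complex) (of_real (1 + e/2)) = norm (complex_of_real (e/2))"
        by (simp add: dist_norm norm_minus_commute)
      then have "of_real (1 + e/2) \<in> ball (1::complex) e"
        using e by (simp add: norm_divide)
      moreover have "of_real (1 + e/2) \<in> complex_of_real ` {0<..}" using e by (intro imageI) simp
      moreover have "complex_of_real (1 + e/2) \<noteq> 1" using e by (simp add: complex_eq_iff)
      ultimately show "\<exists>y\<in>complex_of_real ` {0<..}. y \<in> T \<and> y \<noteq> 1" using e by blast
    qed
  qed (use eq w in auto)
  then show ?thesis by simp
qed

lemma powr_of_real_mult:
  assumes "x > 0"
  shows "(complex_of_real x * w) powr z = of_real x powr z * w powr z"
using assms by (intro powr_times_real_left) auto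

lemma powr_of_real_inverse:
  assumes "w > 0"
  shows "complex_of_real (1/w) powr z = of_real w powr (-z)"
proof -
  have "Ln (complex_of_real (1/w)) = - of_real (ln w)"
    using assms by (subst Ln_of_real) (auto simp: ln_div)
  then show ?thesis using assms by (simp add: powr_def Ln_of_real)
qed

lemma norm_of_real_powr:
  "x > 0 \<Longrightarrow> norm (complex_of_real x powr z) = x powr Re z"
  by (simp add: norm_powr_real_powr)

section \<open>Gamma integrals along rotated rays\<close>

lemma set_integrable_powr_exp_Ioi:
  assumes "Re z > 0" "Re w > 0"
  shows "set_integrable lborel {0<..} (\<lambda>x. complex_of_real x powr (z - 1) * exp (- (w * of_real x)))"
proof -
  have "set_integrable lborel {0<..} (\<lambda>x. complex_of_real x powr (z - 1) / of_real (exp (Re w * x)))"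
    by (intro absolutely_integrable_imp_set_integrable_lborel absolutely_integrable_Gamma_integral assms
          set_borel_measurable_continuous_on continuous_intros) auto
  then show ?thesis
    by (rule set_integrable_bound)
       (auto intro!: set_borel_measurable_continuous_on continuous_intros AE_I2
         simp: norm_mult norm_divide norm_exp_eq_Re exp_minus field_simps)
qed

text \<open>For positive real \<open>w\<close> the substitution x -> x/w reduces this to Euler's
  integral. Near \<open>w0\<close> the real part stays above \<open>Re w0 / 2\<close>, which
  supplies the dominating function for holomorphy in \<open>w\<close>.\<close>

lemma integral_powr_exp_Ioi:
  assumes z: "Re z > 0" and w: "Re w > 0"
  shows "(LBINT x:{0<..}. complex_of_real x powr (z - 1) * exp (- (w * of_real x))) = Gamma z * w powr (-z)"
proof -
  define f where "f w = (LBINT x:{0<..}. complex_of_real x powr (z - 1) * exp (- (w * of_real x)))" for w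
  have "f w = Gamma z * w powr (-z)"
  proof (rule eq_on_right_half_plane[OF _ _ _ w, of f])
    show "f holomorphic_on {w. 0 < Re w}"
      unfolding f_def
    proof (rule holomorphic_on_set_integral)
      fix w0 :: complex assume w0: "w0 \<in> {w. 0 < Re w}"
      show "\<exists>r>0. \<exists>g. set_integrable lborel {0<..} g \<and> (\<forall>s\<in>{w. 0 < Re w}. dist w0 s \<le> r \<longrightarrow>
        (\<forall>x\<in>{0<..}. norm (complex_of_real x powr (z - 1) * exp (- (s * of_real x))) \<le> g x))"
      proof (intro exI conjI ballI impI)
        show "Re w0 / 2 > 0" using w0 by simp
        show "set_integrable lborel {0<..} (\<lambda>x. norm (complex_of_real x powr (z - 1) * exp (- (of_real (Re w0/2) * of_real x))))"
          by (intro set_integrable_norm set_integrable_powr_exp_Ioi) (use z w0 in auto)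
        fix s :: complex and x :: real assume *: "dist w0 s \<le> Re w0 / 2" "x \<in> {0<..}"
        have "Re s \<ge> Re w0 / 2" using *(1) abs_Re_le_cmod[of "w0 - s"] by (simp add: dist_norm)
        then show "norm (complex_of_real x powr (z - 1) * exp (- (s * of_real x))) \<le>
          norm (complex_of_real x powr (z - 1) * exp (- (of_real (Re w0/2) * of_real x)))"
          using *(2) by (simp add: norm_mult norm_exp_eq_Re mult_left_mono)
      qed
    qed (auto intro!: open_halfspace_Re_gt set_borel_measurable_continuous_on continuous_intros holomorphic_intros)
    show "(\<lambda>w. Gamma z * w powr (- z)) holomorphic_on {w. 0 < Re w}"
      by (intro holomorphic_intros) (auto simp: complex_nonpos_Reals_iff)
  next
    fix w :: real assume w: "w > 0"
    let ?F = "\<lambda>x. indicat_real {0<..} x *\<^sub>R (complex_of_real x powr (z - 1) * exp (- (of_real w * of_real x)))"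
    let ?h = "\<lambda>x. complex_of_real x powr (z - 1) / of_real (exp x)"
    have si: "set_integrable lborel {0<..} ?h"
      by (intro absolutely_integrable_imp_set_integrable_lborel absolutely_integrable_Gamma_integral' z
          set_borel_measurable_continuous_on continuous_intros) auto
    have G: "(LBINT x:{0<..}. ?h x) = Gamma z"
      using set_borel_integral_eq_integral(2)[OF si] Gamma_integral_complex'[OF z] by (simp add: integral_unique)
    have "f (of_real w) = (\<integral>x. ?F x \<partial>lborel)" by (simp add: f_def set_lebesgue_integral_def)
    also have "\<dots> = \<bar>1/w\<bar> *\<^sub>R (\<integral>x. ?F (0 + (1/w) * x) \<partial>lborel)"
      using w by (intro lborel_integral_real_affine) auto
    also have "(\<lambda>x. ?F (0 + (1/w) * x)) = (\<lambda>x. of_real (1/w) powr (z-1) * (indicat_real {0<..} x *\<^sub>R ?h x))"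
    proof
      fix x show "?F (0 + (1/w) * x) = of_real (1/w) powr (z-1) * (indicat_real {0<..} x *\<^sub>R ?h x)"
      proof (cases "x > 0")
        case True
        then show ?thesis using w powr_of_real_mult[of "1/w" "of_real x" "z-1"]
          by (simp add: exp_minus field_simps exp_of_real)
      next
        case False then show ?thesis using w by (simp add: indicator_def divide_less_0_iff zero_less_divide_iff)
      qed
    qed
    also have "(\<integral>x. of_real (1/w) powr (z-1) * (indicat_real {0<..} x *\<^sub>R ?h x) \<partial>lborel) = of_real (1/w) powr (z-1) * Gamma z"
      unfolding integral_mult_right_zero using G by (simp add: set_lebesgue_integral_def)
    also have "\<bar>1/w\<bar> *\<^sub>R (of_real (1/w) powr (z-1) * Gamma z) = of_real (1/w) powr z * Gamma z"
      using w by (simp add: scaleR_conv_of_real powr_diff)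
    also have "complex_of_real (1/w) powr z = of_real w powr (-z)"
      using w by (rule powr_of_real_inverse)
    finally show "f (of_real w) = Gamma z * of_real w powr (-z)" by simp
  qed
  then show ?thesis by (simp add: f_def)
qed

lemma set_integrable_powr_exp_Ici:
  fixes a \<kappa> p :: real
  assumes "a > 0" "\<kappa> > 0"
  shows "set_integrable lborel {a..} (\<lambda>x. x powr p * exp (- (\<kappa> * x)))"
proof -
  obtain C where C: "C \<ge> 0" "\<And>x. x \<ge> a \<Longrightarrow> x powr p \<le> C * exp (\<kappa>/2 * x)"
    using powr_le_exp[of a "\<kappa>/2" p] assms by auto
  have "set_integrable lborel {a..} (\<lambda>x. C * exp (- (\<kappa>/2 * x)))"
    using set_integrable_exp_Ici[of "\<kappa>/2" a] assms by (intro set_integrable_mult_right) auto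
  then show ?thesis
  proof (rule set_integrable_bound)
    show "set_borel_measurable lborel {a..} (\<lambda>x. x powr p * exp (- (\<kappa> * x)))"
      using assms by (intro set_borel_measurable_continuous_on continuous_intros) auto
    show "AE x in lborel. x \<in> {a..} \<longrightarrow> norm (x powr p * exp (- (\<kappa> * x))) \<le> norm (C * exp (- (\<kappa>/2 * x)))"
    proof (intro AE_I2 impI)
      fix x assume "x \<in> {a..}"
      then have "x powr p * exp (- (\<kappa> * x)) \<le> C * exp (\<kappa>/2 * x) * exp (- (\<kappa> * x))"
        using C(2)[of x] by (intro mult_right_mono) auto
      also have "\<dots> = C * exp (- (\<kappa>/2 * x))" by (simp add: exp_add[symmetric] mult.assoc field_simps)
      finally show "norm (x powr p * exp (- (\<kappa> * x))) \<le> norm (C * exp (- (\<kappa>/2 * x)))" using C by simp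
    qed
  qed
qed

lemma set_integrable_cpowr_exp_Ici:
  assumes "a > 0" "Re w > 0"
  shows "set_integrable lborel {a..} (\<lambda>x. complex_of_real x powr z * exp (- (w * of_real x)))"
  using set_integrable_powr_exp_Ici[OF assms, of "Re z"]
  by (rule set_integrable_bound)
     (use assms in \<open>auto intro!: set_borel_measurable_continuous_on continuous_intros AE_I2
         simp: norm_mult norm_of_real_powr norm_exp_eq_Re\<close>)

text \<open>The ray of integration moves with \<open>z\<close>, so after parametrisation by
  \<open>u\<close> the variable \<open>z\<close> occurs in the integrand alone and the domain [0,
  infinity) is fixed.\<close>

lemma holomorphic_upper_Gamma:
  "upper_Gamma w holomorphic_on {z. Re z > 0}"
  unfolding upper_Gamma_def
proof (rule holomorphic_on_set_integral)
  fix z0 :: complex assume z0: "z0 \<in> {z. 0 < Re z}"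
  \<comment> \<open>Half of the decay exp(-u) is reserved for the power, hence the exponent 1/2. The
    lower bound \<open>Re z0/2\<close> for |s + u| keeps negative powers under control.\<close>
  obtain C where C: "C \<ge> 0" "\<And>x. x \<ge> Re z0/2 \<Longrightarrow> x powr (Re w - 1) \<le> C * exp (1/2 * x)"
    using powr_le_exp[of "Re z0/2" "1/2" "Re w - 1"] z0 by auto
  define D where "D = C * exp (pi * \<bar>Im w\<bar>) * exp ((norm z0 + Re z0 / 2) / 2)"
  show "\<exists>r>0. \<exists>g. set_integrable lborel {0..} g \<and> (\<forall>s\<in>{w. 0 < Re w}. dist z0 s \<le> r \<longrightarrow>
        (\<forall>u\<in>{0..}. norm ((s + complex_of_real u) powr (w - 1) * exp (- (s + complex_of_real u))) \<le> g u))"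
  proof (intro exI conjI ballI impI)
    show "Re z0 / 2 > 0" using z0 by simp
    show "set_integrable lborel {0..} (\<lambda>u::real. D * exp (- (1/2 * u)))"
      by (intro set_integrable_mult_right set_integrable_exp_Ici) auto
    fix s u assume *: "s \<in> {w. 0 < Re w}" "dist z0 s \<le> Re z0 / 2" "u \<in> {0::real..}"
    have "Re s \<ge> Re z0 / 2" using *(2) abs_Re_le_cmod[of "z0 - s"] by (simp add: dist_norm)
    moreover have "Re (s + of_real u) \<le> norm (s + of_real u)" by (rule complex_Re_le_cmod)
    ultimately have n1: "norm (s + of_real u) \<ge> Re z0 / 2" using *(3) by simp
    have "norm (s + of_real u) \<le> norm s + u" using norm_triangle_ineq[of s "of_real u"] *(3) by simp
    moreover have "norm s \<le> norm z0 + Re z0 / 2"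
      using *(2) norm_triangle_ineq2[of s z0] by (simp add: dist_norm norm_minus_commute)
    ultimately have n2: "norm (s + of_real u) \<le> norm z0 + Re z0 / 2 + u" by simp
    have "norm ((s + of_real u) powr (w - 1)) \<le> norm (s + of_real u) powr (Re w - 1) * exp (pi * \<bar>Im w\<bar>)"
      using norm_powr_complex_le[of "s + of_real u" "w - 1"] by simp
    also have "\<dots> \<le> C * exp (1/2 * norm (s + of_real u)) * exp (pi * \<bar>Im w\<bar>)"
      using C(2)[OF n1] by (intro mult_right_mono) auto
    also have "\<dots> \<le> C * exp (1/2 * (norm z0 + Re z0 / 2 + u)) * exp (pi * \<bar>Im w\<bar>)"
      using n2 C by (intro mult_right_mono mult_left_mono) auto
    also have "\<dots> = D * exp (u/2)" by (simp add: D_def exp_add[symmetric] mult.assoc field_simps)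
    finally have "norm ((s + of_real u) powr (w - 1)) \<le> D * exp (u/2)" .
    moreover have "norm (exp (- (s + of_real u))) \<le> exp (- u)" using * by (simp add: norm_exp_eq_Re)
    ultimately have "norm ((s + of_real u) powr (w - 1)) * norm (exp (- (s + of_real u))) \<le> D * exp (u/2) * exp (- u)"
      by (intro mult_mono) (auto simp: D_def C)
    also have "\<dots> = D * exp (- (1/2 * u))" by (simp add: exp_add[symmetric] mult.assoc field_simps)
    finally show "norm ((s + of_real u) powr (w - 1) * exp (- (s + of_real u))) \<le> D * exp (- (1/2 * u))"
      by (simp add: norm_mult)
  qed
next
  show "set_borel_measurable lborel {0..} (\<lambda>u. (s + complex_of_real u) powr (w - 1) * exp (- (s + complex_of_real u)))"
    if "s \<in> {z. 0 < Re z}" for s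
    using that by (intro set_borel_measurable_continuous_on continuous_intros) (auto simp: complex_nonpos_Reals_iff complex_eq_iff)
qed (auto intro!: open_halfspace_Re_gt holomorphic_intros simp: complex_nonpos_Reals_iff)

text \<open>For positive \<open>w\<close> the substitution x = a + u/w sends [a, infinity) to the
  horizontal ray from a w, the path in \<open>upper_Gamma\<close>. For complex \<open>w\<close> the
  image would be a slanted ray; holomorphy of both sides in \<open>w\<close> bridges the
  difference.\<close>

lemma integral_powr_exp_Ici:
  assumes a: "a > 0" and w: "Re w > 0"
  shows "(LBINT x:{a..}. complex_of_real x powr (z - 1) * exp (- (w * of_real x))) =
    upper_Gamma z (of_real a * w) * w powr (-z)"
proof -
  define f where "f w = (LBINT x:{a..}. complex_of_real x powr (z - 1) * exp (- (w * of_real x)))" for w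
  have "f w = upper_Gamma z (of_real a * w) * w powr (-z)"
  proof (rule eq_on_right_half_plane[OF _ _ _ w, of f])
    show "f holomorphic_on {w. 0 < Re w}"
      unfolding f_def
    proof (rule holomorphic_on_set_integral)
      fix w0 :: complex assume w0: "w0 \<in> {w. 0 < Re w}"
      show "\<exists>r>0. \<exists>g. set_integrable lborel {a..} g \<and> (\<forall>s\<in>{w. 0 < Re w}. dist w0 s \<le> r \<longrightarrow>
        (\<forall>x\<in>{a..}. norm (complex_of_real x powr (z - 1) * exp (- (s * of_real x))) \<le> g x))"
      proof (intro exI conjI ballI impI)
        show "Re w0 / 2 > 0" using w0 by simp
        show "set_integrable lborel {a..} (\<lambda>x. x powr (Re z - 1) * exp (- ((Re w0/2) * x)))"
          by (intro set_integrable_powr_exp_Ici) (use a w0 in auto)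
        fix s :: complex and x :: real assume *: "dist w0 s \<le> Re w0 / 2" "x \<in> {a..}"
        have "Re s \<ge> Re w0 / 2" using *(1) abs_Re_le_cmod[of "w0 - s"] by (simp add: dist_norm)
        then have "(Re w0 / 2) * x \<le> Re s * x" using * a by (intro mult_right_mono) auto
        then show "norm (complex_of_real x powr (z - 1) * exp (- (s * of_real x))) \<le>
          x powr (Re z - 1) * exp (- ((Re w0/2) * x))"
          using *(2) a by (simp add: norm_mult norm_exp_eq_Re norm_of_real_powr mult_left_mono)
      qed
    qed (use a in \<open>auto intro!: open_halfspace_Re_gt set_borel_measurable_continuous_on continuous_intros holomorphic_intros\<close>)
    have "(upper_Gamma z \<circ> (\<lambda>w. of_real a * w)) holomorphic_on {w. 0 < Re w}"
      by (intro holomorphic_on_compose_gen[OF _ holomorphic_upper_Gamma] holomorphic_intros) (use a in auto)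
    then show "(\<lambda>w. upper_Gamma z (of_real a * w) * w powr (- z)) holomorphic_on {w. 0 < Re w}"
      by (intro holomorphic_intros) (auto simp: complex_nonpos_Reals_iff o_def)
  next
    fix w :: real assume w: "w > 0"
    let ?F = "\<lambda>x. indicat_real {a..} x *\<^sub>R (complex_of_real x powr (z - 1) * exp (- (of_real w * of_real x)))"
    let ?h = "\<lambda>u. (of_real a * of_real w + complex_of_real u) powr (z - 1) * exp (- (of_real a * of_real w + complex_of_real u))"
    have "f (of_real w) = (\<integral>x. ?F x \<partial>lborel)" by (simp add: f_def set_lebesgue_integral_def)
    also have "\<dots> = \<bar>1/w\<bar> *\<^sub>R (\<integral>x. ?F (a + (1/w) * x) \<partial>lborel)"
      using w by (intro lborel_integral_real_affine) auto
    also have "(\<lambda>x. ?F (a + (1/w) * x)) = (\<lambda>x. of_real (1/w) powr (z-1) * (indicat_real {0..} x *\<^sub>R ?h x))"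
    proof
      fix x show "?F (a + (1/w) * x) = of_real (1/w) powr (z-1) * (indicat_real {0..} x *\<^sub>R ?h x)"
      proof (cases "x \<ge> 0")
        case True
        have eq: "complex_of_real (a + 1/w * x) = of_real (1/w) * (of_real a * of_real w + of_real x)"
          using w by (simp add: field_simps)
        have eq2: "complex_of_real w * (of_real (1/w) * (of_real a * of_real w + of_real x)) = of_real a * of_real w + of_real x"
          using w by simp
        show ?thesis using w True unfolding eq eq2 powr_of_real_mult[OF divide_pos_pos[OF zero_less_one w]]
          by simp
      next
        case False then show ?thesis using w by (simp add: indicator_def divide_less_0_iff zero_le_divide_iff)
      qed
    qed
    also have "(\<integral>x. of_real (1/w) powr (z-1) * (indicat_real {0..} x *\<^sub>R ?h x) \<partial>lborel) = of_real (1/w) powr (z-1) * upper_Gamma z (of_real a * of_real w)"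
      unfolding integral_mult_right_zero by (simp add: set_lebesgue_integral_def upper_Gamma_def)
    also have "\<bar>1/w\<bar> *\<^sub>R (of_real (1/w) powr (z-1) * upper_Gamma z (of_real a * of_real w)) = of_real (1/w) powr z * upper_Gamma z (of_real a * of_real w)"
      using w by (simp add: scaleR_conv_of_real powr_diff)
    also have "complex_of_real (1/w) powr z = of_real w powr (-z)"
      using w by (rule powr_of_real_inverse)
    finally show "f (of_real w) = upper_Gamma z (of_real a * of_real w) * of_real w powr (-z)" by simp
  qed
  then show ?thesis by (simp add: f_def)
qed

lemma integral_real_powr_exp_Ioi:
  fixes p c :: real
  assumes p: "p > -1" and c: "c > 0"
  shows "set_integrable lborel {0<..} (\<lambda>x. x powr p * exp (- (c * x)))"
    and "(LBINT x:{0<..}. x powr p * exp (- (c * x))) = Gamma (p + 1) * c powr (- (p + 1))"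
proof -
  have eq: "complex_of_real x powr (of_real (p + 1) - 1) * exp (- (of_real c * of_real x)) =
      of_real (x powr p * exp (- (c * x)))" if "x \<in> {0<..}" for x
    using that by (simp add: powr_of_real exp_of_real[symmetric])
  have "set_integrable lborel {0<..} (\<lambda>x. complex_of_real x powr (of_real (p + 1) - 1) * exp (- (of_real c * of_real x)))"
    using p c by (intro set_integrable_powr_exp_Ioi) auto
  also have "?this \<longleftrightarrow> set_integrable lborel {0<..} (\<lambda>x. complex_of_real (x powr p * exp (- (c * x))))"
    by (intro set_integrable_cong refl eq) auto
  finally have si: "set_integrable lborel {0<..} (\<lambda>x. complex_of_real (x powr p * exp (- (c * x))))" .
  then show "set_integrable lborel {0<..} (\<lambda>x. x powr p * exp (- (c * x)))"
    using set_integrable_norm[OF si] by (simp add: norm_mult)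
  have "(LBINT x:{0<..}. complex_of_real (x powr p * exp (- (c * x)))) = Gamma (of_real (p + 1)) * of_real c powr (- of_real (p+1))"
  proof -
    have "(LBINT x:{0<..}. complex_of_real (x powr p * exp (- (c * x)))) =
       (LBINT x:{0<..}. complex_of_real x powr (of_real (p + 1) - 1) * exp (- (of_real c * of_real x)))"
      by (intro set_lebesgue_integral_cong) (use eq in auto)
    then show ?thesis using integral_powr_exp_Ioi[of "of_real (p+1)" "of_real c"] p c by simp
  qed
  also have "\<dots> = of_real (Gamma (p + 1) * c powr (- (p + 1)))"
    using c powr_of_real[of c "- (p + 1)"] Gamma_complex_of_real[of "p + 1"] by simp
  finally have "complex_of_real (LBINT x:{0<..}. x powr p * exp (- (c * x))) = of_real (Gamma (p + 1) * c powr (- (p + 1)))"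
    by (simp only: set_integral_complex_of_real)
  then show "(LBINT x:{0<..}. x powr p * exp (- (c * x))) = Gamma (p + 1) * c powr (- (p + 1))"
    using of_real_eq_iff by blast
qed

section \<open>The kernel \<open>1 / (exp (2\<pi>t) - 1)\<close>\<close>

text \<open>The Bose--Einstein factor that weights the Abel--Plana formula. Its geometric expansion
  in exp(-2 pi n t) turns integrals against it into sums of Laplace transforms at the points 2 pi
  n.\<close>

definition bose :: "real \<Rightarrow> real" where
  "bose t = 1 / (exp (2 * pi * t) - 1)"

lemma bose_pos: "t > 0 \<Longrightarrow> bose t > 0"
  by (simp add: bose_def)

text \<open>The denominator is exp(pi t) times 2 sinh(pi t). The hyperbolic sine absorbs the simple
  pole at 0, and half of the exponential decay survives.\<close>

lemma mult_bose_le: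
  assumes "t > 0" shows "t * bose t \<le> exp (- (pi * t)) / pi"
proof -
  have "exp (pi * t) - exp (- (pi * t)) \<ge> pi * t"
    using exp_ge_add_one_self[of "pi * t"] assms by (smt (verit) exp_le_one_iff mult_pos_pos pi_gt_zero)
  then have "exp (pi * t) * (pi * t) \<le> exp (pi * t) * (exp (pi * t) - exp (- (pi * t)))"
    by (intro mult_left_mono) auto
  also have "\<dots> = exp (2 * pi * t) - 1"
    by (simp add: right_diff_distrib flip: exp_add)
  finally have "exp (pi * t) * (pi * t) \<le> exp (2 * pi * t) - 1" .
  moreover have "exp (2 * pi * t) - 1 > 0" using assms by simp
  ultimately have "t * bose t \<le> t / (exp (pi * t) * (pi * t))"
    unfolding bose_def times_divide_eq_right mult_1_right using assms by (intro divide_left_mono mult_pos_pos) auto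
  also have "\<dots> = exp (- (pi * t)) / pi" using assms by (simp add: exp_minus field_simps)
  finally show ?thesis .
qed

lemma continuous_on_bose: "continuous_on {0<..} bose"
  unfolding bose_def by (intro continuous_intros) auto

lemma bose_sums:
  assumes "t > 0"
  shows "(\<lambda>n. exp (- (2 * pi * real (Suc n) * t))) sums bose t"
proof -
  define q where "q = exp (- (2 * pi * t))"
  have q: "0 < q" "q < 1" using assms by (auto simp: q_def)
  have "(\<lambda>n. q * q ^ n) sums (q * (1 / (1 - q)))"
    using q by (intro sums_mult geometric_sums) auto
  moreover have "q * (1 / (1 - q)) = bose t"
    using assms by (simp add: bose_def q_def exp_minus field_simps)
  moreover have "q * q ^ n = exp (- (2 * pi * real (Suc n) * t))" for n
    by (simp add: q_def flip: exp_of_nat_mult exp_add) (simp add: algebra_simps)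
  ultimately show ?thesis by simp
qed

lemma summable_powr_Suc:
  fixes p c :: real
  assumes "p > 1" "c > 0"
  shows "summable (\<lambda>n. (c * real (Suc n)) powr (- p))"
proof -
  have "summable (\<lambda>n. real n powr (- p))"
    using assms by (subst summable_real_powr_iff) auto
  then have "summable (\<lambda>n. real (Suc n) powr (- p))"
    by (subst summable_Suc_iff)
  then have "summable (\<lambda>n. c powr (- p) * real (Suc n) powr (- p))" by (rule summable_mult)
  then show ?thesis using assms by (subst powr_mult)
qed

text \<open>By the Gamma integral the n-th term of the expanded kernel contributes at most a
  multiple of n^(-p-1). This is summable because p > 0, which justifies integrating term by
  term.\<close>

lemma
  fixes h :: "real \<Rightarrow> complex"
  assumes p: "p > 0" and h: "\<And>t. t > 0 \<Longrightarrow> norm (h t) \<le> C * t powr p"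
    and hm: "set_borel_measurable lborel {0<..} h"
  shows set_integrable_mult_bose: "set_integrable lborel {0<..} (\<lambda>t. h t * of_real (bose t))"
    and integral_mult_bose_sums:
      "(\<lambda>n. LBINT t:{0<..}. h t * of_real (exp (- (2 * pi * real (Suc n) * t)))) sums
        (LBINT t:{0<..}. h t * of_real (bose t))"
proof -
  define f where "f n t = indicat_real {0<..} t *\<^sub>R (h t * of_real (exp (- (2 * pi * real (Suc n) * t))))" for n t
  have C: "C \<ge> 0" using order_trans[OF norm_ge_zero h[of 1]] by simp
  have dom: "set_integrable lborel {0<..} (\<lambda>t. C * (t powr p * exp (- (2 * pi * real (Suc n) * t))))" for n
    using p by (intro set_integrable_mult_right integral_real_powr_exp_Ioi) auto
  have bd: "norm (h t * of_real (exp (- (2 * pi * real (Suc n) * t)))) \<le>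
      C * (t powr p * exp (- (2 * pi * real (Suc n) * t)))" if "t > 0" for t n
    using h[OF that] by (simp add: norm_mult mult_right_mono mult.assoc[symmetric])
  have int: "set_integrable lborel {0<..} (\<lambda>t. h t * of_real (exp (- (2 * pi * real (Suc n) * t))))" for n
    using dom[of n]
  proof (rule set_integrable_bound)
    have "set_borel_measurable lborel {0<..} (\<lambda>t::real. exp (- (2 * pi * real (Suc n) * t)))"
      by (intro set_borel_measurable_continuous_on continuous_intros) auto
    then have "(\<lambda>t. (indicat_real {0<..} t *\<^sub>R h t) * of_real (indicat_real {0<..} t *\<^sub>R exp (- (2 * pi * real (Suc n) * t)))) \<in> borel_measurable lborel"
      using hm unfolding set_borel_measurable_def by measurable
    also have "(\<lambda>t. (indicat_real {0<..} t *\<^sub>R h t) * of_real (indicat_real {0<..} t *\<^sub>R exp (- (2 * pi * real (Suc n) * t)))) =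
        (\<lambda>t. indicat_real {0<..} t *\<^sub>R (h t * of_real (exp (- (2 * pi * real (Suc n) * t)))))"
      by (auto simp: indicator_def fun_eq_iff)
    finally show "set_borel_measurable lborel {0<..} (\<lambda>t. h t * of_real (exp (- (2 * pi * real (Suc n) * t))))"
      by (simp add: set_borel_measurable_def)
    show "AE t in lborel. t \<in> {0<..} \<longrightarrow> norm (h t * of_real (exp (- (2 * pi * real (Suc n) * t)))) \<le>
        norm (C * (t powr p * exp (- (2 * pi * real (Suc n) * t))))"
      using bd C by (intro AE_I2 impI) (smt (verit) greaterThan_iff real_norm_def)
  qed
  have f1: "integrable lborel (f n)" for n
    using int[of n] by (simp only: f_def[abs_def] set_integrable_def)
  have pt: "(\<lambda>n. f n t) sums (indicat_real {0<..} t *\<^sub>R (h t * of_real (bose t)))" for t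
  proof (cases "t > 0")
    case True
    then show ?thesis unfolding f_def
      by (intro sums_scaleR_right sums_mult sums_of_real bose_sums)
  qed (auto simp: f_def)
  have f2: "AE t in lborel. summable (\<lambda>n. norm (f n t))"
  proof (rule AE_I2)
    fix t show "summable (\<lambda>n. norm (f n t))"
    proof (cases "t > 0")
      case True
      then have "(\<lambda>n. norm (f n t)) = (\<lambda>n. norm (h t) * exp (- (2 * pi * real (Suc n) * t)))"
        by (auto simp: f_def norm_mult)
      then show ?thesis using bose_sums[OF True] by (auto intro!: summable_mult simp: sums_iff)
    qed (auto simp: f_def)
  qed
  have f3: "summable (\<lambda>n. \<integral>t. norm (f n t) \<partial>lborel)"
  proof (rule summable_comparison_test')
    have "summable (\<lambda>n. (2 * pi * real (Suc n)) powr (- (p + 1)))"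
      using p by (intro summable_powr_Suc) auto
    then show "summable (\<lambda>n. C * (Gamma (p + 1) * (2 * pi * real (Suc n)) powr (- (p + 1))))"
      by (intro summable_mult)
    fix n :: nat
    have "(\<integral>t. norm (f n t) \<partial>lborel) \<le> (LBINT t:{0<..}. C * (t powr p * exp (- (2 * pi * real (Suc n) * t))))"
      unfolding set_lebesgue_integral_def
    proof (rule integral_mono)
      show "integrable lborel (\<lambda>t. norm (f n t))" using f1 by (rule integrable_norm)
      show "integrable lborel (\<lambda>t. indicat_real {0<..} t *\<^sub>R (C * (t powr p * exp (- (2 * pi * real (Suc n) * t)))))"
        using dom[of n] by (simp only: set_integrable_def)
      show "norm (f n t) \<le> indicat_real {0<..} t *\<^sub>R (C * (t powr p * exp (- (2 * pi * real (Suc n) * t))))" for t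
        using bd[of t n] by (auto simp: f_def indicator_def simp del: of_nat_Suc)
    qed
    also have "\<dots> = C * (Gamma (p + 1) * (2 * pi * real (Suc n)) powr (- (p + 1)))"
      using p by (subst set_integral_mult_right, subst integral_real_powr_exp_Ioi(2)) auto
    finally show "norm (\<integral>t. norm (f n t) \<partial>lborel) \<le> C * (Gamma (p + 1) * (2 * pi * real (Suc n)) powr (- (p + 1)))"
      by simp
  qed
  have eq: "(\<lambda>t. \<Sum>n. f n t) = (\<lambda>t. indicat_real {0<..} t *\<^sub>R (h t * of_real (bose t)))"
    using pt by (auto simp: sums_iff fun_eq_iff)
  show "set_integrable lborel {0<..} (\<lambda>t. h t * of_real (bose t))"
    using integrable_suminf[OF f1 f2 f3] by (simp add: eq set_integrable_def)
  show "(\<lambda>n. LBINT t:{0<..}. h t * of_real (exp (- (2 * pi * real (Suc n) * t)))) sums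
        (LBINT t:{0<..}. h t * of_real (bose t))"
    using sums_integral[OF f1 f2 f3] unfolding eq by (simp only: set_lebesgue_integral_def f_def)
qed

section \<open>Partial fractions of the cotangent from the digamma function, and Legendre's
  integral\<close>

lemma Digamma_diff_sums:
  fixes z :: complex
  assumes "z \<notin> \<int>"
  shows "(\<lambda>k. 2 * z / (of_nat (Suc k) ^ 2 - z ^ 2)) sums (Digamma (1 + z) - Digamma (1 - z))"
proof -
  have nz: "of_nat (Suc k) + z \<noteq> 0" "of_nat (Suc k) - z \<noteq> 0" for k
  proof -
    show "of_nat (Suc k) + z \<noteq> 0"
      using assms by (metis Ints_minus Ints_of_nat add.inverse_inverse eq_neg_iff_add_eq_0)
    show "of_nat (Suc k) - z \<noteq> 0"
      using assms by (metis Ints_of_nat eq_iff_diff_eq_0)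
  qed
  have nz1: "1 + z \<noteq> 0" "1 - z \<noteq> 0" using nz[of 0] by auto
  have "(\<lambda>k. (inverse (of_nat (Suc k)) - inverse ((1 + z) + of_nat k)) -
      (inverse (of_nat (Suc k)) - inverse ((1 - z) + of_nat k))) sums
      ((\<Sum>k. inverse (of_nat (Suc k)) - inverse ((1 + z) + of_nat k)) -
       (\<Sum>k. inverse (of_nat (Suc k)) - inverse ((1 - z) + of_nat k)))"
    using summable_Digamma[OF nz1(1)] summable_Digamma[OF nz1(2)] by (intro sums_diff summable_sums)
  moreover have "(inverse (of_nat (Suc k)) - inverse ((1 + z) + of_nat k)) -
      (inverse (of_nat (Suc k)) - inverse ((1 - z) + of_nat k)) = 2 * z / (of_nat (Suc k) ^ 2 - z ^ 2)" for k
  proof -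
    have "inverse (of_nat (Suc k) - z) - inverse (of_nat (Suc k) + z) = 2 * z / ((of_nat (Suc k) - z) * (of_nat (Suc k) + z))"
      using nz[of k] by (simp add: field_simps del: of_nat_Suc)
    then show ?thesis by (simp add: power2_eq_square algebra_simps)
  qed
  ultimately show ?thesis by (simp add: Digamma_def)
qed

text \<open>Differentiate Gamma(1+w) Gamma(1-w) sin(pi w) = pi w on both sides and divide by the
  product of the Gamma factors, which has no zero.\<close>

lemma Digamma_reflection:
  fixes z :: complex
  assumes "z \<notin> \<int>"
  shows "Digamma (1 + z) - Digamma (1 - z) = 1 / z - of_real pi * cos (of_real pi * z) / sin (of_real pi * z)"
proof -
  have z0: "z \<noteq> 0" using assms by auto
  have n1: "1 + z \<notin> \<int>\<^sub>\<le>\<^sub>0" and n2: "1 - z \<notin> \<int>\<^sub>\<le>\<^sub>0"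
    using assms by (metis Ints_diff Ints_1 add_diff_cancel_left' nonpos_Ints_Int)
       (metis assms Ints_diff Ints_1 diff_diff_eq2 add_diff_cancel_left' nonpos_Ints_Int)
  have sn: "sin (of_real pi * z) \<noteq> 0"
  proof
    assume "sin (of_real pi * z) = 0"
    then obtain n where "of_real pi * z = complex_of_real (of_int n * pi)" by (auto simp: sin_eq_0)
    then have "z = of_int n" by (simp add: mult.commute)
    then show False using assms by simp
  qed
  have eq: "Gamma (1 + w) * Gamma (1 - w) * sin (of_real pi * w) = of_real pi * w" if "w \<notin> \<int>" for w :: complex
  proof -
    have "sin (of_real pi * w) \<noteq> 0"
    proof
      assume "sin (of_real pi * w) = 0"
      then obtain n where "of_real pi * w = complex_of_real (of_int n * pi)" by (auto simp: sin_eq_0)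
      then have "w = of_int n" by (simp add: mult.commute)
      then show False using that by simp
    qed
    moreover have "Gamma (1 + w) = w * Gamma w"
      using that Gamma_plus1[of w] nonpos_Ints_Int by (metis add.commute)
    ultimately show ?thesis using Gamma_reflection_complex[of w] by (simp add: field_simps)
  qed
  have op: "open (- \<int> :: complex set)" by (simp add: open_Compl)
  let ?L = "\<lambda>w. Gamma (1 + w) * Gamma (1 - w) * sin (of_real pi * w)"
  have d1: "(?L has_field_derivative (Gamma (1+z) * Gamma (1-z) *
      ((Digamma (1 + z) - Digamma (1 - z)) * sin (of_real pi * z) + of_real pi * cos (of_real pi * z)))) (at z)"
    by (rule derivative_eq_intros refl n1 n2 | simp add: algebra_simps)+
  have "((\<lambda>w. of_real pi * w) has_field_derivative of_real pi) (at z)"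
    by (rule derivative_eq_intros refl | simp)+
  then have d2: "(?L has_field_derivative of_real pi) (at z)"
    by (rule DERIV_cong_ev[THEN iffD2, rotated 3])
       (use eventually_nhds_in_open[OF op, of z] assms eq in \<open>auto elim!: eventually_mono\<close>)
  have "Gamma (1+z) * Gamma (1-z) *
      ((Digamma (1 + z) - Digamma (1 - z)) * sin (of_real pi * z) + of_real pi * cos (of_real pi * z)) = of_real pi"
    by (rule DERIV_unique[OF d1 d2])
  also have "of_real pi = Gamma (1+z) * Gamma (1-z) * (sin (of_real pi * z) / z)"
    using eq[OF assms] z0 by (simp add: field_simps)
  finally have "(Digamma (1 + z) - Digamma (1 - z)) * sin (of_real pi * z) + of_real pi * cos (of_real pi * z) = sin (of_real pi * z) / z"
    using n1 n2 by (subst (asm) mult_cancel_left) (auto simp: Gamma_eq_zero_iff)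
  then show ?thesis using sn z0 by (simp add: field_simps)
qed

text \<open>This is the partial fraction series of pi cot(pi z) at z = i x/(2 pi), where the
  cotangent becomes -i coth(x/2).\<close>

lemma inverse_exp_minus_one_sums:
  fixes x :: real
  assumes x: "x > 0"
  shows "(\<lambda>n. 2 * x / ((2 * pi * real (Suc n))\<^sup>2 + x\<^sup>2)) sums (1 / (exp x - 1) - 1 / x + 1 / 2)"
proof -
  define z where "z = \<i> * of_real (x / (2 * pi))"
  have z: "z \<notin> \<int>" 
  proof
    assume "z \<in> \<int>" then have "Im z = 0" by (auto elim!: Ints_cases)
    then show False using x by (simp add: z_def)
  qed
  have z2: "z ^ 2 = - of_real ((x / (2*pi))^2)" by (simp add: z_def power_mult_distrib power_divide)
  have "2 * z / (of_nat (Suc k) ^ 2 - z ^ 2) = (2 * pi * \<i>) * of_real (2 * x / ((2 * pi * real (Suc k))\<^sup>2 + x\<^sup>2))" for k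
  proof -
    have "(of_nat (Suc k) ^ 2 - z ^ 2) = complex_of_real ((real (Suc k))^2 + (x / (2*pi))^2)"
      by (simp add: z2)
    then have "2 * z / (of_nat (Suc k) ^ 2 - z ^ 2) = \<i> * of_real ((2 * (x / (2 * pi))) / ((real (Suc k))^2 + (x / (2*pi))^2))"
      by (simp add: z_def)
    also have "(2 * (x / (2 * pi))) / ((real (Suc k))^2 + (x / (2*pi))^2) = 2 * pi * (2 * x / ((2 * pi * real (Suc k))\<^sup>2 + x\<^sup>2))"
    proof -
      have "(2 * (x / (2 * pi))) / ((real (Suc k))^2 + (x / (2*pi))^2) = ((2*pi)^2 * (2 * (x / (2 * pi)))) / ((2*pi)^2 * ((real (Suc k))^2 + (x / (2*pi))^2))"
        by (subst mult_divide_mult_cancel_left) auto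
      also have "(2*pi)^2 * (2 * (x / (2 * pi))) = 2 * pi * (2 * x)" by (simp add: power2_eq_square)
      also have "(2*pi)^2 * ((real (Suc k))^2 + (x / (2*pi))^2) = (2 * pi * real (Suc k))\<^sup>2 + x\<^sup>2"
        by (simp add: power_mult_distrib power_divide distrib_left del: of_nat_Suc)
      finally show ?thesis by simp
    qed
    finally show ?thesis by (simp add: mult_ac)
  qed
  then have "(\<lambda>k. (2 * pi * \<i>) * of_real (2 * x / ((2 * pi * real (Suc k))\<^sup>2 + x\<^sup>2))) sums
      (1 / z - of_real pi * cos (of_real pi * z) / sin (of_real pi * z))"
    using Digamma_diff_sums[OF z] Digamma_reflection[OF z] by simp
  then have s0: "(\<lambda>k. inverse (2 * pi * \<i>) * ((2 * pi * \<i>) * of_real (2 * x / ((2 * pi * real (Suc k))\<^sup>2 + x\<^sup>2)))) sums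
      (inverse (2 * pi * \<i>) * (1 / z - of_real pi * cos (of_real pi * z) / sin (of_real pi * z)))"
    by (rule sums_mult)
  have s: "(\<lambda>k. complex_of_real (2 * x / ((2 * pi * real (Suc k))\<^sup>2 + x\<^sup>2))) sums
      (inverse (2 * pi * \<i>) * (1 / z - of_real pi * cos (of_real pi * z) / sin (of_real pi * z)))"
  proof -
    have "inverse c * (c * w) = w" if "c \<noteq> 0" for c w :: complex using that by simp
    from this[of "2 * pi * \<i>"] have "inverse (2 * pi * \<i>) * ((2 * pi * \<i>) * w) = w" for w by simp
    then show ?thesis using s0 by (simp only:)
  qed
  have eq: "of_real pi * z = \<i> * of_real (x/2)" by (simp add: z_def)
  have cs: "cos (of_real pi * z) / sin (of_real pi * z) = - \<i> * of_real ((exp x + 1) / (exp x - 1))"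
  proof -
    define E where "E = exp (x/2)"
    have E: "E > 1" using x by (simp add: E_def)
    have ii: "\<i> * (\<i> * of_real (x/2)) = complex_of_real (- (x/2))" by (simp add: complex_eq_iff)
    have e1: "exp (\<i> * (\<i> * of_real (x/2))) = complex_of_real (1/E)"
      unfolding ii exp_of_real by (simp add: E_def exp_minus inverse_eq_divide)
    have e2: "exp (- (\<i> * (\<i> * of_real (x/2)))) = complex_of_real E"
      unfolding ii of_real_minus[symmetric] exp_of_real by (simp add: E_def)
    have ex: "exp x = E^2" by (simp add: E_def power2_eq_square flip: exp_add)
    have c1: "cos (\<i> * of_real (x/2)) = complex_of_real (1/E + E) / 2"
      unfolding cos_exp_eq e1 e2 by simp
    have s1: "sin (\<i> * of_real (x/2)) = complex_of_real (1/E - E) / (2*\<i>)"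
      unfolding sin_exp_eq e1 e2 by simp
    have "(A/2) / (B/(2*\<i>)) = \<i> * (A/B)" for A B :: complex by (cases "B = 0") (auto simp: field_simps)
    then have "cos (of_real pi * z) / sin (of_real pi * z) = \<i> * of_real ((1/E + E) / (1/E - E))"
      unfolding eq c1 s1 by (simp only: of_real_divide)
    also have "(1/E + E) / (1/E - E) = - ((exp x + 1) / (exp x - 1))"
    proof -
      have "(1/E + E) / (1/E - E) = (E * (1/E + E)) / (E * (1/E - E))" using E by simp
      also have "\<dots> = (1 + E^2) / (1 - E^2)" using E by (simp add: distrib_left right_diff_distrib power2_eq_square)
      finally show ?thesis unfolding ex by (simp add: minus_divide_right add.commute)
    qed
    finally show ?thesis by simp
  qed
  have "inverse (2 * pi * \<i>) * (1 / z - of_real pi * cos (of_real pi * z) / sin (of_real pi * z))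
     = inverse (2 * pi * \<i>) * (1/z) - inverse (2 * \<i>) * (cos (of_real pi * z) / sin (of_real pi * z))"
    by (simp add: right_diff_distrib)
  also have "inverse (2 * pi * \<i>) * (1/z) = of_real (- (1 / x))"
    by (simp add: z_def field_simps)
  also have "inverse (2 * \<i>) * (cos (of_real pi * z) / sin (of_real pi * z)) = of_real (- ((exp x + 1) / (exp x - 1) / 2))"
  proof -
    have "inverse (2 * \<i>) * (- \<i> * w) = - (w / 2)" for w by (simp add: field_simps)
    then show ?thesis unfolding cs by (simp only: of_real_minus of_real_divide of_real_numeral)
  qed
  also have "complex_of_real (- (1/x)) - of_real (- ((exp x + 1) / (exp x - 1) / 2)) = of_real (- (1/x) + (exp x + 1) / (exp x - 1) / 2)"
    by simp
  also have "- (1/x) + (exp x + 1) / (exp x - 1) / 2 = 1 / (exp x - 1) - 1 / x + 1 / 2"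
    using x by (simp add: field_simps)
  finally have "(\<lambda>k. complex_of_real (2 * x / ((2 * pi * real (Suc k))\<^sup>2 + x\<^sup>2))) sums of_real (1 / (exp x - 1) - 1 / x + 1 / 2)"
    using s by simp
  then show ?thesis by (simp only: sums_of_real_iff)
qed

lemma integral_exp_Ioi:
  assumes "Re w > 0"
  shows "set_integrable lborel {0<..} (\<lambda>t. exp (- (w * complex_of_real t)))"
    and "(LBINT t:{0<..}. exp (- (w * complex_of_real t))) = 1 / w"
proof -
  have w: "w \<noteq> 0" using assms by auto
  have "set_integrable lborel {0<..} (\<lambda>t. complex_of_real t powr (1 - 1) * exp (- (w * of_real t)))"
    using assms by (intro set_integrable_powr_exp_Ioi) auto
  then show "set_integrable lborel {0<..} (\<lambda>t. exp (- (w * complex_of_real t)))"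
    by (subst set_integrable_cong[OF refl refl]) auto
  have "(LBINT t:{0<..}. exp (- (w * complex_of_real t))) =
      (LBINT t:{0<..}. complex_of_real t powr (1 - 1) * exp (- (w * of_real t)))"
    by (intro set_lebesgue_integral_cong) auto
  also have "\<dots> = 1 / w"
    using integral_powr_exp_Ioi[of 1 w] assms w by (simp add: powr_minus inverse_eq_divide)
  finally show "(LBINT t:{0<..}. exp (- (w * complex_of_real t))) = 1 / w" .
qed

lemma integral_sin_exp_Ioi:
  fixes x c :: real
  assumes "c > 0"
  shows "(LBINT t:{0<..}. complex_of_real (2 * sin (t * x)) * of_real (exp (- (c * t)))) =
    of_real (2 * x / (c\<^sup>2 + x\<^sup>2))"
proof -
  let ?p = "of_real c + \<i> * of_real x" and ?m = "of_real c - \<i> * of_real x"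
  have eq: "complex_of_real (2 * sin (t * x)) * of_real (exp (- (c * t))) =
      \<i> * exp (- (?p * of_real t)) - \<i> * exp (- (?m * of_real t))" for t
  proof -
    have "complex_of_real (2 * sin (t * x)) = \<i> * exp (- (\<i> * of_real (t * x))) - \<i> * exp (\<i> * of_real (t * x))"
      unfolding of_real_mult of_real_numeral sin_of_real[symmetric] sin_exp_eq by (simp add: field_simps)
    moreover have "exp (- (?p * of_real t)) = exp (- (\<i> * of_real (t * x))) * of_real (exp (- (c * t)))"
      "exp (- (?m * of_real t)) = exp (\<i> * of_real (t * x)) * of_real (exp (- (c * t)))"
      by (simp_all add: exp_of_real[symmetric] algebra_simps flip: exp_add)
    ultimately show ?thesis by (simp only: left_diff_distrib mult.assoc)
  qed
  have "(LBINT t:{0<..}. complex_of_real (2 * sin (t * x)) * of_real (exp (- (c * t)))) =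
      (LBINT t:{0<..}. \<i> * exp (- (?p * of_real t)) - \<i> * exp (- (?m * of_real t)))"
    by (simp only: eq)
  also have "\<dots> = (LBINT t:{0<..}. \<i> * exp (- (?p * of_real t))) - (LBINT t:{0<..}. \<i> * exp (- (?m * of_real t)))"
    using assms by (intro set_integral_diff set_integrable_mult_right integral_exp_Ioi) auto
  also have "\<dots> = \<i> * (1 / ?p) - \<i> * (1 / ?m)"
    using assms by (simp add: integral_exp_Ioi)
  also have "\<dots> = of_real (2 * x / (c\<^sup>2 + x\<^sup>2))"
  proof -
    have nz: "?p \<noteq> 0" "?m \<noteq> 0" using assms by (auto simp: complex_eq_iff)
    have "\<i> * (1 / ?p) - \<i> * (1 / ?m) = \<i> * (?m - ?p) / (?p * ?m)"
      using nz by (simp add: field_simps)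
    also have "\<i> * (?m - ?p) = of_real (2 * x)" by (simp add: complex_eq_iff)
    also have "?p * ?m = of_real (c\<^sup>2 + x\<^sup>2)" by (simp add: algebra_simps power2_eq_square)
    finally show ?thesis by simp
  qed
  finally show ?thesis .
qed

text \<open>Legendre's integral. The kernel expands into exponentials exp(-2 pi n t), whose sine
  transforms are exactly the partial fractions in \<open>inverse_exp_minus_one_sums\<close>; |sin(t
  x)| <= t x supplies the power of t that termwise integration demands.\<close>

lemma integral_sin_bose:
  fixes x :: real
  assumes x: "x > 0"
  shows "(LBINT t:{0<..}. complex_of_real (2 * sin (t * x)) * of_real (bose t)) =
        of_real (1 / (exp x - 1) - 1 / x + 1 / 2)"
proof -
  have b: "norm (complex_of_real (2 * sin (t * x))) \<le> (2 * x) * t powr 1" if "t > 0" for t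
    using abs_sin_x_le_abs_x[of "t * x"] that x by (simp add: norm_mult abs_mult mult_ac)
  have m: "set_borel_measurable lborel {0<..} (\<lambda>t. complex_of_real (2 * sin (t * x)))"
    by (intro set_borel_measurable_continuous_on continuous_intros) auto
  have "(\<lambda>n. LBINT t:{0<..}. complex_of_real (2 * sin (t * x)) * of_real (exp (- (2 * pi * real (Suc n) * t)))) sums
      (LBINT t:{0<..}. complex_of_real (2 * sin (t * x)) * of_real (bose t))"
    by (rule integral_mult_bose_sums[OF _ b m]) auto
  moreover have "(LBINT t:{0<..}. complex_of_real (2 * sin (t * x)) * of_real (exp (- (2 * pi * real (Suc n) * t)))) =
      of_real (2 * x / ((2 * pi * real (Suc n))\<^sup>2 + x\<^sup>2))" for n
    by (rule integral_sin_exp_Ioi) auto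
  ultimately have "(\<lambda>n. complex_of_real (2 * x / ((2 * pi * real (Suc n))\<^sup>2 + x\<^sup>2))) sums
      (LBINT t:{0<..}. complex_of_real (2 * sin (t * x)) * of_real (bose t))" by (simp only:)
  moreover have "(\<lambda>n. complex_of_real (2 * x / ((2 * pi * real (Suc n))\<^sup>2 + x\<^sup>2))) sums of_real (1 / (exp x - 1) - 1 / x + 1 / 2)"
    by (intro sums_of_real inverse_exp_minus_one_sums x)
  ultimately show "(LBINT t:{0<..}. complex_of_real (2 * sin (t * x)) * of_real (bose t)) =
        of_real (1 / (exp x - 1) - 1 / x + 1 / 2)" by (rule sums_unique2)
qed

text \<open>Termwise integration gives twice the sum of 1/(2 pi n)^2, so the value comes from
  pi^2/6. It is the source of the constant 1/12 in the estimate that excludes zeros.\<close>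

lemma
  shows set_integrable_ident_bose: "set_integrable lborel {0<..} (\<lambda>t. 2 * t * bose t)"
    and integral_ident_bose: "(LBINT t:{0<..}. 2 * t * bose t) = 1 / 12"
proof -
  have b: "norm (complex_of_real (2 * t)) \<le> 2 * t powr 1" if "t > 0" for t
    using that by simp
  have m: "set_borel_measurable lborel {0<..} (\<lambda>t. complex_of_real (2 * t))"
    by (intro set_borel_measurable_continuous_on continuous_intros) auto
  have si: "set_integrable lborel {0<..} (\<lambda>t. complex_of_real (2 * t) * of_real (bose t))"
    by (rule set_integrable_mult_bose[OF _ b m]) auto
  show "set_integrable lborel {0<..} (\<lambda>t. 2 * t * bose t)"
  proof -
    have "norm (complex_of_real (2 * t) * of_real (bose t)) = 2 * t * bose t" if "t \<in> {0<..}" for t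
      unfolding of_real_mult[symmetric] norm_of_real using that bose_pos[of t] by simp
    from iffD1[OF set_integrable_cong[OF refl refl this] set_integrable_norm[OF si]] show ?thesis .
  qed
  have "(\<lambda>n. LBINT t:{0<..}. complex_of_real (2 * t) * of_real (exp (- (2 * pi * real (Suc n) * t)))) sums
      (LBINT t:{0<..}. complex_of_real (2 * t) * of_real (bose t))"
    by (rule integral_mult_bose_sums[OF _ b m]) auto
  moreover have "(LBINT t:{0<..}. complex_of_real (2 * t) * of_real (exp (- (2 * pi * real (Suc n) * t)))) =
      of_real (1 / (2 * pi\<^sup>2) * (1 / (real n + 1)\<^sup>2))" for n
  proof -
    have "(LBINT t:{0<..}. complex_of_real (2 * t) * of_real (exp (- (2 * pi * real (Suc n) * t)))) =
        of_real (LBINT t:{0<..}. 2 * (t powr 1 * exp (- (2 * pi * real (Suc n) * t))))"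
      by (subst set_integral_complex_of_real[symmetric], intro set_lebesgue_integral_cong) auto
    also have "(LBINT t:{0<..}. 2 * (t powr 1 * exp (- (2 * pi * real (Suc n) * t)))) = 2 * (Gamma (1 + 1) * (2 * pi * real (Suc n)) powr (- (1 + 1)))"
      by (subst set_integral_mult_right, subst integral_real_powr_exp_Ioi(2)) auto
    also have "(2 * pi * real (Suc n)) powr (- (1 + 1)) = 1 / (2 * pi * real (Suc n))\<^sup>2"
      by (simp add: powr_minus powr_numeral inverse_eq_divide del: of_nat_Suc)
    also have "2 * (Gamma (1 + 1) * (1 / (2 * pi * real (Suc n))\<^sup>2)) = 1 / (2 * pi\<^sup>2) * (1 / (real n + 1)\<^sup>2)"
      using Gamma_fact[of 1, where 'a=real] by (simp add: power_mult_distrib del: of_nat_Suc) simp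
    finally show ?thesis .
  qed
  ultimately have "(\<lambda>n. complex_of_real (1 / (2 * pi\<^sup>2) * (1 / (real n + 1)\<^sup>2))) sums
      (LBINT t:{0<..}. complex_of_real (2 * t) * of_real (bose t))" by (simp only:)
  moreover have "(\<lambda>n. complex_of_real (1 / (2 * pi\<^sup>2) * (1 / (real n + 1)\<^sup>2))) sums of_real (1 / (2 * pi\<^sup>2) * (pi\<^sup>2 / 6))"
    using inverse_squares_sums by (intro sums_of_real sums_mult) (simp add: add.commute)
  ultimately have "(LBINT t:{0<..}. complex_of_real (2 * t) * of_real (bose t)) = of_real (1 / (2 * pi\<^sup>2) * (pi\<^sup>2 / 6))"
    by (rule sums_unique2)
  also have "1 / (2 * pi\<^sup>2) * (pi\<^sup>2 / 6) = 1 / 12" by simp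
  also have "(LBINT t:{0<..}. complex_of_real (2 * t) * of_real (bose t)) = of_real (LBINT t:{0<..}. 2 * t * bose t)"
    by (simp flip: set_integral_complex_of_real)
  finally show "(LBINT t:{0<..}. 2 * t * bose t) = 1 / 12" using of_real_eq_iff by blast
qed

section \<open>The Abel--Plana integral\<close>

text \<open>For real \<open>s\<close> and c > 0 this equals 2 (c^2 + t^2)^(-s/2) sin(s arctan(t/c)),
  the numerator in Hermite's formula for the Hurwitz zeta function.\<close>

definition ap_diff :: "real \<Rightarrow> complex \<Rightarrow> real \<Rightarrow> complex" where
  "ap_diff c s t = \<i> * ((of_real c + \<i> * of_real t) powr (-s) - (of_real c - \<i> * of_real t) powr (-s))"

definition ap_integral :: "real \<Rightarrow> complex \<Rightarrow> complex" where
  "ap_integral c s = (LBINT t:{0<..}. ap_diff c s t * of_real (bose t))"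

text \<open>Mean value estimate for z^(-s) along the vertical segment from c - i t to c + i t, which
  has length 2t. The factor t compensates for the pole of \<open>bose\<close> at 0.\<close>

lemma norm_ap_diff_le:
  assumes c: "c > 0" and t: "t > 0"
    and B: "\<And>u. \<bar>u\<bar> \<le> t \<Longrightarrow> norm ((of_real c + \<i> * of_real u) powr (- s - 1)) \<le> B"
  shows "norm (ap_diff c s t) \<le> 2 * t * (norm s * B)"
proof -
  let ?S = "closed_segment (of_real c - \<i> * of_real t) (of_real c + \<i> * of_real t) :: complex set"
  have S: "\<exists>u. \<bar>u\<bar> \<le> t \<and> z = of_real c + \<i> * of_real u" if zS: "z \<in> ?S" for z
  proof -
    obtain v where v: "0 \<le> v" "v \<le> 1" "z = (1 - v) *\<^sub>R (of_real c - \<i> * of_real t) + v *\<^sub>R (of_real c + \<i> * of_real t)"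
      using zS by (auto simp: closed_segment_def)
    have "z = of_real c + \<i> * of_real ((2 * v - 1) * t)"
      unfolding v(3) by (simp add: complex_eq_iff algebra_simps)
    moreover have "\<bar>(2 * v - 1) * t\<bar> \<le> t" using v t by (simp add: abs_mult mult_le_cancel_right1)
    ultimately show ?thesis by blast
  qed
  have "norm ((of_real c + \<i> * of_real t) powr (-s) - (of_real c - \<i> * of_real t) powr (-s)) \<le>
      (norm s * B) * norm ((of_real c + \<i> * of_real t) - (of_real c - \<i> * of_real t))"
  proof (rule field_differentiable_bound[where S="?S" and f="\<lambda>z. z powr (-s)" and f'="\<lambda>z. - s * z powr (- s - 1)"])
    fix z assume zS: "z \<in> ?S"
    obtain u where u: "\<bar>u\<bar> \<le> t" "z = of_real c + \<i> * of_real u" using S[OF zS] by auto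
    have "z \<notin> \<real>\<^sub>\<le>\<^sub>0" using c by (simp add: u complex_nonpos_Reals_iff)
    then show "((\<lambda>z. z powr - s) has_field_derivative - s * z powr (- s - 1)) (at z within ?S)"
      by (rule has_field_derivative_at_within[OF has_field_derivative_powr])
    show "norm (- s * z powr (- s - 1)) \<le> norm s * B"
      using B[OF u(1)] by (simp add: u norm_mult mult_left_mono)
  qed auto
  also have "norm ((of_real c + \<i> * of_real t) - (of_real c - \<i> * of_real t)) = 2 * t"
    using t by (simp add: norm_mult)
  finally show ?thesis by (simp add: ap_diff_def norm_mult mult_ac)
qed

lemma norm_ge_Re_and_le_sum:
  assumes "c > 0" "\<bar>u\<bar> \<le> t"
  shows "norm (complex_of_real c + \<i> * of_real u) \<ge> c" "norm (complex_of_real c + \<i> * of_real u) \<le> c + t"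
  using complex_Re_le_cmod[of "complex_of_real c + \<i> * of_real u"]
    norm_triangle_ineq[of "complex_of_real c" "\<i> * of_real u"] assms by (auto simp: norm_mult)

text \<open>Uniformity in \<open>s\<close> gives holomorphy of \<open>ap_integral\<close>,
  uniformity in \<open>c\<close> gives its continuity in \<open>c\<close>. The factor exp(t) is
  harmless because \<open>bose\<close> decays like exp(-2 pi t).\<close>

lemma ap_diff_bound_uniform:
  fixes c0 c1 R :: real
  assumes c0: "c0 > 0"
  obtains C where "C \<ge> 0" "\<And>c s t. c0 \<le> c \<Longrightarrow> c \<le> c1 \<Longrightarrow> norm s \<le> R \<Longrightarrow> t > 0 \<Longrightarrow> norm (ap_diff c s t) \<le> C * t * exp t"
proof -
  obtain C1 where C1: "C1 \<ge> 0" "\<And>x. x \<ge> c0 \<Longrightarrow> x powr (R + 1) \<le> C1 * exp (1 * x)"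
    using powr_le_exp[OF c0 zero_less_one] by blast
  obtain C2 where C2: "C2 \<ge> 0" "\<And>x. x \<ge> c0 \<Longrightarrow> x powr (- R - 1) \<le> C2 * exp (1 * x)"
    using powr_le_exp[OF c0 zero_less_one] by blast
  define B where "B = (C1 + C2) * exp c1 * exp (pi * R)"
  define C where "C = 2 * (\<bar>R\<bar> * B)"
  have B0: "B \<ge> 0" using C1 C2 by (simp add: B_def)
  have "norm (ap_diff c s t) \<le> C * t * exp t" if h: "c0 \<le> c" "c \<le> c1" "norm s \<le> R" "t > 0" for c s t
  proof -
    have c: "c > 0" using c0 h by simp
    have R: "\<bar>Re s\<bar> \<le> R" "\<bar>Im s\<bar> \<le> R" using h abs_Re_le_cmod[of s] abs_Im_le_cmod[of s] by linarith+
    have "norm (ap_diff c s t) \<le> 2 * t * (norm s * (B * exp t))"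
    proof (rule norm_ap_diff_le[OF c \<open>t > 0\<close>])
      fix u assume u: "\<bar>u\<bar> \<le> t"
      let ?z = "of_real c + \<i> * of_real u"
      have n: "norm ?z \<ge> c0" "norm ?z \<le> c1 + t" using norm_ge_Re_and_le_sum[OF c u] h by linarith+
      \<comment> \<open>The exponent lies between -R-1 and R+1; adding the two extreme powers covers
        bases below and above 1 at once.\<close>
      have "norm ?z powr (- Re s - 1) \<le> norm ?z powr (R + 1) + norm ?z powr (- R - 1)"
      proof (cases "norm ?z \<ge> 1")
        case True
        then have "norm ?z powr (- Re s - 1) \<le> norm ?z powr (R + 1)" using R by (intro powr_mono) auto
        then show ?thesis by (simp add: add_increasing2)
      next
        case False
        then have "norm ?z powr (- Re s - 1) \<le> norm ?z powr (- R - 1)" using R n c0 by (intro powr_mono') auto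
        then show ?thesis by (simp add: add_increasing)
      qed
      also have "\<dots> \<le> (C1 + C2) * exp (norm ?z)"
        using C1(2)[OF n(1)] C2(2)[OF n(1)] by (simp add: distrib_right)
      also have "\<dots> \<le> (C1 + C2) * exp (c1 + t)" using n C1 C2 by (intro mult_left_mono) auto
      finally have 1: "norm ?z powr (- Re s - 1) \<le> (C1 + C2) * exp (c1 + t)" .
      have "norm (?z powr (- s - 1)) \<le> norm ?z powr (- Re s - 1) * exp (pi * \<bar>Im s\<bar>)"
        using norm_powr_complex_le[of ?z "- s - 1"] by simp
      also have "\<dots> \<le> (C1 + C2) * exp (c1 + t) * exp (pi * R)"
        using 1 R C1 C2 by (intro mult_mono) auto
      also have "\<dots> = B * exp t" by (simp add: B_def exp_add)
      finally show "norm (?z powr (- s - 1)) \<le> B * exp t" .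
    qed
    also have "\<dots> \<le> 2 * t * (\<bar>R\<bar> * (B * exp t))"
      using h B0 by (intro mult_left_mono mult_right_mono) auto
    finally show ?thesis by (simp add: C_def mult_ac)
  qed
  moreover have "C \<ge> 0" using B0 by (simp add: C_def)
  ultimately show ?thesis using that by blast
qed

lemma set_integrable_exp_bose:
  "set_integrable lborel {0<..} (\<lambda>t. C * t * exp t * bose t)"
proof -
  have "set_integrable lborel {0<..} (\<lambda>t. \<bar>C\<bar> / pi * (t powr 0 * exp (- ((pi - 1) * t))))"
    using pi_gt3 by (intro set_integrable_mult_right integral_real_powr_exp_Ioi) auto
  then show ?thesis
  proof (rule set_integrable_bound)
    show "set_borel_measurable lborel {0<..} (\<lambda>t. C * t * exp t * bose t)"
      by (intro set_borel_measurable_continuous_on continuous_intros continuous_on_bose) auto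
    show "AE t in lborel. t \<in> {0<..} \<longrightarrow> norm (C * t * exp t * bose t) \<le> norm (\<bar>C\<bar> / pi * (t powr 0 * exp (- ((pi - 1) * t))))"
    proof (intro AE_I2 impI)
      fix t :: real assume t: "t \<in> {0<..}"
      have "norm (C * t * exp t * bose t) = \<bar>C\<bar> * exp t * (t * bose t)"
        using t bose_pos[of t] by (simp add: abs_mult)
      also have "\<dots> \<le> \<bar>C\<bar> * exp t * (exp (- (pi * t)) / pi)"
        using t mult_bose_le[of t] by (intro mult_left_mono) auto
      also have "\<dots> = \<bar>C\<bar> / pi * exp (- ((pi - 1) * t))"
        by (simp add: field_simps flip: exp_add)
      finally show "norm (C * t * exp t * bose t) \<le> norm (\<bar>C\<bar> / pi * (t powr 0 * exp (- ((pi - 1) * t))))"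
        using t by simp
    qed
  qed
qed

text \<open>The value c = 0 is included for the sake of the limit behind the functional equation:
  for t > 0 the points i t and -i t still avoid the branch cut.\<close>

lemma set_borel_measurable_ap_diff:
  assumes "c \<ge> 0"
  shows "set_borel_measurable lborel {0<..} (\<lambda>t. ap_diff c s t * of_real (bose t))"
  unfolding ap_diff_def
  by (intro set_borel_measurable_continuous_on continuous_intros continuous_on_bose)
     (use assms in \<open>auto simp: complex_nonpos_Reals_iff complex_eq_iff\<close>)

lemma set_integrable_ap_diff:
  assumes c: "c > 0"
  shows "set_integrable lborel {0<..} (\<lambda>t. ap_diff c s t * of_real (bose t))"
proof -
  obtain C where C: "C \<ge> 0" "\<And>c' s' t. c \<le> c' \<Longrightarrow> c' \<le> c \<Longrightarrow> norm s' \<le> norm s \<Longrightarrow> t > 0 \<Longrightarrow> norm (ap_diff c' s' t) \<le> C * t * exp t"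
    by (rule ap_diff_bound_uniform[OF c, of c "norm s"]) blast
  from set_integrable_exp_bose[of C] show ?thesis
  proof (rule set_integrable_bound)
    show "set_borel_measurable lborel {0<..} (\<lambda>t. ap_diff c s t * of_real (bose t))"
      using c by (intro set_borel_measurable_ap_diff) auto
    show "AE t in lborel. t \<in> {0<..} \<longrightarrow> norm (ap_diff c s t * of_real (bose t)) \<le> norm (C * t * exp t * bose t)"
      using C bose_pos by (intro AE_I2 impI) (auto simp: norm_mult abs_mult intro!: mult_right_mono)
  qed
qed

lemma holomorphic_ap_integral:
  assumes c: "c > 0"
  shows "ap_integral c holomorphic_on A"
proof -
  have "ap_integral c holomorphic_on UNIV"
    unfolding ap_integral_def
  proof (rule holomorphic_on_set_integral)
    show "set_borel_measurable lborel {0<..} (\<lambda>t. ap_diff c s t * of_real (bose t))" for s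
      using c by (intro set_borel_measurable_ap_diff) auto
    show "(\<lambda>s. ap_diff c s x * of_real (bose x)) holomorphic_on UNIV" for x
      unfolding ap_diff_def by (intro holomorphic_intros)
    fix s0 :: complex
    obtain C where C: "C \<ge> 0" "\<And>c' s' t. c \<le> c' \<Longrightarrow> c' \<le> c \<Longrightarrow> norm s' \<le> norm s0 + 1 \<Longrightarrow> t > 0 \<Longrightarrow> norm (ap_diff c' s' t) \<le> C * t * exp t"
      by (rule ap_diff_bound_uniform[OF c, of c "norm s0 + 1"]) blast
    have "norm (ap_diff c s t * of_real (bose t)) \<le> C * t * exp t * bose t" if "dist s0 s \<le> 1" "t > 0" for s t
    proof -
      have "norm s \<le> norm s0 + 1" using that norm_triangle_ineq2[of s s0] by (simp add: dist_norm norm_minus_commute)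
      then show ?thesis using C(2)[of c s t] that bose_pos[of t] by (auto simp: norm_mult intro!: mult_right_mono)
    qed
    then show "\<exists>r>0. \<exists>g. set_integrable lborel {0<..} g \<and> (\<forall>s\<in>UNIV. dist s0 s \<le> r \<longrightarrow>
        (\<forall>t\<in>{0<..}. norm (ap_diff c s t * of_real (bose t)) \<le> g t))"
      using set_integrable_exp_bose[of C] by (intro exI[of _ 1] conjI exI[of _ "\<lambda>t. C * t * exp t * bose t"]) auto
  qed auto
  then show ?thesis using holomorphic_on_subset by blast
qed

lemma Re_pos_not_nonpos_Int: "Re z > 0 \<Longrightarrow> z \<notin> \<int>\<^sub>\<le>\<^sub>0"
  by (auto elim!: nonpos_Ints_cases)

text \<open>The mean value bound grows linearly in t with the constant \<open>norm s * B\<close>, so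
  its integral against the kernel is known exactly from \<open>integral_ident_bose\<close>. The
  explicit constant is what makes the numerical exclusion of zeros possible.\<close>

lemma norm_ap_integral_le:
  assumes c: "c > 0"
    and B: "\<And>u. norm ((of_real c + \<i> * of_real u) powr (- s - 1)) \<le> B"
  shows "norm (ap_integral c s) \<le> norm s * B / 12"
proof -
  have si: "set_integrable lborel {0<..} (\<lambda>t. norm s * B * (2 * t * bose t))"
    by (intro set_integrable_mult_right set_integrable_ident_bose)
  have "norm (ap_integral c s) \<le> (LBINT t:{0<..}. norm (ap_diff c s t * of_real (bose t)))"
    unfolding ap_integral_def by (rule set_integral_norm_bound[OF set_integrable_ap_diff[OF c]])
  also have "\<dots> \<le> (LBINT t:{0<..}. norm s * B * (2 * t * bose t))"
  proof (rule set_integral_mono[OF set_integrable_norm[OF set_integrable_ap_diff[OF c]] si])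
    fix t :: real assume "t \<in> {0<..}"
    then have t: "t > 0" by simp
    show "norm (ap_diff c s t * of_real (bose t)) \<le> norm s * B * (2 * t * bose t)"
      using mult_right_mono[OF norm_ap_diff_le[OF c t B], of "bose t"] bose_pos[OF t]
      by (simp add: norm_mult mult_ac)
  qed
  also have "\<dots> = norm s * B / 12"
    using integral_ident_bose by (subst set_integral_mult_right) simp
  finally show ?thesis .
qed

section \<open>Mellin transforms and the shift relation in c\<close>

lemma integral_powr_exp_sin_Ioi:
  assumes s: "Re s > 0" and c: "c > 0"
  shows "set_integrable lborel {0<..} (\<lambda>x. complex_of_real x powr (s - 1) * exp (- (of_real c * of_real x)) * of_real (2 * sin (t * x)))"
    and "(LBINT x:{0<..}. complex_of_real x powr (s - 1) * exp (- (of_real c * of_real x)) * of_real (2 * sin (t * x))) =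
      Gamma s * ap_diff c s t"
proof -
  let ?p = "of_real c + \<i> * of_real t" and ?m = "of_real c - \<i> * of_real t"
  have eq: "complex_of_real x powr (s - 1) * exp (- (of_real c * of_real x)) * of_real (2 * sin (t * x)) =
      \<i> * (of_real x powr (s - 1) * exp (- (?p * of_real x))) - \<i> * (of_real x powr (s - 1) * exp (- (?m * of_real x)))" for x
  proof -
    have "complex_of_real (2 * sin (t * x)) = \<i> * exp (- (\<i> * of_real (t * x))) - \<i> * exp (\<i> * of_real (t * x))"
      unfolding of_real_mult of_real_numeral sin_of_real[symmetric] sin_exp_eq by (simp add: field_simps)
    moreover have "exp (- (?p * of_real x)) = exp (- (of_real c * of_real x)) * exp (- (\<i> * of_real (t * x)))"
      "exp (- (?m * of_real x)) = exp (- (of_real c * of_real x)) * exp (\<i> * of_real (t * x))"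
      by (simp_all add: algebra_simps flip: exp_add)
    ultimately show ?thesis by (simp only: right_diff_distrib mult_ac)
  qed
  have i: "set_integrable lborel {0<..} (\<lambda>x. \<i> * (of_real x powr (s - 1) * exp (- (?p * of_real x))))"
    "set_integrable lborel {0<..} (\<lambda>x. \<i> * (of_real x powr (s - 1) * exp (- (?m * of_real x))))"
    using s c by (auto intro!: set_integrable_mult_right set_integrable_powr_exp_Ioi)
  show "set_integrable lborel {0<..} (\<lambda>x. complex_of_real x powr (s - 1) * exp (- (of_real c * of_real x)) * of_real (2 * sin (t * x)))"
    unfolding eq using i by (rule set_integral_diff)
  show "(LBINT x:{0<..}. complex_of_real x powr (s - 1) * exp (- (of_real c * of_real x)) * of_real (2 * sin (t * x))) =
      Gamma s * ap_diff c s t"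
    unfolding eq set_integral_diff(2)[OF i] set_integral_mult_right
    by (subst (1 2) integral_powr_exp_Ioi) (use s c in \<open>auto simp: ap_diff_def algebra_simps\<close>)
qed

lemma integrable_lborel_prod:
  fixes F G :: "real \<Rightarrow> real"
  assumes F: "integrable lborel F" and G: "integrable lborel G"
  shows "integrable (lborel \<Otimes>\<^sub>M lborel) (\<lambda>(t, x). F t * G x)"
proof (rule lborel_pair.Fubini_integrable)
  have [measurable]: "F \<in> borel_measurable lborel" "G \<in> borel_measurable lborel" using F G by auto
  show "(\<lambda>(t, x). F t * G x) \<in> borel_measurable (lborel \<Otimes>\<^sub>M lborel)" by measurable
  have "integrable lborel (\<lambda>t. \<bar>F t\<bar> * (\<integral>x. \<bar>G x\<bar> \<partial>lborel))"
    using F by (intro integrable_mult_left) auto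
  then show "integrable lborel (\<lambda>t. \<integral>x. norm (case (t, x) of (t, x) \<Rightarrow> F t * G x) \<partial>lborel)"
    by (simp add: abs_mult)
qed (use G in auto)

text \<open>Fubini for x^(s-1) exp(-c x) times \<open>bose t\<close> times 2 sin(t x): integrating
  over x first gives \<open>Gamma s * ap_diff c s t\<close> against the kernel, integrating over t
  first gives Legendre's integral.\<close>

lemma Gamma_mult_ap_integral:
  assumes s: "Re s > 0" and c: "c > 0"
  shows "set_integrable lborel {0<..} (\<lambda>x. complex_of_real x powr (s - 1) * exp (- (of_real c * of_real x)) *
      of_real (1 / (exp x - 1) - 1 / x + 1 / 2))" (is ?th1)
    and "Gamma s * ap_integral c s = (LBINT x:{0<..}. complex_of_real x powr (s - 1) * exp (- (of_real c * of_real x)) *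
      of_real (1 / (exp x - 1) - 1 / x + 1 / 2))" (is ?th2)
proof -
  define X where "X x = indicat_real {0<..} x *\<^sub>R (complex_of_real x powr (s - 1) * exp (- (of_real c * of_real x)))" for x
  define T where "T t = indicat_real {0<..} t * bose t" for t
  define f where "f = (\<lambda>(t, x). of_real (T t) * X x * complex_of_real (2 * sin (t * x)))"
  have Xm [measurable]: "X \<in> borel_measurable lborel"
    using set_integrable_powr_exp_Ioi[of s "of_real c"] s c unfolding X_def[abs_def] set_integrable_def by auto
  have Tm [measurable]: "T \<in> borel_measurable lborel"
    using set_borel_measurable_continuous_on[OF continuous_on_bose] unfolding T_def[abs_def] set_borel_measurable_def by simp
  have fm [measurable]: "f \<in> borel_measurable (lborel \<Otimes>\<^sub>M lborel)"
    unfolding f_def by measurable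
  define F where "F t = indicat_real {0<..} t *\<^sub>R (2 * t * bose t)" for t
  define G where "G x = indicat_real {0<..} x *\<^sub>R (x powr Re s * exp (- (c * x)))" for x
  have FG: "integrable (lborel \<Otimes>\<^sub>M lborel) (\<lambda>(t, x). F t * G x)"
  proof (rule integrable_lborel_prod)
    show "integrable lborel F" using set_integrable_ident_bose by (simp only: F_def[abs_def] set_integrable_def)
    show "integrable lborel G"
      using integral_real_powr_exp_Ioi(1)[of "Re s" c] s c by (simp only: G_def[abs_def] set_integrable_def)
  qed
  have "norm (f (t, x)) \<le> F t * G x" for t x
  proof (cases "t > 0 \<and> x > 0")
    case True
    then have t: "t > 0" and x: "x > 0" by auto
    have "norm (f (t, x)) = bose t * (x powr (Re s - 1) * exp (- (c * x))) * (2 * \<bar>sin (t * x)\<bar>)"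
      using t x bose_pos[OF t] by (simp add: f_def T_def X_def norm_mult norm_of_real_powr norm_exp_eq_Re)
    \<comment> \<open>Bounding the sine by t x separates the variables, so the majorant is a product
      of integrable functions; the factor t also removes the pole of the kernel.\<close>
    also have "\<dots> \<le> bose t * (x powr (Re s - 1) * exp (- (c * x))) * (2 * (t * x))"
      using abs_sin_x_le_abs_x[of "t * x"] t x bose_pos[OF t] by (intro mult_left_mono) (auto simp: abs_mult)
    also have "\<dots> = F t * G x"
      using t x by (simp add: F_def G_def powr_diff)
    finally show ?thesis .
  qed (auto simp: f_def F_def G_def T_def X_def)
  then have fi: "integrable (lborel \<Otimes>\<^sub>M lborel) f"
    by (intro Bochner_Integration.integrable_bound[OF FG fm] AE_I2)
       (auto intro: order_trans[OF _ abs_ge_self] simp: split_beta)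
  have in1: "(\<integral>x. f (t, x) \<partial>lborel) = indicat_real {0<..} t *\<^sub>R (Gamma s * (ap_diff c s t * of_real (bose t)))" for t
  proof -
    have "(\<integral>x. f (t, x) \<partial>lborel) = of_real (T t) * (LBINT x:{0<..}. complex_of_real x powr (s - 1) * exp (- (of_real c * of_real x)) * of_real (2 * sin (t * x)))"
      unfolding set_lebesgue_integral_def integral_mult_right_zero[symmetric]
      by (intro Bochner_Integration.integral_cong) (auto simp: f_def X_def)
    then show ?thesis unfolding integral_powr_exp_sin_Ioi(2)[OF s c] by (simp add: T_def scaleR_conv_of_real mult_ac)
  qed
  have in2: "(\<integral>t. f (t, x) \<partial>lborel) = indicat_real {0<..} x *\<^sub>R (complex_of_real x powr (s - 1) * exp (- (of_real c * of_real x)) *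
      of_real (1 / (exp x - 1) - 1 / x + 1 / 2))" for x
  proof (cases "x > 0")
    case True
    have "(\<integral>t. f (t, x) \<partial>lborel) = X x * (LBINT t:{0<..}. complex_of_real (2 * sin (t * x)) * of_real (bose t))"
      unfolding set_lebesgue_integral_def integral_mult_right_zero[symmetric]
      by (intro Bochner_Integration.integral_cong) (auto simp: f_def T_def indicator_def)
    then show ?thesis unfolding integral_sin_bose[OF True] using True by (simp add: X_def)
  qed (simp add: f_def X_def)
  have "integrable lborel (\<lambda>x. \<integral>t. f (t, x) \<partial>lborel)"
    using lborel_pair.integrable_snd[of "\<lambda>t x. f (t, x)"] fi by simp
  then show ?th1 by (simp only: in2 set_integrable_def)
  have "(\<integral>x. (\<integral>t. f (t, x) \<partial>lborel) \<partial>lborel) = (\<integral>t. (\<integral>x. f (t, x) \<partial>lborel) \<partial>lborel)"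
    using lborel_pair.Fubini_integral[of "\<lambda>t x. f (t, x)"] fi by simp
  then have "(LBINT t:{0<..}. Gamma s * (ap_diff c s t * of_real (bose t))) = (LBINT x:{0<..}. complex_of_real x powr (s - 1) * exp (- (of_real c * of_real x)) *
      of_real (1 / (exp x - 1) - 1 / x + 1 / 2))"
    by (simp only: in1 in2 set_lebesgue_integral_def)
  then show ?th2 by (simp add: ap_integral_def)
qed

text \<open>On the Mellin side, passing from \<open>c\<close> to \<open>c + 1\<close> multiplies the
  integrand by exp(-x). The difference thus carries the factor 1 - exp(-x), which cancels the
  denominator exp(x) - 1 and leaves four elementary Gamma integrals. Those from the term 1/x involve
  Gamma(s - 1), whence Re s > 1.\<close>

lemma ap_integral_diff_aux:
  assumes s: "Re s > 1" and c: "c > 0"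
  shows "ap_integral c s - ap_integral (c + 1) s =
    (of_real c powr (-s) + of_real (c + 1) powr (-s)) / 2 - (of_real c powr (1 - s) - of_real (c + 1) powr (1 - s)) / (s - 1)"
proof -
  have s0: "Re s > 0" "s \<noteq> 0" and s1: "s \<noteq> 1" using s by auto
  let ?P = "\<lambda>x. complex_of_real x powr (s - 1)" and ?Q = "\<lambda>x. complex_of_real x powr ((s - 1) - 1)"
  let ?E = "\<lambda>b x. exp (- (of_real b * complex_of_real x))"
  have g1: "set_integrable lborel {0<..} (\<lambda>x. ?P x * ?E b x)" "(LBINT x:{0<..}. ?P x * ?E b x) = Gamma s * of_real b powr (-s)"
    if "b > 0" for b :: real
    using set_integrable_powr_exp_Ioi[of s "of_real b"] integral_powr_exp_Ioi[of s "of_real b"] s0 that by auto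
  have g2: "set_integrable lborel {0<..} (\<lambda>x. ?Q x * ?E b x)" "(LBINT x:{0<..}. ?Q x * ?E b x) = Gamma (s - 1) * of_real b powr (1-s)"
    if "b > 0" for b :: real
    using set_integrable_powr_exp_Ioi[of "s - 1" "of_real b"] integral_powr_exp_Ioi[of "s - 1" "of_real b"] s that by auto
  let ?h = "\<lambda>b x. ?P x * ?E b x * of_real (1 / (exp x - 1) - 1 / x + 1 / 2)"
  have pt: "?h c x - ?h (c + 1) x = (1/2) * (?P x * ?E c x) + (1/2) * (?P x * ?E (c+1) x) - (?Q x * ?E c x - ?Q x * ?E (c + 1) x)"
    if "x \<in> {0<..}" for x
  proof -
    have x: "x > 0" using that by simp
    have Q: "?Q x = ?P x / of_real x" using x by (simp add: powr_diff power2_eq_square)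
    have E: "?E (c + 1) x = ?E c x * of_real (exp (- x))"
      by (simp add: exp_of_real[symmetric] algebra_simps flip: exp_add)
    define e where "e = exp (- x)"
    have "1 - e = e * (exp x - 1)" by (simp add: e_def exp_minus right_diff_distrib)
    then have a: "(1 - e) * (1 / (exp x - 1)) = e" using x by simp
    have "p * q * r - p * (q * w) * r = p * q * ((1 - w) * r)" for p q r w :: complex by (simp add: algebra_simps)
    then have "?h c x - ?h (c + 1) x = ?P x * ?E c x * ((1 - of_real e) * of_real (1 / (exp x - 1) - 1 / x + 1 / 2))"
      unfolding E e_def[symmetric] by blast
    also have "(1 - of_real e) * complex_of_real (1 / (exp x - 1) - 1 / x + 1 / 2) = of_real ((1 - e) * (1 / (exp x - 1) - 1 / x + 1 / 2))"
      by simp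
    also have "(1 - e) * (1 / (exp x - 1) - 1 / x + 1 / 2) = (1 - e) * (1 / (exp x - 1)) - (1 - e) / x + (1 - e) / 2"
      by (simp add: right_diff_distrib distrib_left)
    also have "\<dots> = 1/2 + 1/2 * e - (1 - e) / x" unfolding a by (simp add: diff_divide_distrib)
    also have "complex_of_real (1/2 + 1/2 * e - (1 - e) / x) = 1/2 + 1/2 * of_real e - (1 - of_real e) / of_real x" by simp
    also have "?P x * ?E c x * (1/2 + 1/2 * of_real e - (1 - of_real e) / of_real x) =
       (1/2) * (?P x * ?E c x) + (1/2) * (?P x * ?E (c+1) x) - (?Q x * ?E c x - ?Q x * ?E (c + 1) x)"
    proof -
      have "p * q * (1/2 + 1/2 * w - (1 - w) / y) = 1/2 * (p * q) + 1/2 * (p * (q * w)) - (p / y * q - p / y * (q * w))" for p q w y :: complex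
        by (simp add: algebra_simps diff_divide_distrib)
      then show ?thesis unfolding E Q e_def[symmetric] by blast
    qed
    finally show ?thesis .
  qed
  have c1: "c + 1 > 0" using c by simp
  have gen: "(1/2) * (g * a) + (1/2) * (g * b) - (g / d * p - g / d * q) = g * ((a + b) / 2 - (p - q) / d)"
    for g a b d p q :: complex
    by (simp add: algebra_simps add_divide_distrib diff_divide_distrib)
  have "Gamma s * (ap_integral c s - ap_integral (c + 1) s) = (LBINT x:{0<..}. ?h c x) - (LBINT x:{0<..}. ?h (c + 1) x)"
    unfolding right_diff_distrib Gamma_mult_ap_integral(2)[OF s0(1) c] Gamma_mult_ap_integral(2)[OF s0(1) c1] ..
  also have "\<dots> = (LBINT x:{0<..}. ?h c x - ?h (c + 1) x)"
    by (rule set_integral_diff(2)[OF Gamma_mult_ap_integral(1)[OF s0(1) c] Gamma_mult_ap_integral(1)[OF s0(1) c1], symmetric])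
  also have "\<dots> = (LBINT x:{0<..}. (1/2) * (?P x * ?E c x) + (1/2) * (?P x * ?E (c+1) x) - (?Q x * ?E c x - ?Q x * ?E (c + 1) x))"
    by (intro set_lebesgue_integral_cong allI impI pt) auto
  also have "\<dots> = (1/2) * (Gamma s * of_real c powr (-s)) + (1/2) * (Gamma s * of_real (c+1) powr (-s)) -
      (Gamma (s - 1) * of_real c powr (1-s) - Gamma (s - 1) * of_real (c+1) powr (1-s))"
  proof -
    note i1 = set_integrable_mult_right[OF g1(1)[OF c], of "1/2"] set_integrable_mult_right[OF g1(1)[OF c1], of "1/2"]
    show ?thesis
      unfolding set_integral_diff(2)[OF set_integral_add(1)[OF i1] set_integral_diff(1)[OF g2(1)[OF c] g2(1)[OF c1]]]
        set_integral_add(2)[OF i1] set_integral_diff(2)[OF g2(1)[OF c] g2(1)[OF c1]]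
        set_integral_mult_right g1(2)[OF c] g1(2)[OF c1] g2(2)[OF c] g2(2)[OF c1] ..
  qed
  also have "Gamma (s - 1) = Gamma s / (s - 1)"
    using Gamma_plus1[OF Re_pos_not_nonpos_Int[of "s - 1"]] s1 s by simp
  finally have "Gamma s * (ap_integral c s - ap_integral (c + 1) s) = Gamma s *
     ((of_real c powr (-s) + of_real (c + 1) powr (-s)) / 2 - (of_real c powr (1 - s) - of_real (c + 1) powr (1 - s)) / (s - 1))"
    unfolding gen .
  moreover have "Gamma s \<noteq> 0" using Re_pos_not_nonpos_Int[OF s0(1)] by (simp add: Gamma_eq_zero_iff)
  ultimately show ?thesis by simp
qed

lemma ap_integral_diff:
  assumes s: "s \<noteq> 1" and c: "c > 0"
  shows "ap_integral c s - ap_integral (c + 1) s =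
    (of_real c powr (-s) + of_real (c + 1) powr (-s)) / 2 - (of_real c powr (1 - s) - of_real (c + 1) powr (1 - s)) / (s - 1)"
proof (rule analytic_continuation_open[where s="{s. Re s > 1}" and s'="- {1}" and z=s and
      f="\<lambda>s. ap_integral c s - ap_integral (c + 1) s" and
      g="\<lambda>s. (of_real c powr (-s) + of_real (c + 1) powr (-s)) / 2 - (of_real c powr (1 - s) - of_real (c + 1) powr (1 - s)) / (s - 1)"])
  show "open {s. Re s > 1}" by (rule open_halfspace_Re_gt)
  show "{s. Re s > 1} \<noteq> {}" by (auto intro: exI[of _ 2])
  show "connected (- {1} :: complex set)" by (rule connected_punctured_universe) auto
  show "(\<lambda>s. ap_integral c s - ap_integral (c + 1) s) holomorphic_on - {1}"
    using c by (intro holomorphic_intros holomorphic_ap_integral) auto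
  show "(\<lambda>s. (of_real c powr (-s) + of_real (c + 1) powr (-s)) / 2 - (of_real c powr (1 - s) - of_real (c + 1) powr (1 - s)) / (s - 1)) holomorphic_on - {1}"
    using c by (intro holomorphic_intros) (auto simp del: of_real_add)
  show "ap_integral c s - ap_integral (c + 1) s =
    (of_real c powr (-s) + of_real (c + 1) powr (-s)) / 2 - (of_real c powr (1 - s) - of_real (c + 1) powr (1 - s)) / (s - 1)"
    if "s \<in> {s. Re s > 1}" for s using that c by (intro ap_integral_diff_aux) auto
qed (use s in auto)

section \<open>Continuation and functional equation of zeta\<close>

definition hurwitz :: "real \<Rightarrow> complex \<Rightarrow> complex" where
  "hurwitz c s = ap_integral c s + of_real c powr (1 - s) / (s - 1) + of_real c powr (- s) / 2"

lemma hurwitz_plus1: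
  assumes "s \<noteq> 1" "c > 0"
  shows "hurwitz c s = of_real c powr (- s) + hurwitz (c + 1) s"
proof -
  have "ap_integral c s = ap_integral (c + 1) s + ((of_real c powr (-s) + of_real (c + 1) powr (-s)) / 2 - (of_real c powr (1 - s) - of_real (c + 1) powr (1 - s)) / (s - 1))"
    using ap_integral_diff[OF assms] by (metis add_diff_cancel_left' diff_add_cancel add.commute)
  then show ?thesis unfolding hurwitz_def by (simp add: diff_divide_distrib add_divide_distrib del: of_real_add)
qed

text \<open>Serves to let c -> infinity with \<open>s\<close> fixed, so every power of
  \<open>c\<close> is simply raised to the slowest one, c^(1 - Re s).\<close>

lemma norm_hurwitz_le:
  assumes s: "Re s > 1" and c: "c \<ge> 1"
  shows "norm (hurwitz c s) \<le> (norm s * exp (pi * \<bar>Im s\<bar>) + 1 / norm (s - 1) + 1) * c powr (1 - Re s)"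
proof -
  have c0: "c > 0" using c by simp
  have "norm (ap_integral c s) \<le> norm s * (c powr (1 - Re s) * exp (pi * \<bar>Im s\<bar>)) / 12"
  proof (rule norm_ap_integral_le[OF c0])
    fix u :: real
    have "norm ((of_real c + \<i> * of_real u) powr (- s - 1)) \<le> norm (of_real c + \<i> * of_real u) powr (- Re s - 1) * exp (pi * \<bar>Im s\<bar>)"
      using norm_powr_complex_le[of "of_real c + \<i> * of_real u" "- s - 1"] by simp
    also have "norm (of_real c + \<i> * of_real u) powr (- Re s - 1) \<le> c powr (- Re s - 1)"
      using norm_ge_Re_and_le_sum(1)[OF c0 order_refl, of u] s c0 by (intro powr_mono2') auto
    also have "c powr (- Re s - 1) \<le> c powr (1 - Re s)" using c by (intro powr_mono) auto
    finally show "norm ((of_real c + \<i> * of_real u) powr (- s - 1)) \<le> c powr (1 - Re s) * exp (pi * \<bar>Im s\<bar>)"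
      by (simp add: mult_right_mono)
  qed
  also have "\<dots> \<le> norm s * (c powr (1 - Re s) * exp (pi * \<bar>Im s\<bar>))" by simp
  finally have 1: "norm (ap_integral c s) \<le> norm s * (c powr (1 - Re s) * exp (pi * \<bar>Im s\<bar>))" .
  have "norm (of_real c powr (- s) / 2 :: complex) \<le> c powr (- Re s)"
    using c0 by (simp add: norm_divide norm_of_real_powr)
  also have "\<dots> \<le> c powr (1 - Re s)" using c by (intro powr_mono) auto
  finally have 2: "norm (of_real c powr (- s) / 2 :: complex) \<le> c powr (1 - Re s)" .
  have 3: "norm (of_real c powr (1 - s) / (s - 1)) = c powr (1 - Re s) / norm (s - 1)"
    using c0 by (simp add: norm_divide norm_of_real_powr)
  have "norm (hurwitz c s) \<le> norm (ap_integral c s) + norm (of_real c powr (1 - s) / (s - 1)) + norm (of_real c powr (- s) / 2 :: complex)"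
    unfolding hurwitz_def by (intro norm_triangle_le add_mono norm_triangle_ineq order_refl)
  then show ?thesis using 1 2 unfolding 3 by (simp add: algebra_simps)
qed

text \<open>The shift relation telescopes: the partial sum of N terms is \<open>hurwitz 1 s\<close>
  minus the value at c = N + 1, and the latter tends to 0.\<close>

lemma hurwitz_sums:
  assumes s: "Re s > 1"
  shows "(\<lambda>n. 1 / of_nat (Suc n) powr s) sums hurwitz 1 s"
proof -
  have s1: "s \<noteq> 1" using s by auto
  have part: "(\<Sum>n<N. 1 / of_nat (Suc n) powr s) = hurwitz 1 s - hurwitz (real (Suc N)) s" for N
  proof (induction N)
    case (Suc N)
    have "hurwitz (real (Suc N)) s = of_nat (Suc N) powr (- s) + hurwitz (real (Suc (Suc N))) s"
      using hurwitz_plus1[OF s1, of "real (Suc N)"] by (simp add: add.commute)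
    then show ?case using Suc by (simp add: powr_minus inverse_eq_divide del: of_nat_Suc)
  qed simp
  have "(\<lambda>N. (norm s * exp (pi * \<bar>Im s\<bar>) + 1 / norm (s - 1) + 1) * real (Suc N) powr (1 - Re s)) \<longlonglongrightarrow>
      (norm s * exp (pi * \<bar>Im s\<bar>) + 1 / norm (s - 1) + 1) * 0"
    using s by (intro tendsto_intros tendsto_neg_powr filterlim_compose[OF filterlim_real_sequentially filterlim_Suc]) auto
  then have lim: "(\<lambda>N. (norm s * exp (pi * \<bar>Im s\<bar>) + 1 / norm (s - 1) + 1) * real (Suc N) powr (1 - Re s)) \<longlonglongrightarrow> 0"
    by simp
  have "norm (hurwitz (real (Suc N)) s) \<le> (norm s * exp (pi * \<bar>Im s\<bar>) + 1 / norm (s - 1) + 1) * real (Suc N) powr (1 - Re s)" for N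
    by (rule norm_hurwitz_le[OF s]) simp
  then have "(\<lambda>N. hurwitz (real (Suc N)) s) \<longlonglongrightarrow> 0"
    by (rule Lim_null_comparison[OF always_eventually[OF allI] lim])
  then have "(\<lambda>N. hurwitz 1 s - hurwitz (real (Suc N)) s) \<longlonglongrightarrow> hurwitz 1 s - 0" by (intro tendsto_intros)
  then show ?thesis unfolding sums_def part by simp
qed

lemma holomorphic_hurwitz:
  assumes "c > 0" shows "hurwitz c holomorphic_on - {1}"
  unfolding hurwitz_def by (intro holomorphic_intros holomorphic_ap_integral) (use assms in auto)

text \<open>In the definite description, \<open>hurwitz\<close> provides existence. Uniqueness is
  the identity theorem on the connected punctured plane together with the prescribed value at
  1.\<close>

lemma zeta_altdef: "zeta = (\<lambda>s. if s = 1 then 0 else hurwitz 1 s)"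
  unfolding zeta_def
proof (rule the_equality)
  let ?Z = "\<lambda>s. if s = 1 then 0 else hurwitz 1 s"
  have "?Z holomorphic_on - {1} \<longleftrightarrow> hurwitz 1 holomorphic_on - {1}" by (intro holomorphic_cong) auto
  then have hol: "?Z holomorphic_on - {1}" using holomorphic_hurwitz[of 1] by simp
  have sm: "hurwitz 1 s = (\<Sum>n. 1 / of_nat (Suc n) powr s)" if "Re s > 1" for s
    using hurwitz_sums[OF that] by (simp add: sums_iff)
  show "?Z holomorphic_on - {1} \<and> ?Z 1 = 0 \<and> (\<forall>s. Re s > 1 \<longrightarrow> ?Z s = (\<Sum>n. 1 / of_nat (Suc n) powr s))"
    using hol sm by auto
  fix g assume g: "g holomorphic_on - {1} \<and> g 1 = 0 \<and> (\<forall>s. Re s > 1 \<longrightarrow> g s = (\<Sum>n. 1 / of_nat (Suc n) powr s))"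
  have "g s = ?Z s" if "s \<noteq> 1" for s
  proof (rule analytic_continuation_open[where s="{s. Re s > 1}" and s'="- {1}" and z=s and f=g and g="?Z"])
    show "open {s. Re s > 1}" by (rule open_halfspace_Re_gt)
    show "{s. Re s > 1} \<noteq> {}" by (auto intro: exI[of _ 2])
    show "connected (- {1} :: complex set)" by (rule connected_punctured_universe) auto
  qed (use g hol sm that in auto)
  then show "g = ?Z" using g by (auto simp: fun_eq_iff)
qed

section \<open>The limit c -> 0 and the functional equation\<close>

lemma ap_integral_tendsto:
  assumes X: "X \<longlonglongrightarrow> c" and Xpos: "\<And>n. X n > 0"
    and bd: "\<And>n t. t > 0 \<Longrightarrow> norm (ap_diff (X n) s t) \<le> C * t * exp t"
  shows "(\<lambda>n. ap_integral (X n) s) \<longlonglongrightarrow> ap_integral c s"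
proof -
  \<comment> \<open>The limit may be 0 although all \<open>X n\<close> are positive; the functional
    equation relies on this boundary case.\<close>
  have c: "c \<ge> 0" using X Xpos by (intro LIMSEQ_le_const[OF X]) (auto intro: less_imp_le)
  show ?thesis
    unfolding ap_integral_def set_lebesgue_integral_def
  proof (rule integral_dominated_convergence[where w="\<lambda>t. indicat_real {0<..} t *\<^sub>R (C * t * exp t * bose t)"])
    show "(\<lambda>t. indicat_real {0<..} t *\<^sub>R (ap_diff c s t * of_real (bose t))) \<in> borel_measurable lborel"
      using set_borel_measurable_ap_diff[OF c] by (simp add: set_borel_measurable_def)
    show "(\<lambda>t. indicat_real {0<..} t *\<^sub>R (ap_diff (X n) s t * of_real (bose t))) \<in> borel_measurable lborel" for n
      using set_borel_measurable_ap_diff[OF less_imp_le[OF Xpos]] by (simp add: set_borel_measurable_def)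
    show "integrable lborel (\<lambda>t. indicat_real {0<..} t *\<^sub>R (C * t * exp t * bose t))"
      using set_integrable_exp_bose[of C] by (simp only: set_integrable_def)
    have "(\<lambda>n. ap_diff (X n) s t) \<longlonglongrightarrow> ap_diff c s t" if t: "t > 0" for t
    proof -
      have "of_real c + \<i> * of_real t \<notin> \<real>\<^sub>\<le>\<^sub>0" "of_real c - \<i> * of_real t \<notin> \<real>\<^sub>\<le>\<^sub>0"
        using t by (auto simp: complex_nonpos_Reals_iff)
      then show ?thesis unfolding ap_diff_def using X by (intro tendsto_intros tendsto_powr_complex)
    qed
    then have "(\<lambda>n. indicat_real {0<..} t *\<^sub>R (ap_diff (X n) s t * of_real (bose t))) \<longlonglongrightarrow>
        indicat_real {0<..} t *\<^sub>R (ap_diff c s t * of_real (bose t))" for t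
      by (cases "t > 0") (auto intro!: tendsto_mult simp: indicator_def)
    then show "AE t in lborel. (\<lambda>n. indicat_real {0<..} t *\<^sub>R (ap_diff (X n) s t * of_real (bose t))) \<longlonglongrightarrow>
        indicat_real {0<..} t *\<^sub>R (ap_diff c s t * of_real (bose t))" by (intro AE_I2)
    have "norm (indicat_real {0<..} t *\<^sub>R (ap_diff (X n) s t * of_real (bose t))) \<le>
        indicat_real {0<..} t *\<^sub>R (C * t * exp t * bose t)" for n t
    proof (cases "t > 0")
      case True
      then show ?thesis using mult_right_mono[OF bd[OF True, of n], of "bose t"] bose_pos[OF True] by (simp add: norm_mult)
    qed (simp add: indicator_def)
    then show "AE t in lborel. norm (indicat_real {0<..} t *\<^sub>R (ap_diff (X n) s t * of_real (bose t))) \<le>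
        indicat_real {0<..} t *\<^sub>R (C * t * exp t * bose t)" for n by (intro AE_I2)
  qed
qed

text \<open>For Re s <= -1 the exponent -Re s - 1 is nonnegative, so powers of |c + i u| do not blow
  up near 0 and one constant serves all small \<open>c\<close>.\<close>

lemma ap_diff_bound_small:
  assumes s: "Re s \<le> -1"
  obtains C where "\<And>c t. 0 < c \<Longrightarrow> c \<le> 1 \<Longrightarrow> t > 0 \<Longrightarrow> norm (ap_diff c s t) \<le> C * t * exp t"
proof -
  obtain C1 where C1: "C1 \<ge> 0" "\<And>x. x \<ge> 1 \<Longrightarrow> x powr (- Re s - 1) \<le> C1 * exp (1 * x)"
    using powr_le_exp[OF zero_less_one zero_less_one] by blast
  define B where "B = C1 * exp 1 * exp (pi * \<bar>Im s\<bar>)"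
  have "norm (ap_diff c s t) \<le> (2 * norm s * B) * t * exp t" if h: "0 < c" "c \<le> 1" "t > 0" for c t
  proof -
    have "norm (ap_diff c s t) \<le> 2 * t * (norm s * (B * exp t))"
    proof (rule norm_ap_diff_le[OF h(1,3)])
      fix u assume u: "\<bar>u\<bar> \<le> t"
      let ?z = "of_real c + \<i> * of_real u"
      have n: "norm ?z \<le> 1 + t" using norm_ge_Re_and_le_sum(2)[OF h(1) u] h by linarith
      have "norm ?z powr (- Re s - 1) \<le> (1 + t) powr (- Re s - 1)" using n s by (intro powr_mono2) auto
      also have "\<dots> \<le> C1 * exp (1 + t)" using C1(2)[of "1 + t"] h by simp
      finally have "norm ?z powr (- Re s - 1) * exp (pi * \<bar>Im s\<bar>) \<le> C1 * exp (1 + t) * exp (pi * \<bar>Im s\<bar>)"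
        by (intro mult_right_mono) auto
      moreover have "norm (?z powr (- s - 1)) \<le> norm ?z powr (- Re s - 1) * exp (pi * \<bar>Im s\<bar>)"
        using norm_powr_complex_le[of ?z "- s - 1"] by simp
      moreover have "C1 * exp (1 + t) * exp (pi * \<bar>Im s\<bar>) = B * exp t" by (simp add: B_def exp_add)
      ultimately show "norm (?z powr (- s - 1)) \<le> B * exp t" by linarith
    qed
    then show ?thesis by (simp add: mult_ac)
  qed
  then show ?thesis using that by blast
qed

text \<open>The arguments of i t and -i t are pi/2 and -pi/2; the two resulting exponentials combine
  into the sine factor of the functional equation.\<close>

lemma ap_diff_0:
  assumes t: "t > 0"
  shows "ap_diff 0 s t = 2 * sin (of_real pi * s / 2) * of_real t powr (- s)"
proof -
  have "(\<i> * of_real t) powr (- s) = of_real t powr (- s) * \<i> powr (- s)"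
    using powr_of_real_mult[OF t, of \<i> "- s"] by (simp add: mult.commute)
  moreover have "(- (\<i> * of_real t)) powr (- s) = of_real t powr (- s) * (- \<i>) powr (- s)"
    using powr_of_real_mult[OF t, of "- \<i>" "- s"] by (simp add: mult.commute)
  moreover have "\<i> powr (- s) = exp (- (\<i> * (of_real pi * s / 2)))" by (simp add: powr_def mult_ac)
  moreover have "(- \<i>) powr (- s) = exp (\<i> * (of_real pi * s / 2))" by (simp add: powr_def mult_ac)
  ultimately have "ap_diff 0 s t = of_real t powr (- s) * (\<i> * (exp (- (\<i> * (of_real pi * s / 2))) - exp (\<i> * (of_real pi * s / 2))))"
    by (simp add: ap_diff_def algebra_simps)
  also have "\<i> * (exp (- (\<i> * (of_real pi * s / 2))) - exp (\<i> * (of_real pi * s / 2))) = 2 * sin (of_real pi * s / 2)"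
    unfolding sin_exp_eq[of "of_real pi * s / 2"] by (simp add: field_simps)
  finally show ?thesis by simp
qed

text \<open>At c = 0 the integrand is a multiple of t^(-s) times the kernel. Expanding the kernel
  gives Gamma integrals at the rates 2 pi n, and these add up to the Dirichlet series at 1 - s,
  which converges because Re s < 0.\<close>

lemma ap_integral_0:
  assumes s: "Re s < 0"
  shows "ap_integral 0 s = 2 * sin (of_real pi * s / 2) * (Gamma (1 - s) * of_real (2 * pi) powr (s - 1) * hurwitz 1 (1 - s))"
proof -
  let ?h = "\<lambda>t. complex_of_real t powr (- s)"
  have b: "norm (?h t) \<le> 1 * t powr (- Re s)" if "t > 0" for t
    using norm_of_real_powr[OF that, of "- s"] by simp
  have m: "set_borel_measurable lborel {0<..} ?h"
    by (intro set_borel_measurable_continuous_on continuous_intros) auto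
  have p: "- Re s > 0" using s by simp
  have "(\<lambda>n. LBINT t:{0<..}. ?h t * of_real (exp (- (2 * pi * real (Suc n) * t)))) sums (LBINT t:{0<..}. ?h t * of_real (bose t))"
    by (rule integral_mult_bose_sums[OF p b m])
  moreover have "(LBINT t:{0<..}. ?h t * of_real (exp (- (2 * pi * real (Suc n) * t)))) =
      Gamma (1 - s) * of_real (2 * pi) powr (s - 1) * (1 / of_nat (Suc n) powr (1 - s))" for n
  proof -
    have "(LBINT t:{0<..}. ?h t * of_real (exp (- (2 * pi * real (Suc n) * t)))) =
       (LBINT t:{0<..}. complex_of_real t powr ((1 - s) - 1) * exp (- (of_real (2 * pi * real (Suc n)) * of_real t)))"
      by (simp add: exp_of_real[symmetric])
    also have "\<dots> = Gamma (1 - s) * of_real (2 * pi * real (Suc n)) powr (- (1 - s))"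
      using s by (intro integral_powr_exp_Ioi) auto
    also have "complex_of_real (2 * pi * real (Suc n)) powr (- (1 - s)) = of_real (2 * pi) powr (- (1 - s)) * of_nat (Suc n) powr (- (1 - s))"
      using powr_of_real_mult[of "2 * pi" "of_nat (Suc n)" "- (1 - s)"] by (simp del: of_nat_Suc)
    also have "complex_of_nat (Suc n) powr (- (1 - s)) = 1 / of_nat (Suc n) powr (1 - s)"
      unfolding powr_minus inverse_eq_divide ..
    finally show ?thesis by (simp del: of_nat_Suc)
  qed
  moreover have "(\<lambda>n. Gamma (1 - s) * of_real (2 * pi) powr (s - 1) * (1 / of_nat (Suc n) powr (1 - s))) sums
      (Gamma (1 - s) * of_real (2 * pi) powr (s - 1) * hurwitz 1 (1 - s))"
    using s by (intro sums_mult hurwitz_sums) auto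
  ultimately have I: "(LBINT t:{0<..}. ?h t * of_real (bose t)) = Gamma (1 - s) * of_real (2 * pi) powr (s - 1) * hurwitz 1 (1 - s)"
    by (simp only: sums_unique2)
  have "ap_integral 0 s = (LBINT t:{0<..}. 2 * sin (of_real pi * s / 2) * (?h t * of_real (bose t)))"
    unfolding ap_integral_def by (intro set_lebesgue_integral_cong) (auto simp: ap_diff_0)
  also have "\<dots> = 2 * sin (of_real pi * s / 2) * (LBINT t:{0<..}. ?h t * of_real (bose t))"
    by (rule set_integral_mult_right)
  finally show ?thesis unfolding I .
qed

text \<open>For Re s < -1 the terms c^(1-s)/(s-1) and c^(-s)/2, and the additional c^(-s) of the
  shift relation, all vanish as c -> 0. Comparing the limits of both sides of
  \<open>hurwitz_plus1\<close> along c = 1/(n+1) leaves the claim.\<close>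

lemma hurwitz_eq_ap_integral_0:
  assumes s: "Re s < -1"
  shows "hurwitz 1 s = ap_integral 0 s"
proof -
  have s1: "s \<noteq> 1" using s by auto
  define X where "X n = 1 / real (Suc n)" for n
  have X0: "X \<longlonglongrightarrow> 0" unfolding X_def using LIMSEQ_inverse_real_of_nat by (simp add: inverse_eq_divide)
  have Xp: "0 < X n" "X n \<le> 1" for n by (auto simp: X_def)
  have X1: "(\<lambda>n. X n + 1) \<longlonglongrightarrow> 1" using tendsto_add[OF X0 tendsto_const[of 1]] by simp
  have k0: "(\<lambda>n. ap_integral (X n) s) \<longlonglongrightarrow> ap_integral 0 s"
  proof -
    obtain C where C: "\<And>c t. 0 < c \<Longrightarrow> c \<le> 1 \<Longrightarrow> t > 0 \<Longrightarrow> norm (ap_diff c s t) \<le> C * t * exp t"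
      using ap_diff_bound_small[of s] s by auto
    show ?thesis by (rule ap_integral_tendsto[OF X0 Xp(1) C[OF Xp]])
  qed
  have k1: "(\<lambda>n. ap_integral (X n + 1) s) \<longlonglongrightarrow> ap_integral 1 s"
  proof -
    obtain C where C: "\<And>c s' t. 1 \<le> c \<Longrightarrow> c \<le> 2 \<Longrightarrow> norm s' \<le> norm s \<Longrightarrow> t > 0 \<Longrightarrow> norm (ap_diff c s' t) \<le> C * t * exp t"
      by (rule ap_diff_bound_uniform[OF zero_less_one, of 2 "norm s"]) blast
    show ?thesis
    proof (rule ap_integral_tendsto[OF X1])
      show "X n + 1 > 0" for n using Xp[of n] by simp
      show "norm (ap_diff (X n + 1) s t) \<le> C * t * exp t" if "t > 0" for n t
        using Xp[of n] that by (intro C) auto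
    qed
  qed
  have c0: "(\<lambda>n. complex_of_real (X n)) \<longlonglongrightarrow> 0" using X0 tendsto_of_real[OF X0, where 'a=complex] by simp
  have p0: "(\<lambda>n. complex_of_real (X n) powr w) \<longlonglongrightarrow> 0" if "Re w > 0" for w
    by (rule tendsto_powr_complex_0[OF c0 tendsto_const that])
  have L: "(\<lambda>n. hurwitz (X n) s) \<longlonglongrightarrow> ap_integral 0 s + 0 / (s - 1) + 0 / 2"
    unfolding hurwitz_def using s s1 by (intro tendsto_intros k0 p0) auto
  have c1: "(\<lambda>n. complex_of_real (X n + 1)) \<longlonglongrightarrow> of_real 1" by (intro tendsto_of_real X1)
  have p1: "(\<lambda>n. complex_of_real (X n + 1) powr w) \<longlonglongrightarrow> of_real 1 powr w" for w
    by (rule tendsto_powr_complex[OF _ c1 tendsto_const]) simp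
  have "(\<lambda>n. hurwitz (X n + 1) s) \<longlonglongrightarrow> ap_integral 1 s + of_real 1 powr (1 - s) / (s - 1) + of_real 1 powr (- s) / 2"
    unfolding hurwitz_def using s1 by (intro tendsto_intros k1 p1) auto
  then have R: "(\<lambda>n. hurwitz (X n + 1) s) \<longlonglongrightarrow> hurwitz 1 s" by (simp only: hurwitz_def)
  have "Re (- s) > 0" using s by simp
  from tendsto_add[OF p0[OF this] R] have "(\<lambda>n. of_real (X n) powr (- s) + hurwitz (X n + 1) s) \<longlonglongrightarrow> hurwitz 1 s" by simp
  then have "(\<lambda>n. hurwitz (X n) s) \<longlonglongrightarrow> hurwitz 1 s" using hurwitz_plus1[OF s1 Xp(1)] by simp
  from LIMSEQ_unique[OF this L] show ?thesis by simp
qed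

lemma zeta_functional_equation:
  assumes s: "Im s \<noteq> 0"
  shows "zeta s = 2 * sin (of_real pi * s / 2) * (Gamma (1 - s) * of_real (2 * pi) powr (s - 1) * zeta (1 - s))"
proof -
  \<comment> \<open>The plane slit along [0, infinity) is starlike and contains the half-plane Re s
    < -1. It avoids all singularities of both sides: s = 0 and s = 1 from the zeta factors, and s =
    1, 2, ... from Gamma(1 - s).\<close>
  define D where "D = - (complex_of_real ` {0..})"
  have Dne: "z \<noteq> of_real x" if "z \<in> D" "x \<ge> 0" for z x using that by (auto simp: D_def)
  have D01: "z \<noteq> 0" "z \<noteq> 1" if "z \<in> D" for z using Dne[OF that, of 0] Dne[OF that, of 1] by auto
  have "hurwitz 1 s = 2 * sin (of_real pi * s / 2) * (Gamma (1 - s) * of_real (2 * pi) powr (s - 1) * hurwitz 1 (1 - s))"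
  proof (rule analytic_continuation_open[where s="{s. Re s < -1}" and s'=D and z=s and f="hurwitz 1" and
      g="\<lambda>s. 2 * sin (of_real pi * s / 2) * (Gamma (1 - s) * of_real (2 * pi) powr (s - 1) * hurwitz 1 (1 - s))"])
    show "open {s. Re s < -1}" by (rule open_halfspace_Re_lt)
    show "{s. Re s < -1} \<noteq> {}" by (auto intro: exI[of _ "-2"])
    have "D = {s. Im s > 0} \<union> {s. Im s < 0} \<union> {s. Re s < 0}"
      by (auto simp: D_def complex_eq_iff image_iff Bex_def)
    then show "open D"
      by (auto intro!: open_Un open_halfspace_Im_gt open_halfspace_Im_lt open_halfspace_Re_lt)
    show "connected D" unfolding D_def by (rule starlike_imp_connected[OF starlike_slotted_complex_plane_right])
    show "{s. Re s < -1} \<subseteq> D" by (auto simp: D_def)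
    show "hurwitz 1 holomorphic_on D"
      by (rule holomorphic_on_subset[OF holomorphic_hurwitz]) (auto dest: D01)
    have h1: "(\<lambda>s. hurwitz 1 (1 - s)) holomorphic_on D"
    proof -
      have "(hurwitz 1 \<circ> (\<lambda>s. 1 - s)) holomorphic_on D"
        by (intro holomorphic_on_compose_gen[OF _ holomorphic_hurwitz] holomorphic_intros) (auto dest: D01)
      then show ?thesis by (simp only: o_def)
    qed
    have "1 - z \<notin> \<int>\<^sub>\<le>\<^sub>0" if "z \<in> D" for z
    proof
      assume "1 - z \<in> \<int>\<^sub>\<le>\<^sub>0"
      then obtain n where "1 - z = of_int n" "n \<le> 0" by (rule nonpos_Ints_cases)
      then have "z = of_real (1 - of_int n)" by (metis add_diff_cancel_left' diff_add_cancel of_real_1 of_real_diff of_real_of_int_eq)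
      with \<open>n \<le> 0\<close> Dne[OF that, of "1 - of_int n"] show False by simp
    qed
    then show "(\<lambda>s. 2 * sin (of_real pi * s / 2) * (Gamma (1 - s) * of_real (2 * pi) powr (s - 1) * hurwitz 1 (1 - s))) holomorphic_on D"
      by (intro holomorphic_intros h1) auto
    show "hurwitz 1 s = 2 * sin (of_real pi * s / 2) * (Gamma (1 - s) * of_real (2 * pi) powr (s - 1) * hurwitz 1 (1 - s))"
      if "s \<in> {s. Re s < -1}" for s
      using that hurwitz_eq_ap_integral_0[of s] ap_integral_0[of s] by simp
    show "s \<in> D" using s by (auto simp: D_def)
  qed
  moreover have "s \<noteq> 1" "1 - s \<noteq> 1" using s by auto
  ultimately show ?thesis by (simp add: zeta_altdef)
qed

text \<open>The other factors of the functional equation do not vanish off the real axis: the sine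
  has real zeros only, Gamma and the power have none.\<close>

lemma zeta_reflect_zero:
  assumes "zeta s = 0" "Im s \<noteq> 0"
  shows "zeta (1 - s) = 0"
proof -
  have "sin (of_real pi * s / 2) \<noteq> 0"
  proof
    assume "sin (of_real pi * s / 2) = 0"
    then obtain n where "of_real pi * s / 2 = complex_of_real (of_int n * pi)" by (auto simp: sin_eq_0)
    from arg_cong[OF this, of Im] have "pi * Im s / 2 = 0" by simp
    then show False using assms by simp
  qed
  moreover have "1 - s \<notin> \<int>\<^sub>\<le>\<^sub>0" using assms by (auto elim!: nonpos_Ints_cases simp: complex_eq_iff)
  then have "Gamma (1 - s) \<noteq> 0" by (simp add: Gamma_eq_zero_iff)
  moreover have "complex_of_real (2 * pi) powr (s - 1) \<noteq> 0" by simp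
  ultimately show ?thesis using zeta_functional_equation[OF assms(2)] assms(1) by (metis mult_eq_0_iff zero_neq_numeral)
qed

section \<open>Location of the zeros\<close>

text \<open>The terms of the Dirichlet series after the first have total modulus at most pi^2/6 - 1
  < 1, so they cannot cancel the leading 1.\<close>

lemma zeta_nonzero_Re_ge_2:
  assumes s: "Re s \<ge> 2"
  shows "zeta s \<noteq> 0"
proof
  assume z: "zeta s = 0"
  have "s \<noteq> 1" using s by auto
  then have "hurwitz 1 s = 0" using z by (simp add: zeta_altdef)
  then have "(\<lambda>n. 1 / of_nat (Suc n) powr s) sums 0" using hurwitz_sums[of s] s by simp
  then have S: "(\<lambda>n. 1 / of_nat (Suc (Suc n)) powr s) sums (0 - 1)"
    by (subst sums_Suc_iff) simp
  have "(\<lambda>n. 1 / (real (Suc n))\<^sup>2) sums (pi\<^sup>2 / 6)" using inverse_squares_sums by (simp add: add.commute)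
  then have Q: "(\<lambda>n. 1 / (real (Suc (Suc n)))\<^sup>2) sums (pi\<^sup>2 / 6 - 1)"
    by (subst sums_Suc_iff) simp
  have le: "norm (1 / of_nat (Suc (Suc n)) powr s) \<le> 1 / (real (Suc (Suc n)))\<^sup>2" for n
  proof -
    have "norm (of_nat (Suc (Suc n)) powr s) = real (Suc (Suc n)) powr Re s"
      using norm_of_real_powr[of "real (Suc (Suc n))" s] by (simp del: of_nat_Suc)
    moreover have "real (Suc (Suc n)) powr 2 \<le> real (Suc (Suc n)) powr Re s" using s by (intro powr_mono) auto
    moreover have "real (Suc (Suc n)) powr 2 = (real (Suc (Suc n)))\<^sup>2" by (simp add: powr_numeral del: of_nat_Suc)
    ultimately show ?thesis by (simp add: norm_divide frac_le del: of_nat_Suc)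
  qed
  have "norm (\<Sum>n. 1 / of_nat (Suc (Suc n)) powr s) \<le> (\<Sum>n. 1 / (real (Suc (Suc n)))\<^sup>2)"
    by (rule norm_suminf_le[OF le]) (use Q in \<open>simp add: sums_iff\<close>)
  then have "1 \<le> pi\<^sup>2 / 6 - 1" using S Q by (simp add: sums_iff)
  moreover have "pi\<^sup>2 \<le> 3.2\<^sup>2" using pi_approx by (intro power_mono) auto
  ultimately show False by (simp add: power2_eq_square)
qed

text \<open>With y = pi/2 - |arctan u| one has 1/sqrt(1 + u^2) = sin y <= y <= exp(y - 1); take
  logarithms. It bounds the argument of 1 + i u by the logarithm of its modulus plus a constant
  below 1.\<close>

lemma arctan_le_ln:
  fixes u :: real
  shows "\<bar>arctan u\<bar> \<le> ln (sqrt (1 + u\<^sup>2)) + (pi / 2 - 1)"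
proof -
  define y where "y = pi / 2 - \<bar>arctan u\<bar>"
  have y: "y > 0" using arctan_ubound[of u] arctan_lbound[of u] by (simp add: y_def)
  have "1 / sqrt (1 + u\<^sup>2) = cos (arctan u)" by (simp add: cos_arctan)
  also have "\<dots> = cos \<bar>arctan u\<bar>" by simp
  also have "\<dots> = sin y" by (simp add: y_def sin_diff)
  also have "\<dots> \<le> y" using y by (intro sin_x_le_x) auto
  also have "\<dots> \<le> exp (y - 1)" using exp_ge_add_one_self[of "y - 1"] by simp
  finally have "ln (1 / sqrt (1 + u\<^sup>2)) \<le> y - 1"
    by (metis ln_mono ln_exp add_pos_nonneg real_sqrt_gt_0_iff zero_less_divide_1_iff zero_le_power2 zero_less_one)
  moreover have "ln (1 / sqrt (1 + u\<^sup>2)) = - ln (sqrt (1 + u\<^sup>2))"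
    by (metis ln_inverse inverse_eq_divide add_pos_nonneg real_sqrt_gt_0_iff zero_le_power2 zero_less_one)
  ultimately show ?thesis by (simp add: y_def)
qed

text \<open>At a zero the integral term would equal -(s+1)/(2(s-1)), the negative of 1/(s-1) + 1/2.
  Its modulus is however at most |s| e/12, and |s| <= |s+1|, so |s - 1| would have to be at least
  6/e, too far from 1 for a point of the wedge.\<close>

lemma zeta_nonzero_wedge:
  assumes s: "1/2 \<le> Re s" "Re s \<le> 2" "\<bar>Im s\<bar> \<le> Re s - 1/2" and s1: "s \<noteq> 1"
  shows "zeta s \<noteq> 0"
proof
  assume "zeta s = 0"
  then have h0: "hurwitz 1 s = 0" using s1 by (simp add: zeta_altdef)
  have K: "norm (ap_integral 1 s) \<le> norm s * exp 1 / 12"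
  proof (rule norm_ap_integral_le)
    fix u :: real
    let ?z = "complex_of_real 1 + \<i> * of_real u"
    have nz: "?z \<noteq> 0" by (simp add: complex_eq_iff)
    have nn: "norm ?z = sqrt (1 + u\<^sup>2)" by (simp add: cmod_def)
    have L0: "ln (norm ?z) \<ge> 0" unfolding nn by simp
    have im: "Im (Ln ?z) = arctan u" using nz by (subst Im_Ln_eq) auto
    have "Re ((- s - 1) * Ln ?z) = Im s * arctan u - (Re s + 1) * ln (norm ?z)"
      using nz im by (simp add: algebra_simps)
    also have "Im s * arctan u \<le> \<bar>Im s\<bar> * \<bar>arctan u\<bar>" by (metis abs_ge_self abs_mult)
    also have "\<dots> \<le> \<bar>Im s\<bar> * (ln (norm ?z) + (pi / 2 - 1))"
      using arctan_le_ln[of u] unfolding nn by (intro mult_left_mono) auto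
    also have "\<bar>Im s\<bar> * (ln (norm ?z) + (pi / 2 - 1)) - (Re s + 1) * ln (norm ?z) =
        \<bar>Im s\<bar> * (pi / 2 - 1) - (Re s + 1 - \<bar>Im s\<bar>) * ln (norm ?z)" by (simp add: algebra_simps)
    \<comment> \<open>Here the wedge condition enters: with |Im s| <= Re s - 1/2 the logarithm
      occurs with a negative coefficient, so the bound is uniform in \<open>u\<close>.\<close>
    also have "\<dots> \<le> \<bar>Im s\<bar> * (pi / 2 - 1)" using s L0 by simp
    also have "\<dots> \<le> (3/2) * (6/10)" using s pi_approx by (intro mult_mono) auto
    finally have "Re ((- s - 1) * Ln ?z) \<le> 1" by simp
    then show "norm (?z powr (- s - 1)) \<le> exp 1" using nz by (simp add: powr_def del: of_real_1)
  qed simp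
  have "ap_integral 1 s = - ((s + 1) / (2 * (s - 1)))"
    using h0 s1 by (simp add: hurwitz_def field_simps add_eq_0_iff) 
  then have "norm (s + 1) / (2 * norm (s - 1)) \<le> norm s * exp 1 / 12"
    using K by (simp only: norm_minus_cancel norm_divide norm_mult norm_numeral)
  moreover have "norm s \<le> norm (s + 1)" using s by (simp add: cmod_def power2_eq_square algebra_simps)
  ultimately have "norm s / (2 * norm (s - 1)) \<le> norm s * exp 1 / 12"
    by (meson divide_right_mono mult_nonneg_nonneg norm_ge_zero order_trans zero_le_numeral)
  moreover have "norm s > 0" using s by auto
  moreover have "norm (s - 1) > 0" using s1 by simp
  \<comment> \<open>Numerically 6/2.72 > 2.2, whereas the wedge gives |s - 1|^2 <= 1 + 9/4 <
    2.2^2.\<close>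
  ultimately have "6 \<le> exp 1 * norm (s - 1)" by (simp add: field_simps)
  also have "\<dots> \<le> 272/100 * norm (s - 1)" using e_less_272 by (intro mult_right_mono) auto
  finally have "2.2 \<le> norm (s - 1)" by simp
  then have "2.2\<^sup>2 \<le> (norm (s - 1))\<^sup>2" by (intro power_mono) auto
  also have "(norm (s - 1))\<^sup>2 = (Re s - 1)\<^sup>2 + (Im s)\<^sup>2" by (simp add: cmod_power2)
  also have "(Re s - 1)\<^sup>2 \<le> 1\<^sup>2" using s by (subst abs_le_square_iff[symmetric]) auto
  also have "(Im s)\<^sup>2 \<le> (3/2)\<^sup>2" using s by (subst abs_le_square_iff[symmetric]) auto
  finally show False by (simp add: power2_eq_square)
qed

text \<open>A zero with real part below 1/2 is replaced by its reflection, which flips the signs of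
  Re s - 1/2 and Im s but not their absolute values. The constant 3/2 is the distance from 1/2 to
  the zero-free half-plane Re s >= 2.\<close>

lemma zeta_zero_location:
  assumes z: "zeta \<rho> = 0" and im: "Im \<rho> > 0"
  shows "\<bar>Re \<rho> - 1/2\<bar> < 3/2" "\<bar>Re \<rho> - 1/2\<bar> < Im \<rho>"
proof -
  have *: "Re s < 2 \<and> Re s - 1/2 < \<bar>Im s\<bar>" if "zeta s = 0" "Im s \<noteq> 0" "Re s \<ge> 1/2" for s
  proof -
    have "Re s < 2" using zeta_nonzero_Re_ge_2[of s] that by fastforce
    moreover have "s \<noteq> 1" using that by auto
    ultimately show ?thesis using zeta_nonzero_wedge[of s] that by fastforce
  qed
  have "\<bar>Re \<rho> - 1/2\<bar> < 3/2 \<and> \<bar>Re \<rho> - 1/2\<bar> < Im \<rho>"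
  proof (cases "Re \<rho> \<ge> 1/2")
    case True
    then show ?thesis using *[OF z] im by auto
  next
    case False
    then show ?thesis using *[OF zeta_reflect_zero[OF z]] im by auto
  qed
  then show "\<bar>Re \<rho> - 1/2\<bar> < 3/2" "\<bar>Re \<rho> - 1/2\<bar> < Im \<rho>" by auto
qed

section \<open>Counting the zeros\<close>

text \<open>Points are split off one at a time. The product over the earlier points does not vanish
  at the new one, so \<open>f\<close> and the current cofactor have the same order there.\<close>

lemma entire_factor_zeros:
  fixes f :: "complex \<Rightarrow> complex"
  assumes "finite Z" and f: "f holomorphic_on UNIV" and nz: "f c \<noteq> 0"
  shows "\<exists>h. h holomorphic_on UNIV \<and> (\<forall>w. f w = h w * (\<Prod>z\<in>Z. (w - z) ^ nat (zorder f z)))"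
  using assms(1)
proof (induction Z rule: finite_induct)
  case empty
  then show ?case using f by auto
next
  case (insert z Z)
  then obtain h where h: "h holomorphic_on UNIV"
    and fh: "\<And>w. f w = h w * (\<Prod>z\<in>Z. (w - z) ^ nat (zorder f z))" by blast
  define P where "P w = (\<Prod>z\<in>Z. (w - z) ^ nat (zorder f z))" for w
  have Pz: "P z \<noteq> 0" using insert by (auto simp: P_def)
  have hP: "f = (\<lambda>w. h w * P w)" using fh by (simp add: P_def fun_eq_iff)
  have Phol: "P holomorphic_on UNIV" unfolding P_def by (intro holomorphic_intros)
  have han: "h analytic_on {z}" and Pan: "P analytic_on {z}"
    using h Phol by (auto simp: analytic_at)
  \<comment> \<open>Additivity of \<open>zorder\<close> presupposes a product that is nonzero on a
    punctured neighbourhood; \<open>f c \<noteq> 0\<close> guarantees this everywhere.\<close>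
  have "\<forall>\<^sub>F w in at z. f w \<noteq> 0 \<and> w \<in> UNIV"
    by (rule non_zero_neighbour_alt[OF f _ _ _ _ nz]) auto
  then have ev: "\<forall>\<^sub>F w in at z. h w * P w \<noteq> 0" by (simp add: hP)
  have "zorder P z = 0" using zorder_eq_0I[OF Pan Pz] .
  then have ord: "zorder f z = zorder h z"
    using zorder_times_analytic[OF han Pan ev] by (simp add: hP)
  define n where "n = nat (zorder h z)"
  have "\<exists>w\<in>UNIV. h w \<noteq> 0" using nz hP by (auto intro!: bexI[of _ c])
  from zorder_exist_zero[OF h open_UNIV connected_UNIV UNIV_I this] obtain r where
    r: "r > 0" "zor_poly h z holomorphic_on cball z r"
      "\<And>w. w \<in> cball z r \<Longrightarrow> h w = zor_poly h z w * (w - z) ^ n" unfolding n_def by blast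
  \<comment> \<open>The quotient is glued from plain division away from \<open>z\<close> and
    \<open>zor_poly\<close> near \<open>z\<close>; only the value at \<open>z\<close> itself has to
    be supplied.\<close>
  define k where "k w = (if w = z then zor_poly h z z else h w / (w - z) ^ n)" for w
  have hk: "h w = k w * (w - z) ^ n" for w
    using r(1) r(3)[of z] by (auto simp: k_def)
  have "k holomorphic_on - {z} \<union> ball z r"
  proof (rule holomorphic_on_Un)
    have "(\<lambda>w. h w / (w - z) ^ n) holomorphic_on - {z}"
      by (intro holomorphic_intros holomorphic_on_subset[OF h]) auto
    then show "k holomorphic_on - {z}" by (rule holomorphic_transform) (auto simp: k_def)
    have "zor_poly h z holomorphic_on ball z r"
      using r(2) by (rule holomorphic_on_subset) auto
    then show "k holomorphic_on ball z r"
    proof (rule holomorphic_transform)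
      fix w assume "w \<in> ball z r"
      then show "zor_poly h z w = k w" using r(3)[of w] by (auto simp: k_def)
    qed
  qed auto
  moreover have "- {z} \<union> ball z r = UNIV" using r(1) by auto
  ultimately have k: "k holomorphic_on UNIV" by simp
  have "f w = k w * (\<Prod>z\<in>insert z Z. (w - z) ^ nat (zorder f z))" for w
    using insert hk[of w] fh[of w] ord by (simp add: n_def mult_ac)
  then show ?case using k by blast
qed

text \<open>A weak form of Jensen's inequality: dividing out the zeros costs at most a factor
  \<open>1 / (2 * r)\<close> each on the circle of radius \<open>3 * r\<close> and gains at most \<open>r\<close> each at the centre.\<close>

lemma entire_zeros_bound:
  fixes f :: "complex \<Rightarrow> complex"
  assumes Z: "finite Z" "Z \<subseteq> cball c r" and r: "r > 0"
    and f: "f holomorphic_on UNIV" and nz: "f c \<noteq> 0"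
    and M: "\<And>w. norm (w - c) = 3 * r \<Longrightarrow> norm (f w) \<le> M"
  shows "norm (f c) * 2 ^ (\<Sum>z\<in>Z. nat (zorder f z)) \<le> M"
proof -
  obtain h where h: "h holomorphic_on UNIV"
    and fh: "\<And>w. f w = h w * (\<Prod>z\<in>Z. (w - z) ^ nat (zorder f z))"
    using entire_factor_zeros[OF Z(1) f nz] by blast
  define k where "k = (\<Sum>z\<in>Z. nat (zorder f z))"
  have pw: "(\<Prod>z\<in>Z. x ^ nat (zorder f z)) = x ^ k" for x :: real by (simp add: k_def power_sum)
  have hb: "norm (h w) \<le> M / (2 * r) ^ k" if w: "norm (c - w) = 3 * r" for w
  proof -
    have "(2 * r) ^ k \<le> (\<Prod>z\<in>Z. norm (w - z) ^ nat (zorder f z))"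
      unfolding pw[symmetric]
    proof (intro prod_mono conjI power_mono)
      fix z assume "z \<in> Z"
      then have "norm (c - z) \<le> r" using Z(2) by (auto simp: dist_norm)
      moreover have "norm (c - w) \<le> norm (c - z) + norm (w - z)"
        using norm_triangle_ineq[of "c - z" "z - w"] by (simp add: norm_minus_commute)
      ultimately show "2 * r \<le> norm (w - z)" using w by linarith
    qed (use r in auto)
    then have "norm (h w) * (2 * r) ^ k \<le> norm (h w) * (\<Prod>z\<in>Z. norm (w - z) ^ nat (zorder f z))"
      by (intro mult_left_mono) auto
    also have "\<dots> = norm (f w)" by (simp add: fh[of w] norm_mult norm_power flip: prod_norm)
    also have "\<dots> \<le> M" using M[of w] w by (simp add: norm_minus_commute)
    finally show ?thesis using r by (simp add: pos_le_divide_eq)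
  qed
  \<comment> \<open>Cauchy's inequality for the derivative of order 0 is the maximum principle for
    the zero-free cofactor \<open>h\<close>.\<close>
  have "norm ((deriv ^^ 0) h c) \<le> fact 0 * (M / (2 * r) ^ k) / (3 * r) ^ 0"
    by (rule Cauchy_inequality) (use h r hb in \<open>auto intro: holomorphic_on_subset holomorphic_on_imp_continuous_on\<close>)
  then have "norm (h c) \<le> M / (2 * r) ^ k" by simp
  then have hc: "norm (h c) * (2 * r) ^ k \<le> M" using r by (simp add: pos_le_divide_eq)
  have "norm (f c) = norm (h c) * (\<Prod>z\<in>Z. norm (c - z) ^ nat (zorder f z))"
    by (simp add: fh[of c] norm_mult norm_power flip: prod_norm)
  also have "\<dots> \<le> norm (h c) * r ^ k"
    unfolding pw[symmetric] using Z(2) by (intro mult_left_mono prod_mono conjI power_mono) (auto simp: dist_norm)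
  finally have "norm (f c) * 2 ^ k \<le> norm (h c) * r ^ k * 2 ^ k" by (intro mult_right_mono) auto
  also have "\<dots> = norm (h c) * (2 * r) ^ k" by (simp add: power_mult_distrib)
  finally show ?thesis using hc unfolding k_def by linarith
qed

text \<open>This is \<open>(s - 1) \<zeta>(s)\<close>, extended over the pole.\<close>

definition ezeta :: "complex \<Rightarrow> complex" where
  "ezeta s = (s - 1) * (ap_integral 1 s + 1 / 2) + 1"

lemma holomorphic_ezeta: "ezeta holomorphic_on A"
  unfolding ezeta_def by (intro holomorphic_intros holomorphic_ap_integral) auto

lemma ezeta_eq: "s \<noteq> 1 \<Longrightarrow> ezeta s = (s - 1) * zeta s"
  by (simp add: ezeta_def zeta_altdef hurwitz_def distrib_left)

text \<open>The extra factor s - 1 has order 0 at \<open>z\<close>, so multiplicities of zeta zeros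
  can be counted with an entire function.\<close>

lemma zorder_ezeta:
  assumes "z \<noteq> 1"
  shows "zorder ezeta z = zorder zeta z"
proof -
  have "zeta holomorphic_on - {1}"
    by (rule holomorphic_transform[OF holomorphic_hurwitz[of 1]]) (auto simp: zeta_altdef)
  then have zan: "zeta analytic_on {z}" using assms by (auto simp: analytic_at intro!: exI[of _ "- {1}"])
  have lan: "(\<lambda>s. s - 1) analytic_on {z}" by (intro analytic_intros)
  have evn: "\<forall>\<^sub>F s in at z. s \<noteq> 1" using assms by (metis eventually_neq_at_within)
  have "ezeta 2 \<noteq> 0" using zeta_nonzero_Re_ge_2[of 2] by (simp add: ezeta_eq)
  from non_zero_neighbour_alt[OF holomorphic_ezeta open_UNIV connected_UNIV UNIV_I UNIV_I this, of z]
  have "\<forall>\<^sub>F s in at z. (s - 1) * zeta s \<noteq> 0"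
    using evn by eventually_elim (auto simp: ezeta_eq)
  from zorder_times_analytic[OF lan zan this]
  have "zorder (\<lambda>s. (s - 1) * zeta s) z = zorder (\<lambda>s. s - 1) z + zorder zeta z" .
  moreover have "zorder (\<lambda>s. s - 1) z = 0" using assms by (intro zorder_eq_0I[OF lan]) auto
  moreover have "zorder ezeta z = zorder (\<lambda>s. (s - 1) * zeta s) z"
    by (rule zorder_cong) (use evn in \<open>auto elim!: eventually_mono simp: ezeta_eq\<close>)
  ultimately show ?thesis by simp
qed

text \<open>The only delicate factor is |1 + i u|^R with |u| <= t: it is bounded by exp(R^2 + 1)
  times exp(t), and the kernel absorbs exp(t). The quadratic exponent is generous but keeps the
  integral free of R.\<close>

lemma ezeta_growth:
  obtains A where "A > 0" "\<And>R s. R \<ge> 1 \<Longrightarrow> norm s \<le> R \<Longrightarrow> norm (ezeta s) \<le> exp (A * R\<^sup>2)"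
proof -
  define I where "I = (LBINT t:{0<..}. t * exp t * bose t)"
  have Ii: "set_integrable lborel {0<..} (\<lambda>t. t * exp t * bose t)"
    using set_integrable_exp_bose[of 1] by simp
  have I0: "I \<ge> 0" unfolding I_def set_lebesgue_integral_def
    by (rule Bochner_Integration.integral_nonneg) (simp add: indicator_def bose_pos less_imp_le)
  have "norm (ezeta s) \<le> exp ((I + 11) * R\<^sup>2)" if R: "R \<ge> 1" and s: "norm s \<le> R" for R s
  proof -
    have reim: "\<bar>Re s\<bar> \<le> R" "\<bar>Im s\<bar> \<le> R" using s abs_Re_le_cmod[of s] abs_Im_le_cmod[of s] by linarith+
    have R2: "R \<le> R\<^sup>2" using R by (simp add: power2_eq_square)
    define B where "B = exp (R\<^sup>2 + 1 + pi * R)"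
    have pt: "norm (ap_diff 1 s t) \<le> 2 * t * (R * (B * exp t))" if t: "t > 0" for t
    proof -
      have "norm (ap_diff 1 s t) \<le> 2 * t * (norm s * (B * exp t))"
      proof (rule norm_ap_diff_le[OF zero_less_one t])
        fix u assume u: "\<bar>u\<bar> \<le> t"
        let ?z = "complex_of_real 1 + \<i> * of_real u"
        have n: "norm ?z \<ge> 1" "norm ?z \<le> 1 + t" using norm_ge_Re_and_le_sum[OF zero_less_one u] by simp_all
        have "norm ?z powr (- Re s - 1) \<le> norm ?z powr R" using n reim by (intro powr_mono) auto
        also have "\<dots> \<le> (1 + t) powr R" using n R by (intro powr_mono2) auto
        also have "\<dots> = exp (R * ln (1 + t))" using t by (simp add: powr_def)
        \<comment> \<open>Applying ln y <= y - 1 to y = (1 + t)/R is chosen so that multiplication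
          by R leaves exactly the coefficient 1 at t.\<close>
        also have "R * ln (1 + t) \<le> R\<^sup>2 + 1 + t"
        proof -
          have "ln ((1 + t) / R) \<le> (1 + t) / R - 1" using R t by (intro ln_le_minus_one) auto
          then have "ln (1 + t) \<le> ln R + (1 + t) / R" using R t by (simp add: ln_div)
          also have "ln R \<le> R" using ln_le_minus_one[of R] R by simp
          finally have "R * ln (1 + t) \<le> R * (R + (1 + t) / R)" using R by (intro mult_left_mono) auto
          also have "R * (R + (1 + t) / R) = R\<^sup>2 + 1 + t"
            using R by (subst distrib_left) (simp add: power2_eq_square)
          finally show ?thesis .
        qed
        finally have 1: "norm ?z powr (- Re s - 1) \<le> exp (R\<^sup>2 + 1 + t)" by simp
        have "norm (?z powr (- s - 1)) \<le> norm ?z powr (- Re s - 1) * exp (pi * \<bar>Im s\<bar>)"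
          using norm_powr_complex_le[of ?z "- s - 1"] by simp
        also have "\<dots> \<le> exp (R\<^sup>2 + 1 + t) * exp (pi * R)"
          using 1 reim by (intro mult_mono) auto
        also have "\<dots> = B * exp t" by (simp add: B_def flip: exp_add)
        finally show "norm (?z powr (- s - 1)) \<le> B * exp t" .
      qed
      also have "\<dots> \<le> 2 * t * (R * (B * exp t))"
        using s t by (intro mult_left_mono mult_right_mono) (auto simp: B_def)
      finally show ?thesis .
    qed
    have "norm (ap_integral 1 s) \<le> (LBINT t:{0<..}. norm (ap_diff 1 s t * of_real (bose t)))"
      unfolding ap_integral_def by (rule set_integral_norm_bound[OF set_integrable_ap_diff[OF zero_less_one]])
    also have "\<dots> \<le> (LBINT t:{0<..}. 2 * R * B * (t * exp t * bose t))"
    proof (rule set_integral_mono[OF set_integrable_norm[OF set_integrable_ap_diff[OF zero_less_one]] set_integrable_mult_right[OF Ii]])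
      fix t :: real assume "t \<in> {0<..}"
      then have t: "t > 0" by simp
      show "norm (ap_diff 1 s t * of_real (bose t)) \<le> 2 * R * B * (t * exp t * bose t)"
        using mult_right_mono[OF pt[OF t], of "bose t"] bose_pos[OF t] by (simp add: norm_mult mult_ac)
    qed
    also have "\<dots> = 2 * R * B * I" unfolding I_def by (rule set_integral_mult_right)
    finally have K: "norm (ap_integral 1 s) \<le> 2 * R * B * I" .
    have "2 * R * B \<le> exp (8 * R\<^sup>2)"
    proof -
      have "2 * R \<le> exp (2 * R)" using exp_ge_add_one_self[of "2 * R"] by linarith
      then have "2 * R * B \<le> exp (2 * R) * B" by (intro mult_right_mono) (auto simp: B_def)
      also have "\<dots> = exp (2 * R + (R\<^sup>2 + 1 + pi * R))" by (simp add: B_def flip: exp_add)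
      \<comment> \<open>As R >= 1, the terms 2R, R^2, 1 and pi R are at most 2, 1, 1 and 4 times
        R^2.\<close>
      also have "\<dots> \<le> exp (8 * R\<^sup>2)"
      proof -
        have "pi * R \<le> 4 * R" using R pi_less_4 by (intro mult_right_mono) auto
        then have "2 * R + (R\<^sup>2 + 1 + pi * R) \<le> 8 * R\<^sup>2" using R R2 by linarith
        then show ?thesis by (simp only: exp_le_cancel_iff)
      qed
      finally show ?thesis .
    qed
    then have "2 * R * B * I \<le> exp (8 * R\<^sup>2) * I" using I0 by (intro mult_right_mono)
    then have "norm (ap_integral 1 s + 1 / 2) \<le> exp (8 * R\<^sup>2) * I + 1"
      using K norm_triangle_ineq[of "ap_integral 1 s" "1/2"] by simp
    also have "\<dots> \<le> exp (8 * R\<^sup>2) * (I + 1)" using R by (simp add: distrib_left)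
    finally have 1: "norm (ap_integral 1 s + 1 / 2) \<le> exp (8 * R\<^sup>2) * (I + 1)" .
    have 2: "norm (s - 1) \<le> exp (R\<^sup>2)"
    proof -
      have "norm (s - 1) \<le> R + 1" using norm_triangle_ineq4[of s 1] s by simp
      also have "\<dots> \<le> exp R" using exp_ge_add_one_self[of R] by linarith
      finally show ?thesis using R2 by (meson exp_le_cancel_iff order_trans)
    qed
    have "norm (ezeta s) \<le> norm (s - 1) * norm (ap_integral 1 s + 1 / 2) + 1"
      unfolding ezeta_def using norm_triangle_ineq[of "(s - 1) * (ap_integral 1 s + 1/2)" 1] by (simp add: norm_mult)
    also have "\<dots> \<le> exp (R\<^sup>2) * (exp (8 * R\<^sup>2) * (I + 1)) + 1"
      using 1 2 by (intro add_mono mult_mono) auto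
    also have "\<dots> = exp (9 * R\<^sup>2) * (I + 1) + 1" by (simp add: mult.assoc[symmetric] flip: exp_add)
    also have "\<dots> \<le> exp (9 * R\<^sup>2) * (I + 2)" using R by (simp add: distrib_left)
    also have "\<dots> \<le> exp (9 * R\<^sup>2) * exp (I + 2)"
      using exp_ge_add_one_self[of "I + 2"] by (intro mult_left_mono) auto
    also have "\<dots> = exp (9 * R\<^sup>2 + (I + 2) * 1)" by (simp flip: exp_add)
    also have "\<dots> \<le> exp (9 * R\<^sup>2 + (I + 2) * R\<^sup>2)"
      using R I0 one_le_power[OF R, of 2] by (simp add: mult_left_le)
    also have "\<dots> = exp ((I + 11) * R\<^sup>2)" by (simp add: algebra_simps)
    finally show ?thesis .
  qed
  then show ?thesis using that[of "I + 11"] I0 by auto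
qed

text \<open>The imaginary parts increase and the real parts are bounded, so the first n zeros lie in
  a disc about 3 of radius Im \<rho>_n + 4. There \<open>entire_zeros_bound\<close> gives 2^n
  against exp of a quadratic in Im \<rho>_n; the centre 3 is a point where \<open>ezeta\<close> is
  known not to vanish.\<close>

lemma zeta_zeros_count:
  assumes \<rho>: "upper_zeta_zeros \<rho>"
  obtains C where "C > 0" "\<And>n. n \<ge> 1 \<Longrightarrow> real n \<le> C * (1 + Im (\<rho> n))\<^sup>2"
proof -
  have zer: "zeta (\<rho> n) = 0" "Im (\<rho> n) > 0" "Im (\<rho> n) \<le> Im (\<rho> (Suc n))" if "n \<ge> 1" for n
    using \<rho> that by (auto simp: upper_zeta_zeros_def)
  have mult: "finite {n. n \<ge> 1 \<and> \<rho> n = z}" "int (card {n. n \<ge> 1 \<and> \<rho> n = z}) = zorder zeta z"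
    if "zeta z = 0" "Im z > 0" for z
    using \<rho> that by (auto simp: upper_zeta_zeros_def)
  have mono: "Im (\<rho> k) \<le> Im (\<rho> n)" if "1 \<le> k" "k \<le> n" for k n
    using that(2)
  proof (induction n rule: dec_induct)
    case (step m)
    then show ?case using zer(3)[of m] that(1) by linarith
  qed simp
  obtain A where A: "A > 0" "\<And>R s. R \<ge> 1 \<Longrightarrow> norm s \<le> R \<Longrightarrow> norm (ezeta s) \<le> exp (A * R\<^sup>2)"
    using ezeta_growth by blast
  have e3: "ezeta 3 \<noteq> 0" using zeta_nonzero_Re_ge_2[of 3] by (simp add: ezeta_eq)
  define L where "L = \<bar>ln (norm (ezeta 3))\<bar>"
  \<comment> \<open>The 225 is 15^2, from 3 + 3(T + 4) <= 15(1 + T). The factor 2 comes from ln 2 >=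
    1/2, and \<open>L\<close> accounts for the value at the centre.\<close>
  define C where "C = 2 * (225 * A + L)"
  have "real n \<le> C * (1 + Im (\<rho> n))\<^sup>2" if n: "n \<ge> 1" for n
  proof -
    define T where "T = Im (\<rho> n)"
    have T: "T > 0" using zer[OF n] by (simp add: T_def)
    define Z where "Z = \<rho> ` {1..n}"
    have "norm (ezeta 3) * 2 ^ (\<Sum>z\<in>Z. nat (zorder ezeta z)) \<le> exp (A * (3 + 3 * (T + 4))\<^sup>2)"
    proof (rule entire_zeros_bound[where r="T + 4"])
      show "finite Z" by (simp add: Z_def)
      show "Z \<subseteq> cball 3 (T + 4)"
      proof
        fix z assume "z \<in> Z"
        then obtain k where k: "1 \<le> k" "k \<le> n" "z = \<rho> k" by (auto simp: Z_def)
        have "\<bar>Re (3 - z)\<bar> \<le> 4" using zeta_zero_location(1)[OF zer(1,2)[OF k(1)]] k(3) by (simp add: abs_if split: if_splits)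
        moreover have "\<bar>Im (3 - z)\<bar> \<le> T" using zer(2)[OF k(1)] mono[OF k(1,2)] k(3) by (simp add: T_def)
        ultimately have "norm (3 - z) \<le> T + 4" using cmod_le[of "3 - z"] by linarith
        then show "z \<in> cball 3 (T + 4)" by (simp add: dist_norm)
      qed
      fix w :: complex assume w: "norm (w - 3) = 3 * (T + 4)"
      have "norm w \<le> 3 + 3 * (T + 4)" using norm_triangle_ineq[of "w - 3" 3] w by simp
      then show "norm (ezeta w) \<le> exp (A * (3 + 3 * (T + 4))\<^sup>2)" using T by (intro A) auto
    qed (use T e3 holomorphic_ezeta in auto)
    \<comment> \<open>The indices 1 to n are grouped by the value of \<open>\<rho>\<close>; each
      group has at most as many members as the multiplicity of that zero.\<close>
    moreover have "n \<le> (\<Sum>z\<in>Z. nat (zorder ezeta z))"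
    proof -
      have "{1..n} = (\<Union>z\<in>Z. {k \<in> {1..n}. \<rho> k = z})" by (auto simp: Z_def)
      then have "n = card (\<Union>z\<in>Z. {k \<in> {1..n}. \<rho> k = z})" by (metis card_atLeastAtMost diff_Suc_1)
      also have "\<dots> \<le> (\<Sum>z\<in>Z. card {k \<in> {1..n}. \<rho> k = z})" by (rule card_UN_le) (simp add: Z_def)
      also have "\<dots> \<le> (\<Sum>z\<in>Z. nat (zorder ezeta z))"
      proof (rule sum_mono)
        fix z assume "z \<in> Z"
        then have z: "zeta z = 0" "Im z > 0" using zer by (auto simp: Z_def)
        have "card {k \<in> {1..n}. \<rho> k = z} \<le> card {k. k \<ge> 1 \<and> \<rho> k = z}"
          using mult(1)[OF z] by (intro card_mono) auto
        also have "\<dots> = nat (zorder zeta z)" using mult(2)[OF z] by linarith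
        also have "zorder zeta z = zorder ezeta z" using z by (intro zorder_ezeta[symmetric]) auto
        finally show "card {k \<in> {1..n}. \<rho> k = z} \<le> nat (zorder ezeta z)" .
      qed
      finally show ?thesis .
    qed
    then have "norm (ezeta 3) * 2 ^ n \<le> norm (ezeta 3) * 2 ^ (\<Sum>z\<in>Z. nat (zorder ezeta z))"
      by (intro mult_left_mono power_increasing) auto
    ultimately have "norm (ezeta 3) * 2 ^ n \<le> exp (A * (3 + 3 * (T + 4))\<^sup>2)" by linarith
    then have "ln (norm (ezeta 3) * 2 ^ n) \<le> ln (exp (A * (3 + 3 * (T + 4))\<^sup>2))"
      using e3 by (intro ln_mono) auto
    then have "ln (norm (ezeta 3)) + real n * ln 2 \<le> A * (3 + 3 * (T + 4))\<^sup>2"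
      using e3 by (simp add: ln_mult ln_realpow)
    moreover have "1/2 \<le> ln (2::real)" using ln2_ge_two_thirds by simp
    then have "real n * (1/2) \<le> real n * ln 2" by (intro mult_left_mono) auto
    ultimately have "real n * (1/2) \<le> A * (3 + 3 * (T + 4))\<^sup>2 + L" unfolding L_def by linarith
    also have "\<dots> \<le> A * (225 * (1 + T)\<^sup>2) + L * (1 + T)\<^sup>2"
    proof (intro add_mono mult_left_mono)
      have "(3 + 3 * (T + 4))\<^sup>2 \<le> (15 * (1 + T))\<^sup>2" using T by (intro power_mono) auto
      then show "(3 + 3 * (T + 4))\<^sup>2 \<le> 225 * (1 + T)\<^sup>2" by (simp only: power_mult_distrib) simp
      have "1 \<le> (1 + T)\<^sup>2" using T by (intro one_le_power) auto
      then show "L \<le> L * (1 + T)\<^sup>2" using T by (simp add: L_def mult_le_cancel_left1)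
    qed (use A in auto)
    finally show ?thesis by (simp add: C_def T_def algebra_simps)
  qed
  moreover have "C > 0" using A by (simp add: C_def L_def add_pos_nonneg)
  ultimately show ?thesis using that by blast
qed

section \<open>The theta series and its truncated Mellin transform\<close>

text \<open>With \<alpha> = g + i d and z = x + i y, the real part is x (g^2 - d^2) - 2 y g d. Half
  of x g^2 absorbs the mixed term, the other half dominates n through (1 + g)^2 <= 2 + 2 g^2. The
  constant 11/4 is 9/4 from d^2 plus 1/2 from this last step.\<close>

lemma Re_square_mult_ge:
  fixes \<alpha> z :: complex
  assumes d: "\<bar>Im \<alpha>\<bar> \<le> 3/2" and g: "Re \<alpha> > 0" and z: "Re z > 0" and C: "C > 0"
    and n: "real n \<le> C * (1 + Re \<alpha>)\<^sup>2"
  shows "Re (\<alpha>\<^sup>2 * z) \<ge> Re z / (4 * C) * real n - (11/4 * Re z + 9 * (Im z)\<^sup>2 / (2 * Re z))"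
proof -
  define x y g d where "x = Re z" and "y = Im z" and "g = Re \<alpha>" and "d = Im \<alpha>"
  have x: "x > 0" using z by (simp add: x_def)
  have eq: "Re (\<alpha>\<^sup>2 * z) = x * (g\<^sup>2 - d\<^sup>2) - 2 * y * g * d"
    by (simp add: x_def y_def g_def d_def power2_eq_square algebra_simps)
  have "d\<^sup>2 \<le> (3/2)\<^sup>2" using d by (subst abs_le_square_iff[symmetric]) (simp add: d_def)
  then have "x * d\<^sup>2 \<le> x * (9/4)" using x by (intro mult_left_mono) (auto simp: power2_eq_square)
  moreover have "2 * y * g * d \<le> 3 * \<bar>y\<bar> * g"
  proof -
    have "2 * y * g * d \<le> 2 * g * (\<bar>y\<bar> * \<bar>d\<bar>)"
      using abs_ge_self[of "y * d"] g by (simp add: abs_mult g_def mult_ac)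
    also have "\<dots> \<le> 2 * g * (\<bar>y\<bar> * (3/2))" using d g by (intro mult_left_mono) (auto simp: d_def g_def)
    finally show ?thesis by (simp add: mult_ac)
  qed
  \<comment> \<open>Completing the square in g, which is where the loss 9 y^2/(2x)
    originates.\<close>
  moreover have "x / 2 * g\<^sup>2 - 3 * \<bar>y\<bar> * g + 9 * y\<^sup>2 / (2 * x) \<ge> 0"
  proof -
    have "x / 2 * (g - 3 * \<bar>y\<bar> / x)\<^sup>2 = x / 2 * g\<^sup>2 - 3 * \<bar>y\<bar> * g + 9 * y\<^sup>2 / (2 * x)"
      using x by (simp add: power2_eq_square field_simps)
    then show ?thesis using x by (metis divide_nonneg_pos less_imp_le mult_nonneg_nonneg zero_le_power2 zero_less_numeral)
  qed
  moreover have "x / (4 * C) * real n \<le> x / 4 * (1 + g)\<^sup>2"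
  proof -
    have "x / (4 * C) * real n \<le> x / (4 * C) * (C * (1 + g)\<^sup>2)"
      using n x C by (intro mult_left_mono) (auto simp: g_def)
    then show ?thesis using C by simp
  qed
  moreover have "x / 4 * (1 + g)\<^sup>2 \<le> x / 2 + x / 2 * g\<^sup>2"
  proof -
    have "(1 + g)\<^sup>2 \<le> 2 + 2 * g\<^sup>2" using zero_le_power2[of "1 - g"] by (simp add: power2_eq_square algebra_simps)
    then have "x / 4 * (1 + g)\<^sup>2 \<le> x / 4 * (2 + 2 * g\<^sup>2)" using x by (intro mult_left_mono) auto
    then show ?thesis by (simp add: algebra_simps)
  qed
  ultimately have "x * (g\<^sup>2 - d\<^sup>2) - 2 * y * g * d \<ge> x / (4 * C) * real n - (11/4 * x + 9 * y\<^sup>2 / (2 * x))"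
    by (simp add: right_diff_distrib)
  then show ?thesis unfolding eq by (simp add: x_def y_def)
qed

lemma summable_exp_minus_linear:
  fixes v :: "nat \<Rightarrow> real"
  assumes c: "c > 0" and v: "\<And>n. v n \<ge> c * real (Suc n) - D"
  shows "summable (\<lambda>n. exp (- v n))"
proof (rule summable_comparison_test')
  have "summable (\<lambda>n. exp (- c) ^ n)" using c by (intro summable_geometric) auto
  then show "summable (\<lambda>n. exp D * exp (- c) ^ n)" by (rule summable_mult)
  fix n :: nat
  have "- v n \<le> D + real n * (- c)" using v[of n] c by (simp add: algebra_simps)
  then have "exp (- v n) \<le> exp (D + real n * (- c))" by (simp only: exp_le_cancel_iff)
  then show "norm (exp (- v n)) \<le> exp D * exp (- c) ^ n" by (simp only: exp_add exp_of_nat_mult) simp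
qed

text \<open>For Re \<alpha> > 0 the argument is below pi/2 in absolute value, so doubling it stays
  in the principal range.\<close>

lemma powr_square:
  assumes "Re \<alpha> > 0"
  shows "(\<alpha>\<^sup>2) powr w = \<alpha> powr (2 * w)"
proof -
  have nz: "\<alpha> \<noteq> 0" using assms by auto
  have "\<bar>Im (Ln \<alpha>)\<bar> < pi / 2" using Re_Ln_pos_lt[OF nz] assms by simp
  then have "Ln (\<alpha> * \<alpha>) = Ln \<alpha> + Ln \<alpha>" using nz by (intro Ln_times_simple) auto
  then show ?thesis using nz by (simp add: powr_def power2_eq_square algebra_simps)
qed

text \<open>Gives a single majorant for exponents that vary in an interval, whether the base is
  below or above 1.\<close>

lemma powr_le_sum_powr:
  fixes x p q1 q2 :: real
  assumes "x > 0" "q1 \<le> p" "p \<le> q2"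
  shows "x powr p \<le> x powr q1 + x powr q2"
proof (cases "x \<ge> 1")
  case True
  then have "x powr p \<le> x powr q2" using assms by (intro powr_mono) auto
  then show ?thesis by (simp add: add_increasing)
next
  case False
  then have "x powr p \<le> x powr q1" using assms by (intro powr_mono') auto
  then show ?thesis by (simp add: add_increasing2)
qed

section \<open>Termwise integration of an exponential series over [a, infinity)\<close>

context
  fixes w :: "nat \<Rightarrow> complex" and a \<kappa> :: real
  assumes a: "a > 0" and \<kappa>: "\<kappa> > 0" and w: "\<And>n. \<kappa> \<le> Re (w n)"
    and sm: "summable (\<lambda>n. exp (- (Re (w n) * a)))"
begin

text \<open>Splitting x as a + (x - a) separates the two roles: the value at \<open>a\<close> is
  summable in n, the rest decays in x at a rate independent of n.\<close>

lemma exp_series_term_le: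
  assumes x: "x \<ge> a"
  shows "norm (exp (- (w n * of_real x))) \<le> exp (- (Re (w n) * a)) * exp (- (\<kappa> * (x - a)))"
proof -
  have "\<kappa> * (x - a) \<le> Re (w n) * (x - a)" using w[of n] x by (intro mult_right_mono) auto
  then have "- (Re (w n) * x) \<le> - (Re (w n) * a) + - (\<kappa> * (x - a))" by (simp add: algebra_simps)
  then have "exp (- (Re (w n) * x)) \<le> exp (- (Re (w n) * a) + - (\<kappa> * (x - a)))" by (simp only: exp_le_cancel_iff)
  then show ?thesis by (simp only: exp_add) (simp add: norm_exp_eq_Re)
qed

lemma exp_series_summable:
  assumes x: "x \<ge> a"
  shows "summable (\<lambda>n. norm (exp (- (w n * of_real x))))"
proof (rule summable_comparison_test')
  show "summable (\<lambda>n. exp (- (Re (w n) * a)) * exp (- (\<kappa> * (x - a))))" using sm by (rule summable_mult2)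
qed (use exp_series_term_le[OF x] in auto)

lemma exp_series_norm_le:
  assumes x: "x \<ge> a"
  shows "norm (\<Sum>n. exp (- (w n * of_real x))) \<le> (\<Sum>n. exp (- (Re (w n) * a))) * exp (- (\<kappa> * (x - a)))"
proof -
  have "norm (\<Sum>n. exp (- (w n * of_real x))) \<le> (\<Sum>n. exp (- (Re (w n) * a)) * exp (- (\<kappa> * (x - a))))"
    by (rule norm_suminf_le[OF exp_series_term_le[OF x] summable_mult2[OF sm]])
  then show ?thesis using suminf_mult2[OF sm] by simp
qed

text \<open>Each summand is dominated by exp(-Re (w n) a) times one fixed integrable function of x,
  so sum and integral may be exchanged. Every complex \<open>z\<close> is allowed because the range
  of integration stays away from 0.\<close>

lemma
  shows set_integrable_exp_series:
      "set_integrable lborel {a..} (\<lambda>x. complex_of_real x powr (z - 1) * (\<Sum>n. exp (- (w n * of_real x))))"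
    and integral_exp_series_sums:
      "(\<lambda>n. upper_Gamma z (of_real a * w n) * w n powr (- z)) sums
        (LBINT x:{a..}. complex_of_real x powr (z - 1) * (\<Sum>n. exp (- (w n * of_real x))))"
proof -
  define f where "f n x = indicat_real {a..} x *\<^sub>R (complex_of_real x powr (z - 1) * exp (- (w n * of_real x)))" for n x
  have wp: "Re (w n) > 0" for n using w[of n] \<kappa> by linarith
  have f1: "integrable lborel (f n)" for n
    using set_integrable_cpowr_exp_Ici[OF a wp] by (simp only: f_def[abs_def] set_integrable_def)
  have f2: "AE x in lborel. summable (\<lambda>n. norm (f n x))"
  proof (rule AE_I2)
    fix x show "summable (\<lambda>n. norm (f n x))"
    proof (cases "x \<ge> a")
      case True
      then have "(\<lambda>n. norm (f n x)) = (\<lambda>n. norm (complex_of_real x powr (z - 1)) * norm (exp (- (w n * of_real x))))"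
        by (simp add: f_def fun_eq_iff norm_mult)
      then show ?thesis using summable_mult[OF exp_series_summable[OF True]] by simp
    qed (simp add: f_def)
  qed
  define g where "g x = indicat_real {a..} x *\<^sub>R (exp (\<kappa> * a) * (x powr (Re z - 1) * exp (- (\<kappa> * x))))" for x
  have gi: "integrable lborel g"
    using set_integrable_mult_right[OF set_integrable_powr_exp_Ici[OF a \<kappa>], of "exp (\<kappa> * a)"]
    by (simp only: g_def[abs_def] set_integrable_def)
  have le: "norm (f n x) \<le> exp (- (Re (w n) * a)) * g x" for n x
  proof (cases "x \<ge> a")
    case True
    have "norm (f n x) = x powr (Re z - 1) * norm (exp (- (w n * of_real x)))"
      using True a by (simp add: f_def norm_mult norm_of_real_powr)
    also have "\<dots> \<le> x powr (Re z - 1) * (exp (- (Re (w n) * a)) * exp (- (\<kappa> * (x - a))))"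
      using exp_series_term_le[OF True] by (intro mult_left_mono) auto
    also have "exp (- (\<kappa> * (x - a))) = exp (\<kappa> * a) * exp (- (\<kappa> * x))"
      by (simp add: algebra_simps flip: exp_add)
    also have "x powr (Re z - 1) * (exp (- (Re (w n) * a)) * (exp (\<kappa> * a) * exp (- (\<kappa> * x)))) = exp (- (Re (w n) * a)) * g x"
      using True by (simp add: g_def mult_ac)
    finally show ?thesis .
  qed (simp add: f_def g_def)
  have f3: "summable (\<lambda>n. \<integral>x. norm (f n x) \<partial>lborel)"
  proof (rule summable_comparison_test')
    show "summable (\<lambda>n. exp (- (Re (w n) * a)) * (\<integral>x. g x \<partial>lborel))" using sm by (rule summable_mult2)
    fix n :: nat
    have "(\<integral>x. norm (f n x) \<partial>lborel) \<le> (\<integral>x. exp (- (Re (w n) * a)) * g x \<partial>lborel)"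
      by (rule integral_mono[OF integrable_norm[OF f1] integrable_mult_right[OF gi] le])
    then show "norm (\<integral>x. norm (f n x) \<partial>lborel) \<le> exp (- (Re (w n) * a)) * (\<integral>x. g x \<partial>lborel)" by simp
  qed
  have eq: "(\<lambda>x. \<Sum>n. f n x) = (\<lambda>x. indicat_real {a..} x *\<^sub>R (complex_of_real x powr (z - 1) * (\<Sum>n. exp (- (w n * of_real x)))))"
  proof
    fix x show "(\<Sum>n. f n x) = indicat_real {a..} x *\<^sub>R (complex_of_real x powr (z - 1) * (\<Sum>n. exp (- (w n * of_real x))))"
    proof (cases "x \<ge> a")
      case True
      then show ?thesis
        using suminf_mult[OF summable_norm_cancel[OF exp_series_summable[OF True]], of "complex_of_real x powr (z - 1)"]
        by (simp add: f_def)
    qed (simp add: f_def)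
  qed
  show "set_integrable lborel {a..} (\<lambda>x. complex_of_real x powr (z - 1) * (\<Sum>n. exp (- (w n * of_real x))))"
    using integrable_suminf[OF f1 f2 f3] unfolding eq by (simp only: set_integrable_def)
  have "integral\<^sup>L lborel (f n) = upper_Gamma z (of_real a * w n) * w n powr (- z)" for n
    using integral_powr_exp_Ici[OF a wp, of z n] by (simp only: f_def[abs_def] set_lebesgue_integral_def)
  then show "(\<lambda>n. upper_Gamma z (of_real a * w n) * w n powr (- z)) sums
        (LBINT x:{a..}. complex_of_real x powr (z - 1) * (\<Sum>n. exp (- (w n * of_real x))))"
    using sums_integral[OF f1 f2 f3] unfolding eq by (simp only: set_lebesgue_integral_def)
qed

lemma holomorphic_integral_exp_series:
  "(\<lambda>z. LBINT x:{a..}. complex_of_real x powr (z - 1) * (\<Sum>n. exp (- (w n * of_real x)))) holomorphic_on UNIV"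
proof (rule holomorphic_on_set_integral)
  show "set_borel_measurable lborel {a..} (\<lambda>x. complex_of_real x powr (z - 1) * (\<Sum>n. exp (- (w n * of_real x))))" for z
    using set_integrable_exp_series[of z] by (simp add: set_integrable_def set_borel_measurable_def)
  show "(\<lambda>z. complex_of_real x powr (z - 1) * (\<Sum>n. exp (- (w n * of_real x)))) holomorphic_on UNIV" if "x \<in> {a..}" for x
    by (intro holomorphic_intros)
  fix z0 :: complex
  define S where "S = (\<Sum>n. exp (- (Re (w n) * a))) * exp (\<kappa> * a)"
  \<comment> \<open>For |z - z0| <= 1 the exponent Re z - 1 ranges over [Re z0 - 2, Re z0]; both end
    exponents enter the majorant.\<close>
  let ?g = "\<lambda>x. S * (x powr (Re z0 - 2) * exp (- (\<kappa> * x)) + x powr (Re z0) * exp (- (\<kappa> * x)))"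
  have "set_integrable lborel {a..} ?g"
    by (intro set_integrable_mult_right set_integral_add(1) set_integrable_powr_exp_Ici a \<kappa>)
  moreover have "norm (complex_of_real x powr (z - 1) * (\<Sum>n. exp (- (w n * of_real x)))) \<le> ?g x"
    if z: "dist z0 z \<le> 1" and x: "x \<in> {a..}" for z x
  proof -
    have xa: "x \<ge> a" "x > 0" using x a by auto
    have "\<bar>Re z0 - Re z\<bar> \<le> 1" using z abs_Re_le_cmod[of "z0 - z"] by (simp add: dist_norm)
    then have p: "x powr (Re z - 1) \<le> x powr (Re z0 - 2) + x powr (Re z0)"
      using xa by (intro powr_le_sum_powr) (auto simp: abs_le_iff)
    have "norm (\<Sum>n. exp (- (w n * of_real x))) \<le> (\<Sum>n. exp (- (Re (w n) * a))) * exp (- (\<kappa> * (x - a)))"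
      by (rule exp_series_norm_le[OF xa(1)])
    also have "exp (- (\<kappa> * (x - a))) = exp (\<kappa> * a) * exp (- (\<kappa> * x))"
      by (simp add: algebra_simps flip: exp_add)
    finally have t: "norm (\<Sum>n. exp (- (w n * of_real x))) \<le> S * exp (- (\<kappa> * x))" by (simp add: S_def mult_ac)
    have "norm (complex_of_real x powr (z - 1) * (\<Sum>n. exp (- (w n * of_real x)))) \<le>
        (x powr (Re z0 - 2) + x powr (Re z0)) * (S * exp (- (\<kappa> * x)))"
      unfolding norm_mult using p t xa by (intro mult_mono) (auto simp: norm_of_real_powr)
    then show ?thesis by (simp add: algebra_simps)
  qed
  ultimately show "\<exists>r>0. \<exists>g. set_integrable lborel {a..} g \<and> (\<forall>z\<in>UNIV. dist z0 z \<le> r \<longrightarrow>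
      (\<forall>x\<in>{a..}. norm (complex_of_real x powr (z - 1) * (\<Sum>n. exp (- (w n * of_real x)))) \<le> g x))"
    by (intro exI[of _ 1] conjI exI[of _ ?g]) auto
qed auto

end

theorem theorem3p4:
  fixes \<rho> \<alpha> :: "nat \<Rightarrow> complex" and a :: real
  assumes "upper_zeta_zeros \<rho>"
    and "\<And>n. n \<ge> 1 \<Longrightarrow> \<rho> n = 1 / 2 + \<i> * \<alpha> n"
    and "a > 0"
  shows "(\<forall>z. Re z > 0 \<longrightarrow> summable (\<lambda>n. exp (- ((\<alpha> (Suc n))\<^sup>2 * z)))) \<and>
    (\<forall>s. Re s > 1 \<longrightarrow> set_integrable lborel {a..} (A_integrand \<alpha> s)) \<and>
    (\<exists>B. B holomorphic_on UNIV \<and>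
       (\<forall>s. Re s > 1 \<longrightarrow> B s = A_fun \<alpha> a s) \<and>
       (\<forall>s. (\<lambda>n. upper_Gamma (s / 2) (of_real a * (\<alpha> (Suc n))\<^sup>2) * rGamma (s / 2)
               * (1 / \<alpha> (Suc n) powr s)) sums B s))"
proof -
  note a = assms(3)
  \<comment> \<open>Shifts the numbering from 1 to 0, as the series over \<open>nat\<close>
    require.\<close>
  define b where "b n = \<alpha> (Suc n)" for n
  have b: "Re (b n) = Im (\<rho> (Suc n))" "Im (b n) = 1/2 - Re (\<rho> (Suc n))" for n
    using assms(2)[of "Suc n"] by (auto simp: b_def)
  have zz: "zeta (\<rho> (Suc n)) = 0" "Im (\<rho> (Suc n)) > 0" for n
    using assms(1) by (auto simp: upper_zeta_zeros_def)
  \<comment> \<open>As Re \<alpha> = Im \<rho> and Im \<alpha> = 1/2 - Re \<rho>, the location of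
    the zeros reads |Im \<alpha>| < Re \<alpha>, which amounts to Re(\<alpha>^2) > 0.\<close>
  have bpos: "Re (b n) > 0" and bim: "\<bar>Im (b n)\<bar> \<le> 3/2" and bwedge: "\<bar>Im (b n)\<bar> < Re (b n)" for n
    using zz(2)[of n] zeta_zero_location[OF zz, of n] by (simp_all add: b abs_minus_commute)
  obtain C where C: "C > 0" "\<And>n. n \<ge> 1 \<Longrightarrow> real n \<le> C * (1 + Im (\<rho> n))\<^sup>2"
    using zeta_zeros_count[OF assms(1)] by blast
  have lower: "Re ((b n)\<^sup>2 * z) \<ge> Re z / (4 * C) * real (Suc n) - (11/4 * Re z + 9 * (Im z)\<^sup>2 / (2 * Re z))"
    if "Re z > 0" for n z
    by (rule Re_square_mult_ge[OF bim bpos that C(1)]) (use C(2)[of "Suc n"] b in simp)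
  have summ: "summable (\<lambda>n. exp (- Re ((b n)\<^sup>2 * z)))" if "Re z > 0" for z
    by (rule summable_exp_minus_linear[OF _ lower[OF that]]) (use that C in auto)
  have sum1: "summable (\<lambda>n. exp (- ((b n)\<^sup>2 * z)))" if "Re z > 0" for z
    by (rule summable_norm_cancel) (use summ[OF that] in \<open>simp add: norm_exp_eq_Re\<close>)
  have wpos: "Re ((b n)\<^sup>2) > 0" for n
  proof -
    have "(Im (b n))\<^sup>2 < (Re (b n))\<^sup>2" using power_strict_mono[OF bwedge[of n], of 2] by simp
    then show ?thesis by (simp add: power2_eq_square)
  qed
  obtain \<kappa> where \<kappa>: "\<kappa> > 0" "\<And>n. \<kappa> \<le> Re ((b n)\<^sup>2)"
  proof -
    \<comment> \<open>The lower bound at z = 1 is (n+1)/(4C) - 11/4, hence at least 1 from this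
      index on. The finitely many earlier values are positive by \<open>wpos\<close>, so a minimum
      yields \<open>\<kappa>\<close>.\<close>
    define N where "N = nat \<lceil>(11/4 + 1) * (4 * C)\<rceil>"
    have big: "Re ((b n)\<^sup>2) \<ge> 1" if "n \<ge> N" for n
    proof -
      have "(11/4 + 1) * (4 * C) \<le> real N" unfolding N_def by linarith
      also have "\<dots> \<le> real (Suc n)" using that by simp
      finally have "11/4 + 1 \<le> 1 / (4 * C) * real (Suc n)" using C by (simp add: field_simps)
      moreover have "1 / (4 * C) * real (Suc n) - 11/4 \<le> Re ((b n)\<^sup>2)"
        using lower[of 1 n] by (simp del: of_nat_Suc)
      ultimately show ?thesis by linarith
    qed
    define \<kappa> where "\<kappa> = Min (insert 1 ((\<lambda>n. Re ((b n)\<^sup>2)) ` {..<N}))"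
    have "\<kappa> > 0" unfolding \<kappa>_def by (subst Min_gr_iff) (use wpos in auto)
    moreover have "\<kappa> \<le> Re ((b n)\<^sup>2)" for n
    proof (cases "n < N")
      case True
      then show ?thesis unfolding \<kappa>_def by (intro Min_le) auto
    next
      case False
      have "\<kappa> \<le> 1" unfolding \<kappa>_def by (intro Min_le) auto
      then show ?thesis using big[of n] False by linarith
    qed
    ultimately show ?thesis using that by blast
  qed
  have sma: "summable (\<lambda>n. exp (- (Re ((b n)\<^sup>2) * a)))"
    using summ[of "of_real a"] a by simp
  note ctx = a \<kappa> sma
  let ?I = "\<lambda>z. LBINT x:{a..}. complex_of_real x powr (z - 1) * (\<Sum>n. exp (- ((b n)\<^sup>2 * of_real x)))"
  have Aeq: "A_integrand \<alpha> s x = complex_of_real x powr (s / 2 - 1) * (\<Sum>n. exp (- ((b n)\<^sup>2 * of_real x)))"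
    if "x \<in> {a..}" for s x
    using that a by (simp add: A_integrand_def theta_series_def b_def powr_diff)
  have Aint: "(LBINT x:{a..}. A_integrand \<alpha> s x) = ?I (s / 2)" for s
    by (intro set_lebesgue_integral_cong) (use Aeq in auto)
  have "set_integrable lborel {a..} (A_integrand \<alpha> s)" for s
    using set_integrable_exp_series[of a \<kappa> "\<lambda>n. (b n)\<^sup>2" "s / 2", OF ctx]
    by (subst set_integrable_cong[OF refl refl Aeq])
  \<comment> \<open>The integral over [a, infinity) converges for every \<open>s\<close> and
    \<open>rGamma\<close> is entire, so \<open>A_fun\<close> is its own entire extension and serves
    as the witness \<open>B\<close>.\<close>
  moreover have "A_fun \<alpha> a holomorphic_on UNIV"
  proof -
    have "(?I \<circ> (\<lambda>s. s / 2)) holomorphic_on UNIV"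
      by (rule holomorphic_on_compose_gen[OF _ holomorphic_integral_exp_series[of a \<kappa> "\<lambda>n. (b n)\<^sup>2", OF ctx]])
         (auto intro!: holomorphic_intros)
    then have I: "(\<lambda>s. ?I (s / 2)) holomorphic_on UNIV" by (simp only: o_def)
    have "(\<lambda>s. rGamma (s / 2) * ?I (s / 2)) holomorphic_on UNIV"
      by (intro holomorphic_intros I) auto
    then show ?thesis unfolding A_fun_def Aint .
  qed
  moreover have "(\<lambda>n. upper_Gamma (s / 2) (of_real a * (\<alpha> (Suc n))\<^sup>2) * rGamma (s / 2)
               * (1 / \<alpha> (Suc n) powr s)) sums A_fun \<alpha> a s" for s
  proof -
    have "(\<lambda>n. rGamma (s / 2) * (upper_Gamma (s / 2) (of_real a * (b n)\<^sup>2) * (b n)\<^sup>2 powr (- (s / 2)))) sums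
        (rGamma (s / 2) * ?I (s / 2))"
      by (intro sums_mult integral_exp_series_sums[of a \<kappa> "\<lambda>n. (b n)\<^sup>2", OF ctx])
    moreover have "(b n)\<^sup>2 powr (- (s / 2)) = 1 / b n powr s" for n
      unfolding powr_square[OF bpos] by (simp add: powr_minus inverse_eq_divide)
    ultimately show ?thesis unfolding A_fun_def Aint by (simp add: b_def mult_ac)
  qed
  ultimately show ?thesis using sum1 unfolding b_def by blast
qed

end
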